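(* Let $(\Omega,\mathcal F,\mathbb P)$ be a complete probability space with a filtration $(\mathcal F_n)_{n\ge0}$ such that $\mathcal F=\sigma(\bigcup_n\mathcal F_n)$ and every $\mathcal F_n$ is generated by countably many atoms. Let $p(\cdot):\Omega\to(0,\infty)$ be measurable with $0<p_-\le p_+<\infty$, and assume there is a constant $K\ge1$ such that $\mathbb P(A)^{p_-(A)-p_+(A)}\le K$ for every atom $A$ of every $\mathcal F_n$. Then the following inequalities hold for all martingales $f$ in the space on the right-hand side, with a constant $C$ independent of $f$: (1) $\|f\|_{H^M_{p(\cdot)}}\le C\|f\|_{H^s_{p(\cdot)}}$ and $\|f\|_{H^S_{p(\cdot)}}\le C\|f\|_{H^s_{p(\cdot)}}$, if $0<p_-\le p_+<2$; (2) $\|f\|_{H^M_{p(\cdot)}}\le\|f\|_{P_{p(\cdot)}}$ and $\|f\|_{H^S_{p(\cdot)}}\le\|f\|_{Q_{p(\cdot)}}$; (3) $\|f\|_{H^S_{p(\cdot)}}\le C\|f\|_{P_{p(\cdot)}}$ and $\|f\|_{H^M_{p(\cdot)}}\le C\|f\|_{Q_{p(\cdot)}}$; (4) $\|f\|_{H^s_{p(\cdot)}}\le C\|f\|_{P_{p(\cdot)}}$ and $\|f\|_{H^s_{p(\cdot)}}\le C\|f\|_{Q_{p(\cdot)}}$; (5) $\|f\|_{P_{p(\cdot)}}\le C\|f\|_{Q_{p(\cdot)}}$ and $\|f\|_{Q_{p(\cdot)}}\le C\|f\|_{P_{p(\cdot)}}$. Moreover, if $(\mathcal F_n)_{n\ge0}$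 is regular, then $$H^S_{p(\cdot)}=Q_{p(\cdot)}=P_{p(\cdot)}=H^M_{p(\cdot)}=H^s_{p(\cdot)}$$ with equivalent quasi-norms.
   Context: For measurable $A$, $p_-(A)=\operatorname{ess\,inf}_Ap$, $p_+(A)=\operatorname{ess\,sup}_Ap$; $p_\pm=p_\pm(\Omega)$; $\|f\|_{p(\cdot)}=\inf\{\lambda>0:\int_\Omega(|f|/\lambda)^{p(x)}d\mathbb P\le1\}$, $L_{p(\cdot)}$ the corresponding space. $B\in\mathcal F_n$ (of positive measure) is an atom of $\mathcal F_n$ if every $A\subset B$, $A\in\mathcal F_n$ with $\mathbb P(A)<\mathbb P(B)$ has $\mathbb P(A)=0$. $(\mathcal F_n)$ is regular if there is $R>0$ such that for all $n\ge1$ and $A\in\mathcal F_n$ there is $B\in\mathcal F_{n-1}$ with $A\subset B$ and $\mathbb P(B)\le R\,\mathbb P(A)$. Martingales $f=(f_n)_{n\ge0}$ are with respect to $(\mathcal F_n)$; $f_{-1}=0$, $d_nf=f_n-f_{n-1}$, $\mathbb E_n=\mathbb E(\cdot|\mathcal F_n)$, $\mathbb E_{-1}:=\mathbb E_0$. $M(f)=\sup_n|f_n|$, $S_n(f)=(\sum_{k=0}^n|d_kf|^2)^{1/2}$, $S(f)=\lim_nS_n(f)$, $s(f)=(\sum_{n\ge0}\mathbb E_{n-1}|d_nf|^2)^{1/2}$. $H^M_{p(\cdot)}$, $H^S_{p(\cdot)}$, $H^s_{p(\cdot)}$ are the spaces of martingales for which $\|M(f)\|_{p(\cdot)}$, $\|S(f)\|_{p(\cdot)}$,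 $\|s(f)\|_{p(\cdot)}$, respectively, is finite, with that quantity as quasi-norm. $\Lambda$ is the set of non-decreasing, non-negative, adapted sequences $(\lambda_n)_{n\ge0}$, with $\lambda_\infty=\lim\lambda_n$. $Q_{p(\cdot)}$ (resp. $P_{p(\cdot)}$) is the set of martingales $f$ for which there is $(\lambda_n)\in\Lambda$ with $\lambda_\infty\in L_{p(\cdot)}$ and $S_n(f)\le\lambda_{n-1}$ (resp. $|f_n|\le\lambda_{n-1}$) for all $n\ge1$; the quasi-norm is the infimum of $\|\lambda_\infty\|_{p(\cdot)}$ over all such $(\lambda_n)$. *)

theory Defs
  imports "HOL-Probability.Probability" "HOL-Probability.Essential_Supremum"
    "HOL-Probability.Stopping_Time"
begin

section \<open>Variable exponents and the space \<open>L\<^sub>p\<^sub>(\<^sub>\<cdot>\<^sub>)\<close>\<close>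

definition p_plus :: "'a measure \<Rightarrow> ('a \<Rightarrow> real) \<Rightarrow> 'a set \<Rightarrow> ereal" where
  "p_plus M p A = esssup (restrict_space M A) (\<lambda>x. ereal (p x))"

text \<open>The library has no essential infimum; it is written as \<open>ess inf p = - ess sup (- p)\<close>.\<close>

definition p_minus :: "'a measure \<Rightarrow> ('a \<Rightarrow> real) \<Rightarrow> 'a set \<Rightarrow> ereal" where
  "p_minus M p A = - esssup (restrict_space M A) (\<lambda>x. - ereal (p x))"

text \<open>Real powers of extended nonnegative numbers, used only for positive exponents,
  where \<open>\<infinity>\<close> to the power \<open>r\<close> is \<open>\<infinity>\<close>.\<close>

definition epowr :: "ennreal \<Rightarrow> real \<Rightarrow> ennreal" where
  "epowr t r = (if t = \<infinity> then \<infinity> else ennreal (enn2real t powr r))"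

text \<open>All functions whose quasi-norm is taken below are nonnegative and may a priori take the
  value \<open>\<infinity>\<close>, so the Luxemburg quasi-norm is defined on \<^typ>\<open>ennreal\<close>-valued functions, with values
  in \<^typ>\<open>ennreal\<close>. The infimum of the empty set is \<open>\<infinity>\<close>.\<close>

definition Lp_norm :: "'a measure \<Rightarrow> ('a \<Rightarrow> real) \<Rightarrow> ('a \<Rightarrow> ennreal) \<Rightarrow> ennreal" where
  "Lp_norm M p g =
     (INF l\<in>{l::real. 0 < l \<and> (\<integral>\<^sup>+x. epowr (g x / ennreal l) (p x) \<partial>M) \<le> 1}. ennreal l)"

definition Lp_space :: "'a measure \<Rightarrow> ('a \<Rightarrow> real) \<Rightarrow> ('a \<Rightarrow> ennreal) set" where
  "Lp_space M p = {g. g \<in> borel_measurable M \<and> Lp_norm M p g < \<infinity>}"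


section \<open>Atoms, regularity, martingales\<close>

text \<open>A sub-\<open>\<sigma>\<close>-algebra of \<^term>\<open>M\<close> is represented, as in
  \<^theory>\<open>HOL-Probability.Conditional_Expectation\<close>, by a measure \<^term>\<open>G\<close> of which only the measurable
  sets matter; probabilities are always taken in \<^term>\<open>M\<close>.\<close>

definition is_atom :: "'a measure \<Rightarrow> 'a measure \<Rightarrow> 'a set \<Rightarrow> bool" where
  "is_atom M G B \<longleftrightarrow> B \<in> sets G \<and> 0 < measure M B \<and>
     (\<forall>A\<in>sets G. A \<subseteq> B \<and> measure M A < measure M B \<longrightarrow> measure M A = 0)"

definition generated_by_countably_many_atoms :: "'a measure \<Rightarrow> 'a measure \<Rightarrow> bool" where
  "generated_by_countably_many_atoms M G \<longleftrightarrow>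
     (\<exists>\<A>. countable \<A> \<and> (\<forall>A\<in>\<A>. is_atom M G A) \<and> sets G = sigma_sets (space M) \<A>)"

definition regular_filtration :: "'a measure \<Rightarrow> (nat \<Rightarrow> 'a measure) \<Rightarrow> bool" where
  "regular_filtration M F \<longleftrightarrow>
     (\<exists>R::real. 0 < R \<and>
       (\<forall>n\<ge>1. \<forall>A\<in>sets (F n). \<exists>B\<in>sets (F (n - 1)). A \<subseteq> B \<and> measure M B \<le> R * measure M A))"

definition martingale :: "'a measure \<Rightarrow> (nat \<Rightarrow> 'a measure) \<Rightarrow> (nat \<Rightarrow> 'a \<Rightarrow> real) \<Rightarrow> bool" where
  "martingale M F f \<longleftrightarrow>
     (\<forall>n. f n \<in> borel_measurable (F n) \<and> integrable M (f n)) \<and>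
     (\<forall>m n. n \<le> m \<longrightarrow> (AE x in M. real_cond_exp M (F n) (f m) x = f n x))"

text \<open>\<open>d\<^sub>0 f = f\<^sub>0\<close>, since \<open>f\<^sub>-\<^sub>1 = 0\<close>.\<close>

definition mdiff :: "(nat \<Rightarrow> 'a \<Rightarrow> real) \<Rightarrow> nat \<Rightarrow> 'a \<Rightarrow> real" where
  "mdiff f n x = (if n = 0 then f 0 x else f n x - f (n - 1) x)"

definition maximal_fn :: "(nat \<Rightarrow> 'a \<Rightarrow> real) \<Rightarrow> 'a \<Rightarrow> ennreal" where
  "maximal_fn f x = (SUP n. ennreal \<bar>f n x\<bar>)"

definition square_fn_upto :: "(nat \<Rightarrow> 'a \<Rightarrow> real) \<Rightarrow> nat \<Rightarrow> 'a \<Rightarrow> real" where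
  "square_fn_upto f n x = sqrt (\<Sum>k\<le>n. \<bar>mdiff f k x\<bar>\<^sup>2)"

definition square_fn :: "(nat \<Rightarrow> 'a \<Rightarrow> real) \<Rightarrow> 'a \<Rightarrow> ennreal" where
  "square_fn f x = lim (\<lambda>n. ennreal (square_fn_upto f n x))"

text \<open>Subtraction on \<^typ>\<open>nat\<close> truncates, so \<^term>\<open>F (n - 1)\<close> is \<^term>\<open>F 0\<close> for \<open>n = 0\<close>; this is the
  convention \<open>\<bbbE>\<^sub>-\<^sub>1 = \<bbbE>\<^sub>0\<close>. The conditional expectation is the one for nonnegative functions
  because the differences need not be square integrable.\<close>

definition cond_square_fn ::
    "'a measure \<Rightarrow> (nat \<Rightarrow> 'a measure) \<Rightarrow> (nat \<Rightarrow> 'a \<Rightarrow> real) \<Rightarrow> 'a \<Rightarrow> ennreal" where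
  "cond_square_fn M F f x =
     epowr (\<Sum>n. nn_cond_exp M (F (n - 1)) (\<lambda>y. ennreal (\<bar>mdiff f n y\<bar>\<^sup>2)) x) (1/2)"


section \<open>Martingale Hardy spaces\<close>

definition HM_norm :: "'a measure \<Rightarrow> ('a \<Rightarrow> real) \<Rightarrow> (nat \<Rightarrow> 'a \<Rightarrow> real) \<Rightarrow> ennreal" where
  "HM_norm M p f = Lp_norm M p (maximal_fn f)"

definition HS_norm :: "'a measure \<Rightarrow> ('a \<Rightarrow> real) \<Rightarrow> (nat \<Rightarrow> 'a \<Rightarrow> real) \<Rightarrow> ennreal" where
  "HS_norm M p f = Lp_norm M p (square_fn f)"

definition Hs_norm ::
    "'a measure \<Rightarrow> (nat \<Rightarrow> 'a measure) \<Rightarrow> ('a \<Rightarrow> real) \<Rightarrow> (nat \<Rightarrow> 'a \<Rightarrow> real) \<Rightarrow> ennreal" where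
  "Hs_norm M F p f = Lp_norm M p (cond_square_fn M F f)"

definition HM_space ::
    "'a measure \<Rightarrow> (nat \<Rightarrow> 'a measure) \<Rightarrow> ('a \<Rightarrow> real) \<Rightarrow> (nat \<Rightarrow> 'a \<Rightarrow> real) set" where
  "HM_space M F p = {f. martingale M F f \<and> HM_norm M p f < \<infinity>}"

definition HS_space ::
    "'a measure \<Rightarrow> (nat \<Rightarrow> 'a measure) \<Rightarrow> ('a \<Rightarrow> real) \<Rightarrow> (nat \<Rightarrow> 'a \<Rightarrow> real) set" where
  "HS_space M F p = {f. martingale M F f \<and> HS_norm M p f < \<infinity>}"

definition Hs_space ::
    "'a measure \<Rightarrow> (nat \<Rightarrow> 'a measure) \<Rightarrow> ('a \<Rightarrow> real) \<Rightarrow> (nat \<Rightarrow> 'a \<Rightarrow> real) set" where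
  "Hs_space M F p = {f. martingale M F f \<and> Hs_norm M F p f < \<infinity>}"

definition Lambda :: "'a measure \<Rightarrow> (nat \<Rightarrow> 'a measure) \<Rightarrow> (nat \<Rightarrow> 'a \<Rightarrow> real) set" where
  "Lambda M F =
     {l. (\<forall>n. l n \<in> borel_measurable (F n)) \<and>
         (\<forall>x\<in>space M. \<forall>n. 0 \<le> l n x \<and> l n x \<le> l (Suc n) x)}"

definition lambda_inf :: "(nat \<Rightarrow> 'a \<Rightarrow> real) \<Rightarrow> 'a \<Rightarrow> ennreal" where
  "lambda_inf l x = lim (\<lambda>n. ennreal (l n x))"

definition Q_majorants ::
    "'a measure \<Rightarrow> (nat \<Rightarrow> 'a measure) \<Rightarrow> ('a \<Rightarrow> real) \<Rightarrow> (nat \<Rightarrow> 'a \<Rightarrow> real) \<Rightarrow> (nat \<Rightarrow> 'a \<Rightarrow> real) set"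
  where
  "Q_majorants M F p f =
     {l \<in> Lambda M F. lambda_inf l \<in> Lp_space M p \<and>
        (\<forall>n\<ge>1. AE x in M. square_fn_upto f n x \<le> l (n - 1) x)}"

definition P_majorants ::
    "'a measure \<Rightarrow> (nat \<Rightarrow> 'a measure) \<Rightarrow> ('a \<Rightarrow> real) \<Rightarrow> (nat \<Rightarrow> 'a \<Rightarrow> real) \<Rightarrow> (nat \<Rightarrow> 'a \<Rightarrow> real) set"
  where
  "P_majorants M F p f =
     {l \<in> Lambda M F. lambda_inf l \<in> Lp_space M p \<and>
        (\<forall>n\<ge>1. AE x in M. \<bar>f n x\<bar> \<le> l (n - 1) x)}"

definition Q_norm ::
    "'a measure \<Rightarrow> (nat \<Rightarrow> 'a measure) \<Rightarrow> ('a \<Rightarrow> real) \<Rightarrow> (nat \<Rightarrow> 'a \<Rightarrow> real) \<Rightarrow> ennreal" where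
  "Q_norm M F p f = (INF l\<in>Q_majorants M F p f. Lp_norm M p (lambda_inf l))"

definition P_norm ::
    "'a measure \<Rightarrow> (nat \<Rightarrow> 'a measure) \<Rightarrow> ('a \<Rightarrow> real) \<Rightarrow> (nat \<Rightarrow> 'a \<Rightarrow> real) \<Rightarrow> ennreal" where
  "P_norm M F p f = (INF l\<in>P_majorants M F p f. Lp_norm M p (lambda_inf l))"

definition Q_space ::
    "'a measure \<Rightarrow> (nat \<Rightarrow> 'a measure) \<Rightarrow> ('a \<Rightarrow> real) \<Rightarrow> (nat \<Rightarrow> 'a \<Rightarrow> real) set" where
  "Q_space M F p = {f. martingale M F f \<and> Q_majorants M F p f \<noteq> {}}"

definition P_space ::
    "'a measure \<Rightarrow> (nat \<Rightarrow> 'a measure) \<Rightarrow> ('a \<Rightarrow> real) \<Rightarrow> (nat \<Rightarrow> 'a \<Rightarrow> real) set" where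
  "P_space M F p = {f. martingale M F f \<and> P_majorants M F p f \<noteq> {}}"

definition equivalent_on :: "'f set \<Rightarrow> ('f \<Rightarrow> ennreal) \<Rightarrow> ('f \<Rightarrow> ennreal) \<Rightarrow> bool" where
  "equivalent_on X N N' \<longleftrightarrow>
     (\<exists>c C::real. 0 < c \<and> 0 < C \<and>
        (\<forall>f\<in>X. ennreal c * N f \<le> N' f \<and> N' f \<le> ennreal C * N f))"

end

theory Submission
  imports Defs
begin

text \<open>
  The comparison of the five quasi-norms rests on one device, a good-\<open>\<lambda>\<close> inequality adapted to a
  variable exponent (\<open>dominated_of_good_lambda\<close>). Let \<open>X\<^sub>n\<close> be adapted, \<open>X = sup X\<^sub>n\<close>, and let \<open>Y\<close> be
  the function that is to control \<open>X\<close>, normalised by \<open>\<integral> Y\<^sup>p \<le> 1\<close>. The set \<open>X > 2\<^sup>j\<close> splits into pieces,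
  each contained in an atom of the \<open>\<sigma>\<close>-algebra \<open>F\<^sub>n\<close> at which the level is first passed. With
  \<open>p\<^sub>+\<close> of the atom in place of \<open>p\<close> let \<open>G\<^sub>j\<close> be the sum of \<open>2\<^sup>j\<^sup>p\<^sup>+ P(E)\<close> over these pieces \<open>E\<close>. A piece
  \<open>E\<close> of level \<open>j + 1\<close> is of one of two kinds. If \<open>Y > d 2\<^sup>j\<close> on at least half of it, then
  \<open>P(E) 2\<^sup>j\<^sup>p\<^sup>-\<close> is bounded, and the hypothesis \<open>P(A)\<^sup>p\<^sup>-\<^sup>-\<^sup>p\<^sup>+ \<le> K\<close> allows \<open>p\<^sub>+\<close> to be exchanged for \<open>p\<close>
  (\<open>local_exponent\<close>); this is the only use of that hypothesis. Otherwise at least half of \<open>E\<close> lies in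
  \<open>{X > 2\<^sup>j\<^sup>+\<^sup>1, Y \<le> d 2\<^sup>j}\<close>, and as \<open>p\<^sub>+\<close> decreases along atoms the good-\<open>\<lambda>\<close> estimate gives a small
  multiple of \<open>G\<^sub>j\<close>. Hence \<open>G\<^sub>j\<^sub>+\<^sub>1 \<le> c\<^sub>j + G\<^sub>j / 2\<close> with \<open>\<Sum>c\<^sub>j\<close> bounded, which bounds \<open>\<integral> X\<^sup>p\<close> without
  any a priori finiteness.

  Let \<open>(\<lambda>\<^sub>n)\<close> be a majorant of a martingale \<open>f\<close> in the sense of \<open>P\<close> or of \<open>Q\<close>. Stopping \<open>f\<close> before
  \<open>\<lambda>\<close> exceeds \<open>d t\<close> leaves an \<open>L\<^sup>2\<close> martingale of conditional energy at most \<open>4 d\<^sup>2 t\<^sup>2\<close> (\<open>controls\<close>).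
  Doob's \<open>L\<^sup>2\<close> inequality then yields the good-\<open>\<lambda>\<close> estimate, with \<open>Y = \<lambda>\<^sub>\<infinity>\<close>, for the maximal function,
  for the square function and for the conditional square function; only \<open>L\<^sup>2\<close> estimates are needed,
  however large \<open>p\<^sub>+\<close> is. This bounds \<open>H\<^sup>M\<close>, \<open>H\<^sup>S\<close> and \<open>H\<^sup>s\<close> by \<open>P\<close> and by \<open>Q\<close>. Adding \<open>2 \<lambda>\<^sub>n\<close> to the
  running maximum, or to the partial square function, turns a majorant of one kind into one of the
  other kind, so that \<open>P\<close> and \<open>Q\<close> bound each other (\<open>majorant_of_controls\<close>).
  The maximal and the square function are treated together as functionals \<open>q\<close> of the path of
  differences (locale \<open>path_functional\<close>).

  For the bounds of \<open>H\<^sup>M\<close> and \<open>H\<^sup>S\<close> by \<open>H\<^sup>s\<close> the differences are sorted according to the dyadic layer in which the predictable function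
  \<open>s\<^sub>n(f)\<close> lies. The part belonging to \<open>2\<^sup>i < s\<^sub>n(f) \<le> 2\<^sup>i\<^sup>+\<^sup>1\<close> has conditional \<open>L\<^sup>2\<close> norm of order
  \<open>2\<^sup>i\<close> on the atoms where \<open>s(f)\<close> passes \<open>2\<^sup>i\<close>, and for \<open>p\<^sub>+ < 2\<close> the parts can be summed pointwise
  (\<open>powr_sum_dyadic_le\<close>, \<open>layer_pointwise\<close>).

  If the filtration is regular, an \<open>F\<^sub>n\<^sub>+\<^sub>1\<close>-measurable \<open>u \<ge> 0\<close> satisfies \<open>u \<le> R E\<^sub>n u\<close>. Applied to
  the running functionals this produces predictable majorants for elements of \<open>H\<^sup>M\<close>, \<open>H\<^sup>S\<close> and \<open>H\<^sup>s\<close>;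
  for the first two their size is controlled by \<open>dominated_of_local\<close>, the case of the first
  kind of pieces only.
\<close>

section \<open>Powers of extended nonnegative reals and sums over dyadic levels\<close>

lemma epowr_ennreal: "0 \<le> z \<Longrightarrow> epowr (ennreal z) r = ennreal (z powr r)"
  by (simp add: epowr_def)

lemma epowr_mono: "z \<le> w \<Longrightarrow> 0 \<le> r \<Longrightarrow> epowr z r \<le> epowr w r"
  by (cases w; cases z) (auto simp: epowr_def top_unique intro!: ennreal_leI powr_mono2)

lemma borel_measurable_epowr [measurable]:
  assumes [measurable]: "g \<in> borel_measurable N" "r \<in> borel_measurable N"
  shows "(\<lambda>x. epowr (g x) (r x)) \<in> borel_measurable N"
  unfolding epowr_def by measurable

lemma epowr_divide:
  assumes "0 < c"
  shows "epowr (z / ennreal c) r = epowr z r * ennreal (c powr (- r))"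
proof (cases z)
  case (real y)
  then show ?thesis
    using assms by (simp add: divide_ennreal epowr_ennreal powr_divide powr_minus_divide
        ennreal_mult[symmetric] field_simps)
next
  case top
  then show ?thesis
    using assms by (simp add: epowr_def ennreal_top_divide ennreal_top_mult)
qed

lemma less_epowr_half:
  assumes "0 \<le> t"
  shows "ennreal t < epowr z (1/2) \<longleftrightarrow> ennreal (t\<^sup>2) < z"
proof (cases z)
  case (real y)
  then have "t < sqrt y \<longleftrightarrow> t\<^sup>2 < y"
    using assms real_less_lsqrt real_less_rsqrt by (metis not_less_iff_gr_or_eq real_sqrt_unique
        real_sqrt_less_iff)
  then show ?thesis
    using real assms by (simp add: epowr_ennreal powr_half_sqrt ennreal_less_iff)
qed (simp add: epowr_def)

lemma epowr_half_le:
  assumes "0 \<le> t"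
  shows "epowr z (1/2) \<le> ennreal t \<longleftrightarrow> z \<le> ennreal (t\<^sup>2)"
  using less_epowr_half[OF assms, of z] by (simp add: not_less[symmetric])

lemma ennreal_less_divide:
  assumes "0 < l" "0 \<le> t"
  shows "ennreal t < z / ennreal l \<longleftrightarrow> ennreal (l * t) < z"
proof (cases z)
  case (real y)
  then show ?thesis using assms
    by (simp add: divide_ennreal ennreal_less_iff field_simps)
qed (use assms in \<open>simp add: ennreal_top_divide\<close>)

lemma finite_dyadic_below: "finite {i::nat. (2::real) ^ i < s}"
proof -
  obtain N :: nat where "s < 2 ^ N" using real_arch_pow[of 2 s] by auto
  then have "{i::nat. (2::real) ^ i < s} \<subseteq> {..N}"
    by (auto intro: less_imp_le dest: order.strict_trans)
  then show ?thesis by (rule finite_subset) simp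
qed

lemma sum_dyadic_le:
  fixes s \<theta> :: real
  assumes \<theta>: "0 < \<theta>" and s: "0 < s"
  shows "(\<Sum>i | (2::real) ^ i < s. (2 ^ i / s) powr \<theta>) \<le> 1 / (1 - 2 powr (- \<theta>))"
proof (cases "{i::nat. (2::real) ^ i < s} = {}")
  case True
  have "2 powr (- \<theta>) < 1" using \<theta> by (simp add: powr_less_one)
  then show ?thesis by (simp only: True) simp
next
  case False
  define q where "q = (2::real) powr (- \<theta>)"
  have q: "0 < q" "q < 1" using \<theta> by (auto simp: q_def powr_less_one)
  define N where "N = Max {i::nat. (2::real) ^ i < s}"
  have N: "2 ^ N < s" and sub: "{i::nat. (2::real) ^ i < s} \<subseteq> {..N}"
    using Max_in[OF finite_dyadic_below False] Max_ge[OF finite_dyadic_below, of _ s]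
    by (auto simp: N_def)
  have le: "(2 ^ i / s) powr \<theta> \<le> q ^ (N - i)" if "i \<le> N" for i
  proof -
    have "2 ^ i / s \<le> 2 ^ i / (2::real) ^ N"
      using N s by (intro divide_left_mono) auto
    also have "\<dots> = 2 powr (- real (N - i))"
      using that by (simp add: powr_diff powr_realpow of_nat_diff)
    finally have "(2 ^ i / s) powr \<theta> \<le> (2 powr (- real (N - i))) powr \<theta>"
      using \<theta> s by (intro powr_mono2) auto
    also have "\<dots> = q ^ (N - i)"
      by (simp add: q_def powr_powr powr_realpow[symmetric] mult.commute)
    finally show ?thesis .
  qed
  have "(\<Sum>i | (2::real) ^ i < s. (2 ^ i / s) powr \<theta>) \<le> (\<Sum>i\<le>N. (2 ^ i / s) powr \<theta>)"
    by (rule sum_mono2) (use sub in auto)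
  also have "\<dots> \<le> (\<Sum>i\<le>N. q ^ (N - i))" by (rule sum_mono) (use le in auto)
  also have "\<dots> = (\<Sum>i\<le>N. q ^ i)"
    by (rule sum.reindex_bij_witness[where i="\<lambda>i. N - i" and j="\<lambda>i. N - i"]) auto
  also have "\<dots> \<le> (\<Sum>i. q ^ i)" using q by (intro sum_le_suminf summable_geometric) auto
  also have "\<dots> = 1 / (1 - q)" using q by (simp add: suminf_geometric)
  finally show ?thesis by (simp add: q_def)
qed

text \<open>The weight of level \<open>j\<close>, that is \<open>2\<^sup>j\<close> to the power \<open>r\<close>.\<close>

abbreviation lev :: "nat \<Rightarrow> real \<Rightarrow> ennreal" where
  "lev j r \<equiv> ennreal (2 powr (real j * r))"

text \<open>A power is bounded by a sum of weights over the dyadic levels below its base. The value \<open>\<infinity>\<close> is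
  covered: every summand is then at least 1.\<close>

lemma epowr_le_levels:
  assumes "0 < r"
  shows "epowr z r \<le> 1 + (\<Sum>j. lev (Suc j) r * indicator {ennreal (2 ^ j)<..} z)"
proof (cases z)
  case (real y)
  show ?thesis
  proof (cases "y \<le> 1")
    case True
    then have "epowr z r \<le> 1"
      using real assms by (auto simp: epowr_ennreal intro!: powr_le1)
    then show ?thesis by (rule order_trans) simp
  next
    case False
    define j where "j = Max {i::nat. (2::real) ^ i < y}"
    have ne: "0 \<in> {i::nat. (2::real) ^ i < y}" using False by auto
    have j: "2 ^ j < y" using Max_in[OF finite_dyadic_below, of y] ne unfolding j_def by blast
    have "Suc j \<notin> {i::nat. (2::real) ^ i < y}"
      using Max_ge[OF finite_dyadic_below, of "Suc j" y] by (auto simp: j_def)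
    then have "y \<le> 2 ^ Suc j" by auto
    then have "y \<le> 2 powr real (Suc j)" by (subst powr_realpow) auto
    then have "y powr r \<le> (2 powr real (Suc j)) powr r"
      using real assms by (intro powr_mono2) auto
    then have "epowr z r \<le> lev (Suc j) r * indicator {ennreal (2 ^ j)<..} z"
      using real j by (auto simp: epowr_ennreal powr_powr ennreal_less_iff intro!: ennreal_leI)
    also have "\<dots> \<le> (\<Sum>j. lev (Suc j) r * indicator {ennreal (2 ^ j)<..} z)"
    proof -
      have "g j \<le> suminf g" for g :: "nat \<Rightarrow> ennreal"
        using sum_le_suminf[of g "{j}"] by simp
      from this[of "\<lambda>j. lev (Suc j) r * indicator {ennreal (2 ^ j)<..} z"] show ?thesis .
    qed
    finally show ?thesis by (meson add_increasing order_trans zero_le)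
  qed
next
  case top
  have "(\<Sum>j. 1 :: ennreal) \<le> (\<Sum>j. lev (Suc j) r * indicator {ennreal (2 ^ j)<..} z)"
  proof (rule suminf_le)
    fix j
    have "1 \<le> (2::real) powr (real (Suc j) * r)" using assms by (intro ge_one_powr_ge_zero) auto
    then show "1 \<le> lev (Suc j) r * indicator {ennreal (2 ^ j)<..} z"
      using top by (auto simp: one_ennreal_def[symmetric] intro: ennreal_leI)
  qed auto
  moreover have "(\<Sum>j. 1 :: ennreal) = \<infinity>"
    by (subst suminf_eq_SUP) (simp add: ennreal_SUP_of_nat_eq_top)
  ultimately show ?thesis by (simp add: top_unique)
qed

text \<open>Conversely the sum of the weights is a geometric series dominated by its last term.\<close>

lemma suminf_levels_le:
  assumes a: "0 < a" "a \<le> r" "r \<le> b" and d: "0 < d" "d \<le> 1"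
  shows "(\<Sum>j. lev j r * indicator {ennreal (d * 2 ^ j)<..} z)
    \<le> ennreal (d powr (- b) / (1 - 2 powr (- a))) * epowr z r"
proof (cases z)
  case (real y)
  have qa: "2 powr (- a) < (1::real)" using a by (simp add: powr_less_one)
  let ?I = "{i::nat. (2::real) ^ i < y / d}"
  show ?thesis
  proof (cases "y = 0")
    case True
    have "indicator {ennreal (d * 2 ^ j)<..} z = (0::ennreal)" for j
      using True real d by (simp add: indicator_def)
    then show ?thesis by simp
  next
    case False
    then have y: "0 < y" using real by simp
    have "(\<Sum>j\<in>?I. 2 powr (real j * r)) = (y / d) powr r * (\<Sum>j\<in>?I. (2 ^ j / (y / d)) powr r)"
      using y d by (simp add: sum_distrib_left powr_divide powr_mult powr_realpow[symmetric] powr_powr)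
    also have "\<dots> \<le> (y / d) powr r * (1 / (1 - 2 powr (- r)))"
      using y d a by (intro mult_left_mono sum_dyadic_le) auto
    also have "\<dots> = y powr r * (d powr (- r) * (1 / (1 - 2 powr (- r))))"
      using y d by (simp add: powr_divide powr_minus_divide)
    also have "\<dots> \<le> y powr r * (d powr (- b) * (1 / (1 - 2 powr (- a))))"
    proof (intro mult_left_mono mult_mono)
      show "d powr (- r) \<le> d powr (- b)" using a d by (intro powr_mono') auto
      have "2 powr (- r) \<le> (2::real) powr (- a)" using a by (intro powr_mono) auto
      then show "1 / (1 - 2 powr (- r)) \<le> 1 / (1 - (2::real) powr (- a))"
        using qa by (intro frac_le) auto
      show "0 \<le> 1 / (1 - (2::real) powr (- r))"
        using a powr_less_one[of 2 "- r"] by simp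
    qed auto
    finally have R: "(\<Sum>j\<in>?I. 2 powr (real j * r)) \<le> y powr r * (d powr (- b) * (1 / (1 - 2 powr (- a))))" .
    have "(\<Sum>j. lev j r * indicator {ennreal (d * 2 ^ j)<..} z) = (\<Sum>j\<in>?I. lev j r)"
    proof (subst suminf_finite[where N = ?I])
      show "finite ?I" by (rule finite_dyadic_below)
    qed (use d y in \<open>auto simp: real ennreal_less_iff field_simps indicator_def intro!: sum.cong\<close>)
    also have "\<dots> = ennreal (\<Sum>j\<in>?I. 2 powr (real j * r))" by simp
    also have "\<dots> \<le> ennreal (y powr r * (d powr (- b) * (1 / (1 - 2 powr (- a)))))"
      by (intro ennreal_leI R)
    finally show ?thesis
      using real qa by (simp add: epowr_ennreal ennreal_mult[symmetric] mult.commute)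
  qed
next
  case top
  moreover have "0 < d powr (- b) / (1 - 2 powr (- a))"
    using a d by (simp add: powr_less_one)
  then have "ennreal (d powr (- b) / (1 - 2 powr (- a))) \<noteq> 0"
    by (simp add: ennreal_eq_0_iff not_le)
  ultimately show ?thesis by (simp add: epowr_def ennreal_mult_top)
qed

text \<open>The pointwise inequality behind the case \<open>p\<^sub>+ < 2\<close>: think of \<open>s\<close> as \<open>s(f)\<close> and of \<open>2\<^sup>i u\<^sub>i\<close> as the
  contribution of layer \<open>i\<close>. Each \<open>u\<^sub>i\<close> is first enlarged to \<open>v\<^sub>i \<ge> (s / 2\<^sup>i)\<^sup>a\<^sup>/\<^sup>4\<close>, so that a small power of
  \<open>s / 2\<^sup>i\<close>, needed to sum over \<open>i\<close>, is absorbed by the gap between the exponents \<open>p\<close> and 2.\<close>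

lemma powr_sum_dyadic_le:
  fixes u :: "nat \<Rightarrow> real" and s p a b :: real
  assumes a: "0 < a" "a \<le> p" "p \<le> b" "b < 2" and s: "0 < s" and u: "\<And>i. 0 \<le> u i"
  defines "\<eta> \<equiv> a / 4 * ((2 - b) / b)"
  shows "(\<Sum>i | (2::real) ^ i < s. 2 ^ i * u i) powr p
    \<le> (1 / (1 - 2 powr (- \<eta>))) powr p * ((\<Sum>i | (2::real) ^ i < s. 2 powr (real i * p) * (u i)\<^sup>2)
        + s powr p / (1 - 2 powr (- (a / 2))))"
proof -
  let ?I = "{i::nat. (2::real) ^ i < s}"
  define v where "v i = max (u i) ((s / 2 ^ i) powr (a / 4))" for i :: nat
  define y where "y i = 2 ^ i * v i * (s / 2 ^ i) powr \<eta>" for i :: nat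
  define Y where "Y = (\<Sum>i\<in>?I. y i powr p)"
  have fin: "finite ?I" by (rule finite_dyadic_below)
  have p: "0 < p" "0 < b" using a by auto
  have \<eta>: "0 < \<eta>" using a p by (auto simp: \<eta>_def)
  have v1: "1 \<le> v i" if "i \<in> ?I" for i
    using that a by (auto simp: v_def le_max_iff_disj intro!: disjI2 ge_one_powr_ge_zero)
  have y0: "0 \<le> y i" for i using u[of i] s by (auto simp: y_def v_def intro!: mult_nonneg_nonneg)
  have Y0: "0 \<le> Y" by (auto simp: Y_def intro: sum_nonneg)
  have yY: "y i \<le> Y powr (1 / p)" if "i \<in> ?I" for i
  proof -
    have "y i powr p \<le> Y" unfolding Y_def by (rule member_le_sum) (use that fin in auto)
    then have "(y i powr p) powr (1 / p) \<le> Y powr (1 / p)" using p by (intro powr_mono2) auto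
    then show ?thesis using p y0[of i] by (simp add: powr_powr)
  qed
  \<comment> \<open>Every \<open>y\<^sub>i\<close> is bounded by the \<open>\<ell>\<^sup>p\<close> norm of the sequence, and the factors \<open>(2\<^sup>i / s)\<^sup>\<eta>\<close> are summable.\<close>
  have "(\<Sum>i\<in>?I. 2 ^ i * u i) \<le> (\<Sum>i\<in>?I. Y powr (1 / p) * (2 ^ i / s) powr \<eta>)"
  proof (rule sum_mono)
    fix i assume i: "i \<in> ?I"
    have "2 ^ i * u i \<le> 2 ^ i * v i" by (auto simp: v_def)
    also have "\<dots> = y i * (2 ^ i / s) powr \<eta>"
      using s by (simp add: y_def powr_divide)
    also have "\<dots> \<le> Y powr (1 / p) * (2 ^ i / s) powr \<eta>"
      by (intro mult_right_mono yY i) auto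
    finally show "2 ^ i * u i \<le> Y powr (1 / p) * (2 ^ i / s) powr \<eta>" .
  qed
  also have "\<dots> = Y powr (1 / p) * (\<Sum>i\<in>?I. (2 ^ i / s) powr \<eta>)" by (simp add: sum_distrib_left)
  also have "\<dots> \<le> Y powr (1 / p) * (1 / (1 - 2 powr (- \<eta>)))"
    by (intro mult_left_mono sum_dyadic_le \<eta> s) auto
  finally have "(\<Sum>i\<in>?I. 2 ^ i * u i) powr p \<le> (Y powr (1 / p) * (1 / (1 - 2 powr (- \<eta>)))) powr p"
    using p u by (intro powr_mono2 sum_nonneg) auto
  also have "\<dots> = (1 / (1 - 2 powr (- \<eta>))) powr p * Y"
    using p Y0 \<eta> powr_less_one[of 2 "-\<eta>"] by (simp add: powr_mult powr_powr mult.commute powr_divide)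
  also have "\<dots> \<le> (1 / (1 - 2 powr (- \<eta>))) powr p * ((\<Sum>i\<in>?I. 2 powr (real i * p) * (u i)\<^sup>2)
      + s powr p / (1 - 2 powr (- (a / 2))))"
  proof (rule mult_left_mono)
    have step: "y i powr p \<le> 2 powr (real i * p) * (u i)\<^sup>2 + s powr p * (2 ^ i / s) powr (p - a / 2)"
      if i: "i \<in> ?I" for i
    proof -
      have si: "1 \<le> s / 2 ^ i" using i by auto
      have vpos: "0 < v i" using v1[OF i] by linarith
      \<comment> \<open>The choice of \<open>\<eta>\<close> makes the exponent \<open>\<eta> p / (a / 4)\<close> at most \<open>2 - p\<close>, and \<open>v\<^sub>i \<ge> 1\<close>.\<close>
      have "((s / 2 ^ i) powr \<eta>) powr p = ((s / 2 ^ i) powr (a / 4)) powr ((2 - b) / b * p)"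
        by (simp add: powr_powr \<eta>_def ac_simps)
      also have "\<dots> \<le> v i powr ((2 - b) / b * p)"
        using a p s by (intro powr_mono2) (auto simp: v_def)
      also have "\<dots> \<le> v i powr (2 - p)"
      proof (rule powr_mono[OF _ v1[OF i]])
        have "(2 - b) / b * p = 2 * (p / b) - p" using p by (simp add: field_simps)
        moreover have "p / b \<le> 1" using a p by simp
        ultimately show "(2 - b) / b * p \<le> 2 - p" by linarith
      qed
      finally have w: "((s / 2 ^ i) powr \<eta>) powr p \<le> v i powr (2 - p)" .
      have "y i powr p = 2 powr (real i * p) * v i powr p * ((s / 2 ^ i) powr \<eta>) powr p"
        using vpos s by (simp add: y_def powr_mult powr_powr powr_realpow[symmetric])
      also have "\<dots> \<le> 2 powr (real i * p) * v i powr p * v i powr (2 - p)"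
        using w by (intro mult_left_mono) auto
      also have "\<dots> = 2 powr (real i * p) * (v i)\<^sup>2"
        using vpos by (simp add: mult.assoc powr_add[symmetric])
      also have "\<dots> \<le> 2 powr (real i * p) * ((u i)\<^sup>2 + (s / 2 ^ i) powr (a / 2))"
      proof (rule mult_left_mono)
        have "((s / 2 ^ i) powr (a / 4))\<^sup>2 = (s / 2 ^ i) powr (a / 2)"
          using powr_powr[of "s / 2 ^ i" "a / 4" 2] s by simp
        then show "(v i)\<^sup>2 \<le> (u i)\<^sup>2 + (s / 2 ^ i) powr (a / 2)"
          unfolding v_def max_def by auto
      qed auto
      also have "2 powr (real i * p) * (s / 2 ^ i) powr (a / 2) = s powr p * (2 ^ i / s) powr (p - a / 2)"
      proof -
        have "s powr p = s powr (p - a / 2) * s powr (a / 2)"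
          "2 powr (real i * p) = (2::real) powr (real i * (p - a / 2)) * 2 powr (real i * (a / 2))"
          using s by (simp_all add: powr_add[symmetric] algebra_simps)
        then show ?thesis
          using s by (simp add: powr_divide powr_realpow[symmetric] powr_powr)
      qed
      then have "2 powr (real i * p) * ((u i)\<^sup>2 + (s / 2 ^ i) powr (a / 2)) = 2 powr (real i * p) * (u i)\<^sup>2 + s powr p * (2 ^ i / s) powr (p - a / 2)"
        by (simp add: distrib_left)
      finally show ?thesis .
    qed
    have "Y \<le> (\<Sum>i\<in>?I. 2 powr (real i * p) * (u i)\<^sup>2 + s powr p * (2 ^ i / s) powr (p - a / 2))"
      unfolding Y_def by (rule sum_mono) (rule step)
    also have "\<dots> = (\<Sum>i\<in>?I. 2 powr (real i * p) * (u i)\<^sup>2) + s powr p * (\<Sum>i\<in>?I. (2 ^ i / s) powr (p - a / 2))"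
      by (simp add: sum.distrib sum_distrib_left)
    also have "\<dots> \<le> (\<Sum>i\<in>?I. 2 powr (real i * p) * (u i)\<^sup>2) + s powr p * (1 / (1 - 2 powr (- (p - a / 2))))"
      using a s by (intro add_left_mono mult_left_mono sum_dyadic_le) auto
    also have "\<dots> \<le> (\<Sum>i\<in>?I. 2 powr (real i * p) * (u i)\<^sup>2) + s powr p * (1 / (1 - 2 powr (- (a / 2))))"
      using a by (intro add_left_mono mult_left_mono divide_left_mono diff_left_mono powr_mono mult_pos_pos)
        (auto simp: powr_less_one)
    finally show "Y \<le> (\<Sum>i\<in>?I. 2 powr (real i * p) * (u i)\<^sup>2) + s powr p / (1 - 2 powr (- (a / 2)))"
      by simp
  qed auto
  finally show ?thesis .
qed

lemma sum_le_of_contraction: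
  fixes G c :: "nat \<Rightarrow> ennreal"
  assumes "\<And>j. G (Suc j) \<le> c j + ennreal (1 / 2) * G j"
  shows "(\<Sum>j\<le>N. G j) + G N \<le> 2 * G 0 + 2 * (\<Sum>j<N. c j)"
proof (induction N)
  case (Suc N)
  have "(\<Sum>j\<le>Suc N. G j) + G (Suc N) = (\<Sum>j\<le>N. G j) + 2 * G (Suc N)"
    by (simp add: mult_2 add.assoc del: ennreal_add_left_cancel)
  also have "\<dots> \<le> (\<Sum>j\<le>N. G j) + 2 * (c N + ennreal (1 / 2) * G N)"
    by (intro add_left_mono mult_left_mono assms) auto
  also have "2 * (ennreal (1 / 2) * G N) = G N"
  proof -
    have "(2::ennreal) * ennreal (1 / 2) = ennreal (2 * (1 / 2))"
      by (subst ennreal_mult) auto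
    then show ?thesis by (simp add: mult.assoc[symmetric])
  qed
  then have "(\<Sum>j\<le>N. G j) + 2 * (c N + ennreal (1 / 2) * G N) = ((\<Sum>j\<le>N. G j) + G N) + 2 * c N"
    by (simp add: distrib_left ac_simps)
  also have "\<dots> \<le> (2 * G 0 + 2 * (\<Sum>j<N. c j)) + 2 * c N"
    by (intro add_right_mono Suc.IH)
  also have "\<dots> = 2 * G 0 + 2 * (\<Sum>j<Suc N. c j)"
    by (simp add: distrib_left ac_simps)
  finally show ?case .
qed (simp add: mult_2)

lemma le_divide_iff_ennreal:
  assumes "0 < l" "0 \<le> t"
  shows "z / ennreal l \<le> ennreal t \<longleftrightarrow> z \<le> ennreal (l * t)"
  using ennreal_less_divide[OF assms, of z] by (auto simp: not_less[symmetric])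

lemma le_mult_INF_ennreal:
  fixes g :: "'i \<Rightarrow> ennreal"
  assumes D: "0 < D" and le: "\<And>i. i \<in> I \<Longrightarrow> x \<le> ennreal D * g i"
  shows "x \<le> ennreal D * (INF i\<in>I. g i)"
proof -
  have "ennreal (1 / D) * x \<le> g i" if "i \<in> I" for i
  proof -
    have "ennreal (1 / D) * x \<le> ennreal (1 / D) * (ennreal D * g i)"
      by (intro mult_left_mono le that) auto
    also have "\<dots> = g i" using D by (simp add: mult.assoc[symmetric] ennreal_mult[symmetric])
    finally show ?thesis .
  qed
  then have "ennreal D * (ennreal (1 / D) * x) \<le> ennreal D * (INF i\<in>I. g i)"
    by (intro mult_left_mono INF_greatest) auto
  then show ?thesis using D by (simp add: mult.assoc[symmetric] ennreal_mult[symmetric])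
qed

lemma epowr_mult:
  assumes "0 < c"
  shows "epowr (ennreal c * z) r = ennreal (c powr r) * epowr z r"
proof (cases z)
  case (real y)
  then show ?thesis
    using assms by (simp add: ennreal_mult[symmetric] epowr_ennreal powr_mult)
qed (use assms in \<open>simp add: epowr_def ennreal_mult_top\<close>)

lemma epowr_add_le:
  assumes "0 < r" "r \<le> b"
  shows "epowr (x + y) r \<le> ennreal (2 powr b) * (epowr x r + epowr y r)"
proof -
  have "x + y \<le> ennreal 2 * max x y"
    by (simp add: mult_2 add_mono)
  then have "epowr (x + y) r \<le> epowr (ennreal 2 * max x y) r"
    using assms by (intro epowr_mono) auto
  also have "\<dots> = ennreal (2 powr r) * epowr (max x y) r"
    by (rule epowr_mult) auto
  also have "\<dots> \<le> ennreal (2 powr b) * (epowr x r + epowr y r)"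
    using assms by (intro mult_mono ennreal_leI powr_mono) (auto simp: max_def add_increasing add_increasing2)
  finally show ?thesis .
qed

lemma divide_mult_ennreal:
  assumes "0 < l" "0 < D"
  shows "z / ennreal (l * D) = ennreal (1 / D) * (z / ennreal l)"
proof (cases z)
  case (real y)
  then show ?thesis
    using assms by (simp add: divide_ennreal ennreal_mult[symmetric])
next
  case top
  then show ?thesis
    using assms by (simp add: ennreal_top_divide ennreal_mult_top)
qed

text \<open>Markov's inequality for the limit of an increasing sequence.\<close>

lemma emeasure_le_of_Markov:
  assumes [measurable]: "\<And>N::nat. Z N \<in> borel_measurable M" "A \<in> sets M"
    and mono: "\<And>N x. Z N x \<le> Z (Suc N) x"
    and int: "\<And>N. (\<integral>\<^sup>+x. Z N x \<partial>M) \<le> ennreal (\<epsilon> * \<theta>) * e"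
    and A: "AE x in M. x \<in> A \<longrightarrow> (\<exists>N. ennreal \<theta> \<le> Z N x)" and \<theta>: "0 < \<theta>" "0 \<le> \<epsilon>"
  shows "emeasure M A \<le> ennreal \<epsilon> * e"
proof -
  have "ennreal \<theta> * emeasure M A = (\<integral>\<^sup>+x. ennreal \<theta> * indicator A x \<partial>M)"
    by (simp add: nn_integral_cmult_indicator)
  also have "\<dots> \<le> (\<integral>\<^sup>+x. (SUP N. Z N x) \<partial>M)"
  proof (rule nn_integral_mono_AE)
    show "AE x in M. ennreal \<theta> * indicator A x \<le> (SUP N. Z N x)"
      using A by eventually_elim (auto simp: indicator_def intro: SUP_upper2)
  qed
  also have "\<dots> = (SUP N. \<integral>\<^sup>+x. Z N x \<partial>M)"
    by (rule nn_integral_monotone_convergence_SUP) (auto simp: incseq_Suc_iff le_fun_def mono)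
  also have "\<dots> \<le> ennreal (\<epsilon> * \<theta>) * e" by (rule SUP_least) (rule int)
  finally have "ennreal (1 / \<theta>) * (ennreal \<theta> * emeasure M A) \<le> ennreal (1 / \<theta>) * (ennreal (\<epsilon> * \<theta>) * e)"
    by (rule mult_left_mono) auto
  then show ?thesis using \<theta> by (simp add: mult.assoc[symmetric] ennreal_mult[symmetric])
qed

lemma integrable_mult_L2:
  assumes [measurable]: "f \<in> borel_measurable M" "g \<in> borel_measurable M"
    and "integrable M (\<lambda>x. (f x)\<^sup>2)" "integrable M (\<lambda>x. (g x)\<^sup>2)"
  shows "integrable M (\<lambda>x. f x * g x :: real)"
proof (rule Bochner_Integration.integrable_bound)
  show "integrable M (\<lambda>x. (f x)\<^sup>2 + (g x)\<^sup>2)" using assms by simp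
  have "\<bar>a * b\<bar> \<le> a\<^sup>2 + b\<^sup>2" for a b :: real
  proof -
    have "0 \<le> \<bar>a\<bar> * \<bar>b\<bar>" by simp
    then show ?thesis using sum_squares_bound[of "\<bar>a\<bar>" "\<bar>b\<bar>"] unfolding abs_mult power2_abs by linarith
  qed
  then show "AE x in M. norm (f x * g x) \<le> norm ((f x)\<^sup>2 + (g x)\<^sup>2)" by simp
qed simp

lemma sum_after:
  fixes u :: "nat \<Rightarrow> real"
  assumes "m \<le> n"
  shows "(\<Sum>k\<le>n. if m < k then u k else 0) = (\<Sum>k\<le>n. u k) - (\<Sum>k\<le>m. u k)"
  using assms
proof (induction n rule: dec_induct)
  case base
  show ?case by (simp add: sum.neutral)
qed simp

section \<open>Martingale difference sequences and functionals of their paths\<close>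

text \<open>The running maximum of the partial sums of \<open>u\<close>; for the differences of a martingale it is the
  maximal function up to time \<open>n\<close>.\<close>

definition run_max :: "nat \<Rightarrow> (nat \<Rightarrow> real) \<Rightarrow> real" where
  "run_max n u = Max ((\<lambda>j. \<bar>\<Sum>k\<le>j. u k\<bar>) ` {..n})"

text \<open>The square function of \<open>u\<close> up to time \<open>n\<close>.\<close>

definition run_sq :: "nat \<Rightarrow> (nat \<Rightarrow> real) \<Rightarrow> real" where
  "run_sq n u = sqrt (\<Sum>k\<le>n. (u k)\<^sup>2)"

lemma run_max_0: "run_max 0 u = \<bar>u 0\<bar>"
  by (simp add: run_max_def)

lemma run_max_Suc: "run_max (Suc n) u = max (run_max n u) \<bar>\<Sum>k\<le>Suc n. u k\<bar>"
proof -
  have "run_max (Suc n) u = Max (insert \<bar>\<Sum>k\<le>Suc n. u k\<bar> ((\<lambda>j. \<bar>\<Sum>k\<le>j. u k\<bar>) ` {..n}))"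
    unfolding run_max_def by (simp add: atMost_Suc)
  also have "\<dots> = max \<bar>\<Sum>k\<le>Suc n. u k\<bar> (run_max n u)"
    unfolding run_max_def by (subst Max_insert) auto
  finally show ?thesis by (simp add: max.commute)
qed

lemma run_max_ge: "j \<le> n \<Longrightarrow> \<bar>\<Sum>k\<le>j. u k\<bar> \<le> run_max n u"
  unfolding run_max_def by (rule Max_ge) auto

lemma run_max_leI: "(\<And>j. j \<le> n \<Longrightarrow> \<bar>\<Sum>k\<le>j. u k\<bar> \<le> c) \<Longrightarrow> run_max n u \<le> c"
  unfolding run_max_def by (subst Max_le_iff) auto

lemma run_max_nonneg: "0 \<le> run_max n u"
  using run_max_ge[of 0 n u] by auto

lemma run_max_cong: "(\<And>k. k \<le> n \<Longrightarrow> u k = v k) \<Longrightarrow> run_max n u = run_max n v"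
  unfolding run_max_def by (intro arg_cong[of _ _ Max] image_cong arg_cong[of _ _ abs] sum.cong) auto

lemma borel_measurable_run_max:
  assumes "\<And>k. k \<le> n \<Longrightarrow> u k \<in> borel_measurable N"
  shows "(\<lambda>x. run_max n (\<lambda>k. u k x)) \<in> borel_measurable N"
  using assms
proof (induction n)
  case 0
  have [measurable]: "u 0 \<in> borel_measurable N" using 0 by simp
  show ?case by (simp add: run_max_0)
next
  case (Suc n)
  have [measurable]: "(\<lambda>x. run_max n (\<lambda>k. u k x)) \<in> borel_measurable N"
    by (rule Suc.IH) (use Suc.prems in auto)
  have [measurable]: "(\<lambda>x. \<Sum>k\<le>Suc n. u k x) \<in> borel_measurable N"
    by (rule borel_measurable_sum) (use Suc.prems in auto)
  show ?case unfolding run_max_Suc by measurable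
qed

text \<open>Summation by parts against the running maximum, which gives Doob's \<open>L\<^sup>2\<close> inequality path by path:
  the sum on the left has mean zero for martingale differences, and \<open>run_max_sq_le\<close> bounds the square of
  the maximum by four times that of the final value up to a multiple of this sum.\<close>

lemma run_max_pathwise:
  "(\<Sum>k<n. run_max k u * sgn (\<Sum>i\<le>k. u i) * u (Suc k))
     \<le> run_max n u * \<bar>\<Sum>i\<le>n. u i\<bar> - (run_max n u)\<^sup>2 / 2"
proof (induction n)
  case 0
  show ?case by (simp add: run_max_0 power2_eq_square)
next
  case (Suc n)
  define g where "g = (\<Sum>i\<le>n. u i)"
  define y where "y = \<bar>\<Sum>i\<le>Suc n. u i\<bar>"
  define m where "m = run_max n u"
  have m: "0 \<le> m" "\<bar>g\<bar> \<le> m" by (auto simp: m_def g_def run_max_nonneg run_max_ge)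
  have "sgn g * u (Suc n) \<le> y - \<bar>g\<bar>"
    by (auto simp: y_def g_def sgn_real_def abs_if)
  then have "m * (sgn g * u (Suc n)) \<le> m * (y - \<bar>g\<bar>)" using m by (intro mult_left_mono)
  moreover have "(\<Sum>k<n. run_max k u * sgn (\<Sum>i\<le>k. u i) * u (Suc k)) \<le> m * \<bar>g\<bar> - m\<^sup>2 / 2"
    using Suc.IH by (simp add: m_def g_def)
  ultimately have "(\<Sum>k<Suc n. run_max k u * sgn (\<Sum>i\<le>k. u i) * u (Suc k)) \<le> m * y - m\<^sup>2 / 2"
    by (simp add: m_def g_def algebra_simps)
  also have "\<dots> \<le> max m y * y - (max m y)\<^sup>2 / 2"
  proof (cases "y \<le> m")
    case False
    have "0 \<le> (y - m)\<^sup>2" by simp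
    then have "m * y - m\<^sup>2 / 2 \<le> y * y - y\<^sup>2 / 2" by (simp add: power2_eq_square algebra_simps)
    then show ?thesis using False by (simp add: max_def)
  qed (simp add: max_def)
  finally show ?case by (simp add: run_max_Suc m_def y_def)
qed

lemma run_max_sq_le:
  "(run_max n u)\<^sup>2 \<le> 4 * (\<Sum>i\<le>n. u i)\<^sup>2 - 4 * (\<Sum>k<n. run_max k u * sgn (\<Sum>i\<le>k. u i) * u (Suc k))"
proof -
  define g where "g = \<bar>\<Sum>i\<le>n. u i\<bar>"
  define m where "m = run_max n u"
  have "0 \<le> (m / 2 - g)\<^sup>2" by simp
  then have "m * g - m\<^sup>2 / 2 \<le> g\<^sup>2 - m\<^sup>2 / 4" by (simp add: power2_eq_square field_simps)
  then have "(\<Sum>k<n. run_max k u * sgn (\<Sum>i\<le>k. u i) * u (Suc k)) \<le> g\<^sup>2 - m\<^sup>2 / 4"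
    using run_max_pathwise[of u n] by (simp add: g_def m_def)
  then show ?thesis by (simp add: g_def m_def)
qed

text \<open>The \<open>\<sigma>\<close>-algebras are represented by measures of which only the measurable sets matter.\<close>

locale filtered_prob = prob_space M for M :: "'a measure" +
  fixes F :: "nat \<Rightarrow> 'a measure"
  assumes subalg: "\<And>n. subalgebra M (F n)"
    and sets_mono: "\<And>m n. m \<le> n \<Longrightarrow> sets (F m) \<subseteq> sets (F n)"
begin

lemma space_F [simp]: "space (F n) = space M"
  using subalg[of n] by (simp add: subalgebra_def)

lemma sets_F_M: "A \<in> sets (F n) \<Longrightarrow> A \<in> sets M"
  using subalg[of n] by (auto simp: subalgebra_def)

lemma sets_F_mono: "A \<in> sets (F m) \<Longrightarrow> m \<le> n \<Longrightarrow> A \<in> sets (F n)"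
  using sets_mono by auto

lemma measurable_F_M: "f \<in> borel_measurable (F n) \<Longrightarrow> f \<in> borel_measurable M"
  using measurable_from_subalg[OF subalg] .

lemma measurable_F_mono: "f \<in> measurable (F m) N \<Longrightarrow> m \<le> n \<Longrightarrow> f \<in> measurable (F n) N"
  by (rule measurable_from_subalg[of "F n" "F m"]) (auto simp: subalgebra_def sets_F_mono)

lemma sfs: "sigma_finite_subalgebra M (F n)"
proof -
  interpret finite_measure_subalgebra M "F n" by unfold_locales (rule subalg)
  show ?thesis by (rule finite_measure_subalgebra_is_sigma_finite) unfold_locales
qed

text \<open>Square integrable martingale difference sequences. There is no condition on the mean of \<open>e\<^sub>0\<close>,
  because the first difference of a martingale is its initial value.\<close>

definition mds :: "(nat \<Rightarrow> 'a \<Rightarrow> real) \<Rightarrow> bool" where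
  "mds e \<longleftrightarrow> (\<forall>k. e k \<in> borel_measurable (F k) \<and> integrable M (\<lambda>x. (e k x)\<^sup>2)) \<and>
     (\<forall>k. AE x in M. real_cond_exp M (F k) (e (Suc k)) x = 0)"

lemma mds_orthogonal:
  assumes e: "mds e" and h: "h \<in> borel_measurable (F k)" "integrable M (\<lambda>x. (h x)\<^sup>2)"
  shows "integrable M (\<lambda>x. h x * e (Suc k) x)" "(\<integral>x. h x * e (Suc k) x \<partial>M) = 0"
proof -
  interpret sigma_finite_subalgebra M "F k" by (rule sfs)
  have [measurable]: "e (Suc k) \<in> borel_measurable M" "h \<in> borel_measurable M"
    using e h measurable_F_M by (auto simp: mds_def)
  show i: "integrable M (\<lambda>x. h x * e (Suc k) x)"
    by (rule integrable_mult_L2) (use e h in \<open>auto simp: mds_def\<close>)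
  have "AE x in M. real_cond_exp M (F k) (\<lambda>x. h x * e (Suc k) x) x = 0"
  proof -
    have "AE x in M. real_cond_exp M (F k) (e (Suc k)) x = 0" using e by (simp add: mds_def)
    moreover have "AE x in M. real_cond_exp M (F k) (\<lambda>x. h x * e (Suc k) x) x
        = h x * real_cond_exp M (F k) (e (Suc k)) x"
      by (rule real_cond_exp_mult[OF h(1) _ i]) simp
    ultimately show ?thesis by eventually_elim simp
  qed
  then have "(\<integral>x. real_cond_exp M (F k) (\<lambda>x. h x * e (Suc k) x) x \<partial>M) = 0"
    by (simp add: integral_eq_zero_AE)
  then show "(\<integral>x. h x * e (Suc k) x \<partial>M) = 0"
    using real_cond_exp_int(2)[OF i] by simp
qed

lemma mds_partial_sum:
  assumes e: "mds e"
  shows "(\<lambda>x. \<Sum>k\<le>n. e k x) \<in> borel_measurable (F n)"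
    and "integrable M (\<lambda>x. (\<Sum>k\<le>n. e k x)\<^sup>2)"
    and "(\<integral>x. (\<Sum>k\<le>n. e k x)\<^sup>2 \<partial>M) = (\<Sum>k\<le>n. \<integral>x. (e k x)\<^sup>2 \<partial>M)"
proof -
  show meas: "(\<lambda>x. \<Sum>k\<le>n. e k x) \<in> borel_measurable (F n)" for n
    by (rule borel_measurable_sum, rule measurable_F_mono) (use e in \<open>auto simp: mds_def\<close>)
  have "integrable M (\<lambda>x. (\<Sum>k\<le>n. e k x)\<^sup>2) \<and>
    (\<integral>x. (\<Sum>k\<le>n. e k x)\<^sup>2 \<partial>M) = (\<Sum>k\<le>n. \<integral>x. (e k x)\<^sup>2 \<partial>M)"
  proof (induction n)
    case 0
    then show ?case using e by (simp add: mds_def)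
  next
    case (Suc n)
    note o = mds_orthogonal[OF e meas conjunct1[OF Suc]]
    have eq: "(\<Sum>k\<le>Suc n. e k x)\<^sup>2 = (\<Sum>k\<le>n. e k x)\<^sup>2 + 2 * ((\<Sum>k\<le>n. e k x) * e (Suc n) x) + (e (Suc n) x)\<^sup>2" for x
      by (simp add: power2_sum)
    have i: "integrable M (\<lambda>x. (e (Suc n) x)\<^sup>2)" using e by (simp add: mds_def)
    show ?case unfolding eq using Suc i o by simp
  qed
  then show "integrable M (\<lambda>x. (\<Sum>k\<le>n. e k x)\<^sup>2)"
    "(\<integral>x. (\<Sum>k\<le>n. e k x)\<^sup>2 \<partial>M) = (\<Sum>k\<le>n. \<integral>x. (e k x)\<^sup>2 \<partial>M)" by auto
qed

lemma run_max_measurable_F: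
  assumes "\<And>k. e k \<in> borel_measurable (F k)"
  shows "(\<lambda>x. run_max n (\<lambda>k. e k x)) \<in> borel_measurable (F n)"
  by (rule borel_measurable_run_max) (use assms measurable_F_mono in blast)

lemma mds_run_max_integrable:
  assumes e: "mds e"
  shows "integrable M (\<lambda>x. (run_max n (\<lambda>k. e k x))\<^sup>2)"
proof (rule Bochner_Integration.integrable_bound)
  show "integrable M (\<lambda>x. \<Sum>j\<le>n. (\<Sum>k\<le>j. e k x)\<^sup>2)"
    by (rule Bochner_Integration.integrable_sum) (rule mds_partial_sum(2)[OF e])
  show "(\<lambda>x. (run_max n (\<lambda>k. e k x))\<^sup>2) \<in> borel_measurable M"
    using measurable_F_M[OF run_max_measurable_F[of e n]] e by (simp add: mds_def)
  have "(run_max n u)\<^sup>2 \<le> (\<Sum>j\<le>n. (\<Sum>k\<le>j. u k)\<^sup>2)" for u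
  proof -
    have "run_max n u \<in> (\<lambda>j. \<bar>\<Sum>k\<le>j. u k\<bar>) ` {..n}"
      unfolding run_max_def by (rule Max_in) auto
    then obtain j where "j \<le> n" "run_max n u = \<bar>\<Sum>k\<le>j. u k\<bar>" by auto
    then show ?thesis
      using member_le_sum[of j "{..n}" "\<lambda>j. (\<Sum>k\<le>j. u k)\<^sup>2"] by simp
  qed
  then show "AE x in M. norm ((run_max n (\<lambda>k. e k x))\<^sup>2) \<le> norm (\<Sum>j\<le>n. (\<Sum>k\<le>j. e k x)\<^sup>2)"
    by (auto simp: sum_nonneg)
qed

lemma Doob_L2:
  assumes e: "mds e"
  shows "(\<integral>\<^sup>+x. ennreal ((run_max n (\<lambda>k. e k x))\<^sup>2) \<partial>M) \<le> 4 * (\<Sum>k\<le>n. \<integral>\<^sup>+x. ennreal ((e k x)\<^sup>2) \<partial>M)"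
proof -
  have eF: "\<And>k. e k \<in> borel_measurable (F k)" using e by (simp add: mds_def)
  let ?h = "\<lambda>k x. run_max k (\<lambda>k. e k x) * sgn (\<Sum>i\<le>k. e i x)"
  have hm: "?h k \<in> borel_measurable (F k)" for k
    using run_max_measurable_F[of e k, OF eF] mds_partial_sum(1)[OF e, of k] by simp
  have hi: "integrable M (\<lambda>x. (?h k x)\<^sup>2)" for k
  proof (rule Bochner_Integration.integrable_bound[OF mds_run_max_integrable[OF e, of k]])
    show "(\<lambda>x. (?h k x)\<^sup>2) \<in> borel_measurable M" using measurable_F_M[OF hm[of k]] by simp
    show "AE x in M. norm ((?h k x)\<^sup>2) \<le> norm ((run_max k (\<lambda>k. e k x))\<^sup>2)"
      by (auto simp: power_mult_distrib sgn_real_def)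
  qed
  note o = mds_orthogonal[OF e hm hi]
  have si: "integrable M (\<lambda>x. \<Sum>k<n. ?h k x * e (Suc k) x)"
    by (rule Bochner_Integration.integrable_sum) (rule o(1))
  have "(\<integral>x. (run_max n (\<lambda>k. e k x))\<^sup>2 \<partial>M)
    \<le> (\<integral>x. 4 * (\<Sum>i\<le>n. e i x)\<^sup>2 - 4 * (\<Sum>k<n. ?h k x * e (Suc k) x) \<partial>M)"
    by (rule integral_mono) (use mds_run_max_integrable[OF e] mds_partial_sum(2)[OF e] si run_max_sq_le in auto)
  also have "\<dots> = 4 * (\<Sum>k\<le>n. \<integral>x. (e k x)\<^sup>2 \<partial>M)"
    using mds_partial_sum(2,3)[OF e] si o by simp
  finally have le: "(\<integral>x. (run_max n (\<lambda>k. e k x))\<^sup>2 \<partial>M) \<le> 4 * (\<Sum>k\<le>n. \<integral>x. (e k x)\<^sup>2 \<partial>M)" .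
  have ei: "(\<integral>\<^sup>+x. ennreal ((e k x)\<^sup>2) \<partial>M) = ennreal (\<integral>x. (e k x)\<^sup>2 \<partial>M)" for k
    using e by (intro nn_integral_eq_integral) (auto simp: mds_def)
  have "(\<integral>\<^sup>+x. ennreal ((run_max n (\<lambda>k. e k x))\<^sup>2) \<partial>M) = ennreal (\<integral>x. (run_max n (\<lambda>k. e k x))\<^sup>2 \<partial>M)"
    using mds_run_max_integrable[OF e] by (intro nn_integral_eq_integral) auto
  also have "\<dots> \<le> ennreal (4 * (\<Sum>k\<le>n. \<integral>x. (e k x)\<^sup>2 \<partial>M))" by (rule ennreal_leI[OF le])
  also have "\<dots> = 4 * (\<Sum>k\<le>n. \<integral>\<^sup>+x. ennreal ((e k x)\<^sup>2) \<partial>M)"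
    by (simp add: ei ennreal_mult sum_nonneg)
  finally show ?thesis .
qed

lemma martingaleD:
  assumes "martingale M F f"
  shows "f n \<in> borel_measurable (F n)" "integrable M (f n)" "f n \<in> borel_measurable M"
    and "n \<le> m \<Longrightarrow> AE x in M. real_cond_exp M (F n) (f m) x = f n x"
  using assms measurable_F_M by (auto simp: martingale_def)

lemma mdiff_measurable:
  assumes "martingale M F f"
  shows "mdiff f k \<in> borel_measurable (F k)" "integrable M (mdiff f k)" "mdiff f k \<in> borel_measurable M"
proof -
  have eq: "mdiff f k = (if k = 0 then f 0 else (\<lambda>x. f k x - f (k - 1) x))" by (auto simp: mdiff_def)
  show m: "mdiff f k \<in> borel_measurable (F k)"
    unfolding eq using martingaleD(1)[OF assms] measurable_F_mono[OF martingaleD(1)[OF assms, of "k - 1"], of k]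
    by auto
  show "integrable M (mdiff f k)" unfolding eq using martingaleD(2)[OF assms] by auto
  show "mdiff f k \<in> borel_measurable M" by (rule measurable_F_M[OF m])
qed

lemma sum_mdiff: "(\<Sum>k\<le>n. mdiff f k x) = f n x"
  by (induction n) (auto simp: mdiff_def)

lemma cond_exp_mdiff:
  assumes f: "martingale M F f"
  shows "AE x in M. real_cond_exp M (F k) (mdiff f (Suc k)) x = 0"
proof -
  interpret sigma_finite_subalgebra M "F k" by (rule sfs)
  have "mdiff f (Suc k) = (\<lambda>x. f (Suc k) x - f k x)" by (auto simp: mdiff_def)
  moreover have "AE x in M. real_cond_exp M (F k) (\<lambda>x. f (Suc k) x - f k x) x
      = real_cond_exp M (F k) (f (Suc k)) x - real_cond_exp M (F k) (f k) x"
    by (rule real_cond_exp_diff) (use martingaleD[OF f] in auto)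
  ultimately show ?thesis
    using martingaleD(4)[OF f, of k "Suc k"] martingaleD(4)[OF f, of k k] by auto
qed

text \<open>Differences restricted to predictable sets, that is stopped or started martingales, are martingale
  differences. The index \<open>k - 1\<close> is 0 for \<open>k = 0\<close>, so \<open>H\<^sub>0\<close> has to be in \<open>F\<^sub>0\<close> only.\<close>

lemma mds_restrict_mdiff:
  assumes f: "martingale M F f" and H: "\<And>k. H k \<in> sets (F (k - 1))"
    and fin: "\<And>k. (\<integral>\<^sup>+x. ennreal ((mdiff f k x)\<^sup>2) * indicator (H k) x \<partial>M) < \<infinity>"
  shows "mds (\<lambda>k x. indicator (H k) x * mdiff f k x)"
  unfolding mds_def
proof (intro conjI allI)
  fix k
  have HF [measurable]: "H k \<in> sets (F k)" "H k \<in> sets M"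
    using sets_F_mono[OF H] sets_F_M H by auto
  have dm [measurable]: "mdiff f k \<in> borel_measurable (F k)" "mdiff f k \<in> borel_measurable M"
    using mdiff_measurable[OF f] by auto
  show "(\<lambda>x. indicator (H k) x * mdiff f k x) \<in> borel_measurable (F k)" by measurable
  show "integrable M (\<lambda>x. (indicator (H k) x * mdiff f k x)\<^sup>2)"
  proof (rule integrableI_bounded)
    have "(\<integral>\<^sup>+x. ennreal (norm ((indicator (H k) x * mdiff f k x)\<^sup>2)) \<partial>M)
      = (\<integral>\<^sup>+x. ennreal ((mdiff f k x)\<^sup>2) * indicator (H k) x \<partial>M)"
      by (rule nn_integral_cong) (simp add: indicator_def)
    then show "(\<integral>\<^sup>+x. ennreal (norm ((indicator (H k) x * mdiff f k x)\<^sup>2)) \<partial>M) < \<infinity>"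
      using fin[of k] by simp
  qed measurable
next
  fix k
  interpret sigma_finite_subalgebra M "F k" by (rule sfs)
  have HF [measurable]: "H (Suc k) \<in> sets (F k)" "H (Suc k) \<in> sets M"
    using H[of "Suc k"] sets_F_M by auto
  have [measurable]: "mdiff f (Suc k) \<in> borel_measurable M" by (rule mdiff_measurable[OF f])
  have "integrable M (\<lambda>x. indicator (H (Suc k)) x * mdiff f (Suc k) x)"
    using integrable_mult_indicator[OF HF(2) mdiff_measurable(2)[OF f]] by simp
  from real_cond_exp_mult[OF _ _ this]
  show "AE x in M. real_cond_exp M (F k) (\<lambda>x. indicator (H (Suc k)) x * mdiff f (Suc k) x) x = 0"
    using cond_exp_mdiff[OF f, of k] by auto
qed

lemma nn_cond_exp_indicator:
  assumes H: "H \<in> sets (F k)" and [measurable]: "g \<in> borel_measurable M"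
  shows "(\<integral>\<^sup>+x. nn_cond_exp M (F k) g x * indicator H x \<partial>M) = (\<integral>\<^sup>+x. g x * indicator H x \<partial>M)"
proof -
  interpret sigma_finite_subalgebra M "F k" by (rule sfs)
  have [measurable]: "H \<in> sets (F k)" by fact
  have "(\<integral>\<^sup>+x. indicator H x * nn_cond_exp M (F k) g x \<partial>M) = (\<integral>\<^sup>+x. indicator H x * g x \<partial>M)"
    by (rule nn_cond_exp_intg) measurable
  then show ?thesis by (simp add: mult.commute)
qed

end

text \<open>The properties shared by the running maximum and the running square function. \<open>q n u\<close> depends on
  \<open>u\<^sub>0, \<dots>, u\<^sub>n\<close> only; \<open>q_stop\<close> says that nothing is added once the differences vanish, and \<open>q_L2\<close> is the
  common form of Doob's inequality and of orthogonality.\<close>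

locale path_functional = filtered_prob M F for M :: "'a measure" and F +
  fixes q :: "nat \<Rightarrow> (nat \<Rightarrow> real) \<Rightarrow> real"
  assumes q_0: "q 0 u = \<bar>u 0\<bar>"
    and q_Suc_le: "q (Suc n) u \<le> q n u + \<bar>u (Suc n)\<bar>"
    and q_le_Suc: "q n u \<le> q (Suc n) u"
    and q_add: "q n (\<lambda>k. u k + v k) \<le> q n u + q n v"
    and q_cong: "(\<And>k. k \<le> n \<Longrightarrow> u k = v k) \<Longrightarrow> q n u = q n v"
    and q_stop: "(\<And>k. m < k \<Longrightarrow> u k = 0) \<Longrightarrow> m \<le> n \<Longrightarrow> q n u = q m u"
    and q_measurable: "\<And>n N e. (\<And>k. k \<le> n \<Longrightarrow> e k \<in> borel_measurable N) \<Longrightarrow>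
      (\<lambda>x::'a. q n (\<lambda>k. e k x)) \<in> borel_measurable N"
    and q_L2: "mds e \<Longrightarrow>
      (\<integral>\<^sup>+x. ennreal ((q n (\<lambda>k. e k x))\<^sup>2) \<partial>M) \<le> 4 * (\<Sum>k\<le>n. \<integral>\<^sup>+x. ennreal ((e k x)\<^sup>2) \<partial>M)"
begin

lemma q_mono: "m \<le> n \<Longrightarrow> q m u \<le> q n u"
  by (rule lift_Suc_mono_le[of "\<lambda>n. q n u"]) (auto simp: q_le_Suc)

lemma q_nonneg: "0 \<le> q n u"
  using q_mono[of 0 n u] by (simp add: q_0)

lemma q_zero: "q n (\<lambda>_. 0) = 0"
  using q_stop[of 0 "\<lambda>_. 0" n] by (simp add: q_0)

lemma q_le_sum: "q n u \<le> (\<Sum>k\<le>n. \<bar>u k\<bar>)"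
proof (induction n)
  case (Suc n)
  then show ?case using q_Suc_le[of n u] by simp
qed (simp add: q_0)

lemma q_sum_le: "finite I \<Longrightarrow> q n (\<lambda>k. \<Sum>i\<in>I. u i k) \<le> (\<Sum>i\<in>I. q n (u i))"
proof (induction I rule: finite_induct)
  case (insert i I)
  then show ?case using q_add[of n "u i" "\<lambda>k. \<Sum>i\<in>I. u i k"] by simp
qed (simp add: q_zero)

end

context filtered_prob
begin

lemma path_functional_run_max: "path_functional M F run_max"
proof
  fix m n :: nat and u v :: "nat \<Rightarrow> real"
  show "run_max 0 u = \<bar>u 0\<bar>" by (rule run_max_0)
  have "\<bar>\<Sum>k\<le>Suc n. u k\<bar> \<le> run_max n u + \<bar>u (Suc n)\<bar>"
    using run_max_ge[of n n u] by simp
  then show "run_max (Suc n) u \<le> run_max n u + \<bar>u (Suc n)\<bar>" by (simp add: run_max_Suc)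
  show "run_max n u \<le> run_max (Suc n) u" by (simp add: run_max_Suc)
  show "run_max n (\<lambda>k. u k + v k) \<le> run_max n u + run_max n v"
  proof (rule run_max_leI)
    fix j assume "j \<le> n"
    then show "\<bar>\<Sum>k\<le>j. u k + v k\<bar> \<le> run_max n u + run_max n v"
      using run_max_ge[of j n u] run_max_ge[of j n v] by (simp add: sum.distrib)
  qed
  show "run_max n u = run_max m u" if "\<And>k. m < k \<Longrightarrow> u k = 0" "m \<le> n"
    using that(2)
  proof (induction n rule: dec_induct)
    case (step n)
    have "run_max (Suc n) u = max (run_max n u) \<bar>\<Sum>k\<le>n. u k\<bar>"
      using that(1)[of "Suc n"] step by (simp add: run_max_Suc)
    then show ?case using step run_max_ge[of n n u] by simp
  qed simp
next
  fix e :: "nat \<Rightarrow> 'a \<Rightarrow> real" and n and N :: "'a measure"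
  assume "\<And>k. k \<le> n \<Longrightarrow> e k \<in> borel_measurable N"
  then show "(\<lambda>x. run_max n (\<lambda>k. e k x)) \<in> borel_measurable N" by (rule borel_measurable_run_max)
qed (auto intro: Doob_L2 run_max_cong)

lemma path_functional_run_sq: "path_functional M F run_sq"
proof
  fix m n :: nat and u v :: "nat \<Rightarrow> real"
  show "run_sq 0 u = \<bar>u 0\<bar>" by (simp add: run_sq_def)
  show "run_sq (Suc n) u \<le> run_sq n u + \<bar>u (Suc n)\<bar>"
    using sqrt_add_le_add_sqrt[of "\<Sum>k\<le>n. (u k)\<^sup>2" "(u (Suc n))\<^sup>2"] by (simp add: run_sq_def sum_nonneg)
  show "run_sq n u \<le> run_sq (Suc n) u" by (simp add: run_sq_def)
  show "run_sq n (\<lambda>k. u k + v k) \<le> run_sq n u + run_sq n v"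
    using L2_set_triangle_ineq[of u v "{..n}"] by (simp add: run_sq_def L2_set_def)
  show "run_sq n u = run_sq n v" if "\<And>k. k \<le> n \<Longrightarrow> u k = v k"
    using that by (simp add: run_sq_def)
  show "run_sq n u = run_sq m u" if "\<And>k. m < k \<Longrightarrow> u k = 0" "m \<le> n"
  proof -
    have "(\<Sum>k\<le>m. (u k)\<^sup>2) = (\<Sum>k\<le>n. (u k)\<^sup>2)"
      by (rule sum.mono_neutral_left) (use that in auto)
    then show ?thesis by (simp add: run_sq_def)
  qed
next
  fix e :: "nat \<Rightarrow> 'a \<Rightarrow> real" and n and N :: "'a measure"
  assume "\<And>k. k \<le> n \<Longrightarrow> e k \<in> borel_measurable N"
  then have "(\<lambda>x. \<Sum>k\<le>n. (e k x)\<^sup>2) \<in> borel_measurable N"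
    by (intro borel_measurable_sum borel_measurable_power) auto
  then show "(\<lambda>x. run_sq n (\<lambda>k. e k x)) \<in> borel_measurable N" unfolding run_sq_def by simp
next
  fix e :: "nat \<Rightarrow> 'a \<Rightarrow> real" and n
  assume e: "mds e"
  then have [measurable]: "e k \<in> borel_measurable M" for k using measurable_F_M by (auto simp: mds_def)
  have "(\<integral>\<^sup>+x. ennreal ((run_sq n (\<lambda>k. e k x))\<^sup>2) \<partial>M) = (\<integral>\<^sup>+x. (\<Sum>k\<le>n. ennreal ((e k x)\<^sup>2)) \<partial>M)"
    by (simp add: run_sq_def sum_nonneg)
  also have "\<dots> = (\<Sum>k\<le>n. \<integral>\<^sup>+x. ennreal ((e k x)\<^sup>2) \<partial>M)"
    by (rule nn_integral_sum) measurable
  also have "\<dots> \<le> 4 * \<dots>"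
    using mult_right_mono[of 1 "4::ennreal" "\<Sum>k\<le>n. \<integral>\<^sup>+x. ennreal ((e k x)\<^sup>2) \<partial>M"] by simp
  finally show "(\<integral>\<^sup>+x. ennreal ((run_sq n (\<lambda>k. e k x))\<^sup>2) \<partial>M)
    \<le> 4 * (\<Sum>k\<le>n. \<integral>\<^sup>+x. ennreal ((e k x)\<^sup>2) \<partial>M)" .
qed

end

section \<open>Variable exponents on atoms\<close>

text \<open>If \<open>P t\<^sup>l\<^sup>o \<le> c\<close> then \<open>t\<close> is at most a power of \<open>1 / P\<close>, and the condition on \<open>P\<^sup>l\<^sup>o\<^sup>-\<^sup>h\<^sup>i\<close> makes \<open>t\<^sup>h\<^sup>i\<close> and
  \<open>t\<^sup>l\<^sup>o\<close> comparable.\<close>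

lemma powr_local_exponent:
  fixes P c t lo hi a b K :: real
  assumes "0 < P" "P * t powr lo \<le> c" "1 \<le> c" "1 \<le> t" "P powr (lo - hi) \<le> K" "1 \<le> K"
    and "0 < a" "a \<le> lo" "lo \<le> hi" "hi \<le> b"
  shows "t powr hi \<le> c powr (b / a) * K powr (1 / a) * t powr lo"
proof -
  define r where "r = (hi - lo) / lo"
  have lo: "0 < lo" using assms by simp
  have r: "0 \<le> r" "r \<le> b / a"
    using assms lo by (auto simp: r_def intro!: frac_le)
  have rlo: "lo * r = hi - lo" using lo by (simp add: r_def)
  have "t powr (hi - lo) = (t powr lo) powr r" by (simp add: powr_powr rlo)
  also have "\<dots> \<le> (c / P) powr r"
    using assms r by (intro powr_mono2) (auto simp: field_simps)
  also have "\<dots> = c powr r * (P powr (lo - hi)) powr (1 / lo)"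
  proof -
    have "(lo - hi) * (1 / lo) = - r" using lo by (simp add: r_def field_simps)
    then show ?thesis using assms by (simp add: powr_divide powr_powr powr_minus_divide)
  qed
  also have "\<dots> \<le> c powr (b / a) * K powr (1 / a)"
  proof (intro mult_mono)
    show "c powr r \<le> c powr (b / a)" using assms r by (intro powr_mono) auto
    have "(P powr (lo - hi)) powr (1 / lo) \<le> K powr (1 / lo)"
      using assms lo by (intro powr_mono2) auto
    also have "\<dots> \<le> K powr (1 / a)"
      using assms lo by (intro powr_mono divide_left_mono) auto
    finally show "(P powr (lo - hi)) powr (1 / lo) \<le> K powr (1 / a)" .
  qed auto
  finally have "t powr (hi - lo) \<le> c powr (b / a) * K powr (1 / a)" .
  then have "t powr (hi - lo) * t powr lo \<le> c powr (b / a) * K powr (1 / a) * t powr lo"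
    by (rule mult_right_mono) auto
  then show ?thesis by (simp add: powr_add[symmetric])
qed

text \<open>For every \<open>n\<close> the space is partitioned into the sets \<open>B n i\<close>, each of which is an atom of \<open>F\<^sub>n\<close> or a
  null set, and \<open>lo n i\<close> and \<open>hi n i\<close> are the essential bounds of \<open>p\<close> on \<open>B n i\<close>. Allowing null sets
  keeps the index set \<open>\<nat>\<close>; on them the bounds carry no information.\<close>

locale atomic_exponent = filtered_prob M F for M :: "'a measure" and F +
  fixes p :: "'a \<Rightarrow> real" and a b K :: real
    and B :: "nat \<Rightarrow> nat \<Rightarrow> 'a set" and lo hi :: "nat \<Rightarrow> nat \<Rightarrow> real"
  assumes p_measurable [measurable]: "p \<in> borel_measurable M"
    and a_pos: "0 < a" and a_le_b: "a \<le> b" and K: "1 \<le> K"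
    and p_bounds: "AE x in M. a \<le> p x \<and> p x \<le> b"
    and B_sets: "B n i \<in> sets (F n)" and B_disjoint: "disjoint_family (B n)"
    and B_cover: "(\<Union>i. B n i) = space M"
    and B_indivisible: "A \<in> sets (F n) \<Longrightarrow> A \<subseteq> B n i \<Longrightarrow> measure M A = 0 \<or> measure M A = measure M (B n i)"
    and lo_hi: "0 < measure M (B n i) \<Longrightarrow>
      a \<le> lo n i \<and> hi n i \<le> b \<and> (AE x in M. x \<in> B n i \<longrightarrow> lo n i \<le> p x \<and> p x \<le> hi n i)
      \<and> measure M (B n i) powr (lo n i - hi n i) \<le> K"
    and hi_least: "0 < measure M (B n i) \<Longrightarrow> AE x in M. x \<in> B n i \<longrightarrow> p x \<le> c \<Longrightarrow> hi n i \<le> c"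
begin

lemma b_pos: "0 < b" using a_pos a_le_b by simp

lemma B_M [measurable]: "B n i \<in> sets M"
  using B_sets sets_F_M by auto

lemma B_space: "x \<in> B n i \<Longrightarrow> x \<in> space M"
  using sets.sets_into_space[OF B_M] by blast

text \<open>The modular of the space \<open>L\<^sub>p\<^sub>(\<^sub>\<cdot>\<^sub>)\<close>.\<close>

definition modular :: "('a \<Rightarrow> ennreal) \<Rightarrow> ennreal" where
  "modular g = (\<integral>\<^sup>+x. epowr (g x) (p x) \<partial>M)"

text \<open>The index of the set of the \<open>n\<close>-th partition that contains \<open>x\<close>.\<close>

definition idx :: "nat \<Rightarrow> 'a \<Rightarrow> nat" where
  "idx n x = (THE i. x \<in> B n i)"

lemma idx_eq: "x \<in> B n i \<Longrightarrow> idx n x = i"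
  unfolding idx_def using B_disjoint[of n] by (auto simp: disjoint_family_on_def intro!: the_equality)

lemma in_B_idx: "x \<in> space M \<Longrightarrow> x \<in> B n (idx n x)"
  using B_cover[of n] idx_eq by (metis UN_E)

lemma idx_measurable [measurable]: "idx n \<in> measurable M (count_space UNIV)"
proof (rule measurableI)
  fix A :: "nat set"
  have "idx n -` A \<inter> space M = (\<Union>i\<in>A. B n i)"
    using in_B_idx[of _ n] idx_eq[of _ n] B_space by blast
  then show "idx n -` A \<inter> space M \<in> sets M" by simp
qed auto

text \<open>The essential supremum of \<open>p\<close> over the atom of \<open>F\<^sub>n\<close> around \<open>x\<close>.\<close>

definition Hi :: "nat \<Rightarrow> 'a \<Rightarrow> real" where
  "Hi n x = hi n (idx n x)"

lemma Hi_measurable [measurable]: "Hi n \<in> borel_measurable M"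
  unfolding Hi_def by measurable

lemma AE_not_in_null: "A \<in> sets M \<Longrightarrow> measure M A = 0 \<Longrightarrow> AE x in M. x \<notin> A"
  by (rule AE_not_in) (simp add: null_setsI emeasure_eq_measure)

lemma AE_Hi: "AE x in M. \<forall>n. p x \<le> Hi n x \<and> Hi n x \<le> b"
proof -
  have "AE x in M. x \<in> B n i \<longrightarrow> p x \<le> hi n i \<and> hi n i \<le> b" for n i
  proof (cases "measure M (B n i) = 0")
    case True
    then show ?thesis using AE_not_in_null[OF B_M True] by auto
  next
    case False
    then have "0 < measure M (B n i)" by (simp add: zero_less_measure_iff)
    from lo_hi[OF this] show ?thesis by auto
  qed
  then have "AE x in M. \<forall>n i. x \<in> B n i \<longrightarrow> p x \<le> hi n i \<and> hi n i \<le> b"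
    by (simp add: AE_all_countable)
  then show ?thesis
    by (rule AE_mp) (intro AE_I2, auto simp: Hi_def in_B_idx)
qed

lemma AE_Hi_antimono: "AE x in M. \<forall>m n. m \<le> n \<longrightarrow> Hi n x \<le> Hi m x"
proof -
  have "AE x in M. m \<le> n \<longrightarrow> x \<in> B n i \<inter> B m k \<longrightarrow> hi n i \<le> hi m k" for m n i k
  proof (cases "m \<le> n \<and> measure M (B n i \<inter> B m k) \<noteq> 0")
    case True
    \<comment> \<open>An atom of \<open>F\<^sub>n\<close> that meets \<open>B m k\<close> in positive measure is contained in it up to a null set.\<close>
    have inF: "B n i \<inter> B m k \<in> sets (F n)"
      using B_sets[of n i] sets_F_mono[OF B_sets[of m k], of n] True by auto
    then have eq: "measure M (B n i \<inter> B m k) = measure M (B n i)"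
      using B_indivisible[of "B n i \<inter> B m k" n i] True by auto
    then have pos: "0 < measure M (B n i)" using True by (auto simp: zero_less_measure_iff)
    have posm: "0 < measure M (B m k)"
      using pos eq finite_measure_mono[of "B n i \<inter> B m k" "B m k"] by auto
    have "measure M (B n i - B m k) = 0"
      using finite_measure_Diff'[OF B_M B_M, of n i m k] eq by simp
    then have "AE x in M. x \<notin> B n i - B m k" by (intro AE_not_in_null) auto
    then have "AE x in M. x \<in> B n i \<longrightarrow> p x \<le> hi m k" using lo_hi[OF posm] by auto
    from hi_least[OF pos this] show ?thesis by simp
  next
    case False
    show ?thesis
    proof (cases "m \<le> n")
      case True
      then have "AE x in M. x \<notin> B n i \<inter> B m k" using False by (intro AE_not_in_null) auto
      then show ?thesis by eventually_elim auto
    qed simp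
  qed
  then have "AE x in M. \<forall>m n i k. m \<le> n \<longrightarrow> x \<in> B n i \<inter> B m k \<longrightarrow> hi n i \<le> hi m k"
    by (simp add: AE_all_countable)
  then show ?thesis
    by (rule AE_mp) (intro AE_I2, auto simp: Hi_def in_B_idx)
qed

text \<open>The constant of \<open>local_exponent\<close>; like all later constants it depends only on \<open>a\<close>, \<open>b\<close>, \<open>K\<close>, the
  constant of regularity and its explicit parameters.\<close>

definition C1 :: "real \<Rightarrow> real \<Rightarrow> real" where
  "C1 R d = (R * d powr (- b)) powr (b / a) * K powr (1 / a) * R"

text \<open>If \<open>Y\<close> exceeds \<open>d 2\<^sup>j\<close> on a fixed proportion of a set \<open>E\<close> inside an atom, then on \<open>E\<close> the exponent
  may be replaced by its largest value at the cost of a constant. The bound on the modular of \<open>Y\<close>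
  limits \<open>P(E) 2\<^sup>j\<^sup>l\<^sup>o\<close>, after which \<open>powr_local_exponent\<close> applies.\<close>

lemma local_exponent:
  assumes E: "E \<in> sets (F m)" "E \<subseteq> B m i" and [measurable]: "Y \<in> borel_measurable M"
    and Y: "modular Y \<le> 1" and d: "0 < d" "d \<le> 1" and R: "1 \<le> R"
    and le: "emeasure M E \<le> ennreal R * emeasure M (E \<inter> {x\<in>space M. ennreal (d * 2 ^ j) < Y x})"
  shows "lev j (hi m i) * emeasure M E
    \<le> ennreal (C1 R d) * (\<integral>\<^sup>+x\<in>E \<inter> {x\<in>space M. ennreal (d * 2 ^ j) < Y x}. lev j (p x) \<partial>M)"
proof (cases "measure M E = 0")
  case True
  then show ?thesis by (simp add: emeasure_eq_measure)
next
  case False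
  have EM [measurable]: "E \<in> sets M" using E sets_F_M by auto
  define A where "A = E \<inter> {x\<in>space M. ennreal (d * 2 ^ j) < Y x}"
  have A [measurable]: "A \<in> sets M" unfolding A_def by measurable
  define t where "t = (2::real) ^ j"
  have t: "1 \<le> t" by (simp add: t_def)
  have levt: "lev j r = ennreal (t powr r)" for r
    by (simp add: t_def powr_realpow[symmetric] powr_powr)
  have EB: "measure M E = measure M (B m i)" using B_indivisible[OF E] False by auto
  then have pos: "0 < measure M (B m i)" using False by (simp add: zero_less_measure_iff)
  note lh = lo_hi[OF pos]
  have lohi: "lo m i \<le> hi m i"
  proof (rule ccontr)
    assume "\<not> lo m i \<le> hi m i"
    then have "\<not> (lo m i \<le> r \<and> r \<le> hi m i)" for r by auto
    with conjunct1[OF conjunct2[OF conjunct2[OF lh]]] have "AE x in M. x \<notin> B m i" by simp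
    then have "measure M (B m i) = 0" by (simp add: prob_eq_0)
    then show False using pos by simp
  qed
  have mE: "measure M E \<le> R * measure M A"
    using le R by (simp add: A_def[symmetric] emeasure_eq_measure ennreal_mult[symmetric])
  have AE_A: "AE x in M. x \<in> A \<longrightarrow> d powr b * t powr lo m i \<le> (d * t) powr p x \<and> t powr lo m i \<le> t powr p x"
    using p_bounds conjunct1[OF conjunct2[OF conjunct2[OF lh]]]
  proof eventually_elim
    case (elim x)
    show ?case
    proof
      assume "x \<in> A"
      then have px: "lo m i \<le> p x" using elim E by (auto simp: A_def)
      have "d powr b \<le> d powr p x" using elim d by (intro powr_mono') auto
      moreover have "t powr lo m i \<le> t powr p x" using px t by (intro powr_mono) auto
      ultimately show "d powr b * t powr lo m i \<le> (d * t) powr p x \<and> t powr lo m i \<le> t powr p x"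
        using d t by (auto simp: powr_mult intro!: mult_mono)
    qed
  qed
  have "ennreal (d powr b * t powr lo m i) * emeasure M A = (\<integral>\<^sup>+x. ennreal (d powr b * t powr lo m i) * indicator A x \<partial>M)"
    by (simp add: nn_integral_cmult_indicator)
  also have "\<dots> \<le> modular Y"
    unfolding modular_def
  proof (rule nn_integral_mono_AE)
    show "AE x in M. ennreal (d powr b * t powr lo m i) * indicator A x \<le> epowr (Y x) (p x)"
      using AE_A p_bounds
    proof eventually_elim
      case (elim x)
      show ?case
      proof (cases "x \<in> A")
        case True
        then have "ennreal (d powr b * t powr lo m i) \<le> epowr (ennreal (d * t)) (p x)"
          using elim d t by (auto simp: epowr_ennreal intro!: ennreal_leI)
        also have "\<dots> \<le> epowr (Y x) (p x)"
          using True elim a_pos by (intro epowr_mono) (auto simp: A_def t_def)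
        finally show ?thesis using True by simp
      qed simp
    qed
  qed
  also note Y
  finally have "d powr b * t powr lo m i * measure M A \<le> 1"
    by (simp add: emeasure_eq_measure ennreal_mult[symmetric])
  then have "R * (d powr b * t powr lo m i * measure M A) \<le> R * 1" using R by (intro mult_left_mono) auto
  moreover have "measure M E * (d powr b * t powr lo m i) \<le> R * measure M A * (d powr b * t powr lo m i)"
    by (rule mult_right_mono[OF mE]) auto
  ultimately have "measure M (B m i) * t powr lo m i * d powr b \<le> R" by (simp add: EB mult_ac)
  then have c: "measure M (B m i) * t powr lo m i \<le> R * d powr (- b)"
    using d by (simp add: powr_minus_divide field_simps)
  have "1 \<le> d powr (- b)" using powr_mono'[of "-b" 0 d] d b_pos by simp
  then have "1 * 1 \<le> R * d powr (- b)" using R by (intro mult_mono) auto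
  then have D: "t powr hi m i \<le> (R * d powr (- b)) powr (b / a) * K powr (1 / a) * t powr lo m i"
    using c t pos lh K a_pos lohi
    by (intro powr_local_exponent[where P = "measure M (B m i)"]) auto
  have "t powr hi m i * measure M E \<le> (R * d powr (- b)) powr (b / a) * K powr (1 / a) * t powr lo m i * (R * measure M A)"
    by (rule mult_mono[OF D mE]) auto
  then have "ennreal (t powr hi m i * measure M E) \<le> ennreal (C1 R d * (t powr lo m i * measure M A))"
    by (intro ennreal_leI) (simp add: C1_def mult_ac)
  then have "lev j (hi m i) * emeasure M E \<le> ennreal (C1 R d) * (ennreal (t powr lo m i) * emeasure M A)"
    using R by (simp add: levt emeasure_eq_measure ennreal_mult C1_def)
  also have "ennreal (t powr lo m i) * emeasure M A = (\<integral>\<^sup>+x. ennreal (t powr lo m i) * indicator A x \<partial>M)"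
    by (simp add: nn_integral_cmult_indicator)
  also have "\<dots> \<le> (\<integral>\<^sup>+x\<in>A. lev j (p x) \<partial>M)"
  proof (rule nn_integral_mono_AE)
    show "AE x in M. ennreal (t powr lo m i) * indicator A x \<le> lev j (p x) * indicator A x"
      using AE_A by eventually_elim (auto simp: levt indicator_def intro!: ennreal_leI)
  qed
  finally show ?thesis by (simp add: A_def mult_left_mono)
qed

text \<open>The event that \<open>X\<close> exceeds \<open>t\<close> for the first time at time \<open>n\<close>.\<close>

definition passage :: "(nat \<Rightarrow> 'a \<Rightarrow> ennreal) \<Rightarrow> real \<Rightarrow> nat \<Rightarrow> 'a set" where
  "passage X t n = {x\<in>space M. ennreal t < X n x \<and> (\<forall>k<n. X k x \<le> ennreal t)}"

text \<open>The event that \<open>X\<close> exceeds \<open>t\<close> at some time.\<close>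

definition above :: "(nat \<Rightarrow> 'a \<Rightarrow> ennreal) \<Rightarrow> real \<Rightarrow> 'a set" where
  "above X t = {x\<in>space M. \<exists>n. ennreal t < X n x}"

text \<open>The weight of level \<open>j\<close>, with the exponent replaced by its essential supremum over the atom around
  \<open>x\<close> at the time of first passage. Only its values on \<open>above X (2 ^ j)\<close> are used; elsewhere the passage
  time is a default value.\<close>

definition W :: "(nat \<Rightarrow> 'a \<Rightarrow> ennreal) \<Rightarrow> nat \<Rightarrow> 'a \<Rightarrow> ennreal" where
  "W X j x = lev j (Hi (LEAST n. ennreal (2 ^ j) < X n x) x)"

lemma passage_Least: "x \<in> passage X t n \<Longrightarrow> (LEAST n. ennreal t < X n x) = n"
  unfolding passage_def by (intro Least_equality) (auto simp: not_less[symmetric])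

lemma above_eq_UN_passage: "above X t = (\<Union>n. passage X t n)"
proof
  show "above X t \<subseteq> (\<Union>n. passage X t n)"
  proof
    fix x assume x: "x \<in> above X t"
    then obtain n where n: "ennreal t < X n x" by (auto simp: above_def)
    have "ennreal t < X (LEAST n. ennreal t < X n x) x"
      by (rule LeastI[of "\<lambda>n. ennreal t < X n x", OF n])
    moreover have "X k x \<le> ennreal t" if "k < (LEAST n. ennreal t < X n x)" for k
      using not_less_Least[OF that] by (simp only: not_less)
    ultimately have "x \<in> passage X t (LEAST n. ennreal t < X n x)"
      using x unfolding passage_def above_def by blast
    then show "x \<in> (\<Union>n. passage X t n)" by blast
  qed
qed (auto simp: above_def passage_def)

lemma passage_disjoint: "disjoint_family (passage X t)"
  unfolding disjoint_family_on_def using passage_Least by blast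

lemma passage_sets_F:
  assumes X: "\<And>n. X n \<in> borel_measurable (F n)"
  shows "passage X t n \<in> sets (F n)"
proof -
  have 1: "{x\<in>space (F n). ennreal t < X n x} \<in> sets (F n)"
    using X by measurable
  have 2: "{x\<in>space (F n). X k x \<le> ennreal t} \<in> sets (F n)" if "k < n" for k
  proof -
    have [measurable]: "X k \<in> borel_measurable (F n)"
      using measurable_F_mono[OF X, of k n] that by simp
    show ?thesis by measurable
  qed
  have "passage X t n = {x\<in>space (F n). ennreal t < X n x} \<inter> (\<Inter>k<n. {x\<in>space (F n). X k x \<le> ennreal t})"
    if "0 < n" using that by (auto simp: passage_def)
  moreover have "(\<Inter>k<n. {x\<in>space (F n). X k x \<le> ennreal t}) \<in> sets (F n)" if "0 < n"
    using 2 that by (intro sets.finite_INT) auto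
  moreover have "passage X t 0 = {x\<in>space (F 0). ennreal t < X 0 x}"
    by (auto simp: passage_def)
  ultimately show ?thesis using 1 by (cases "n = 0") auto
qed

lemma above_sets:
  assumes "\<And>n. X n \<in> borel_measurable (F n)"
  shows "above X t \<in> sets M"
  unfolding above_eq_UN_passage using passage_sets_F[OF assms] sets_F_M by auto

lemma W_measurable:
  assumes "\<And>n. X n \<in> borel_measurable (F n)"
  shows "W X j \<in> borel_measurable M"
proof -
  have [measurable]: "X n \<in> borel_measurable M" for n using assms measurable_F_M by auto
  show ?thesis unfolding W_def
    by (rule measurable_compose_countable[where f = "\<lambda>n x. lev j (Hi n x)"]) measurable
qed

text \<open>An inequality between integrals over the event \<open>above X t\<close> may be checked on the intersections of
  first passage events with atoms.\<close>

lemma integral_passage_mono: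
  assumes X: "\<And>n. X n \<in> borel_measurable (F n)"
    and [measurable]: "u \<in> borel_measurable M" "v \<in> borel_measurable M"
    and le: "\<And>n i. (\<integral>\<^sup>+x\<in>passage X t n \<inter> B n i. u x \<partial>M) \<le> (\<integral>\<^sup>+x\<in>passage X t n \<inter> B n i. v x \<partial>M)"
  shows "(\<integral>\<^sup>+x\<in>above X t. u x \<partial>M) \<le> (\<integral>\<^sup>+x\<in>above X t. v x \<partial>M)"
proof -
  have T [measurable]: "passage X t n \<in> sets M" for n using passage_sets_F[OF X] sets_F_M by auto
  have Teq: "passage X t n = (\<Union>i. passage X t n \<inter> B n i)" for n
    using B_cover[of n] by (auto simp: passage_def)
  have dj: "disjoint_family (\<lambda>i. passage X t n \<inter> B n i)" for n
    using B_disjoint[of n] by (auto simp: disjoint_family_on_def)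
  have *: "(\<integral>\<^sup>+x\<in>above X t. w x \<partial>M) = (\<Sum>n i. \<integral>\<^sup>+x\<in>passage X t n \<inter> B n i. w x \<partial>M)"
    if [measurable]: "w \<in> borel_measurable M" for w
  proof -
    have "(\<integral>\<^sup>+x\<in>above X t. w x \<partial>M) = (\<Sum>n. \<integral>\<^sup>+x\<in>passage X t n. w x \<partial>M)"
      unfolding above_eq_UN_passage by (rule nn_integral_disjoint_family) (auto simp: passage_disjoint)
    also have "\<dots> = (\<Sum>n. \<integral>\<^sup>+x\<in>(\<Union>i. passage X t n \<inter> B n i). w x \<partial>M)" using Teq by simp
    also have "\<dots> = (\<Sum>n i. \<integral>\<^sup>+x\<in>passage X t n \<inter> B n i. w x \<partial>M)"
      by (intro suminf_cong nn_integral_disjoint_family) (auto simp: dj)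
    finally show ?thesis .
  qed
  show ?thesis unfolding *[OF \<open>u \<in> borel_measurable M\<close>] *[OF \<open>v \<in> borel_measurable M\<close>]
    by (intro suminf_le le) auto
qed

lemma integral_W_passage:
  assumes A: "A \<in> sets M" "A \<subseteq> passage X (2 ^ j) n \<inter> B n i"
  shows "(\<integral>\<^sup>+x\<in>A. W X j x \<partial>M) = lev j (hi n i) * emeasure M A"
proof -
  have "W X j x = lev j (hi n i)" if "x \<in> A" for x
    using that A passage_Least[of x X "2 ^ j" n] idx_eq[of x n i] by (auto simp: W_def Hi_def)
  then have "(\<integral>\<^sup>+x\<in>A. W X j x \<partial>M) = (\<integral>\<^sup>+x. lev j (hi n i) * indicator A x \<partial>M)"
    by (intro nn_integral_cong) (auto simp: indicator_def)
  then show ?thesis using A by (simp add: nn_integral_cmult_indicator)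
qed

lemma AE_lev_le_W: "AE x in M. \<forall>X j. lev j (p x) \<le> W X j x"
  using AE_Hi by eventually_elim (auto simp: W_def intro!: ennreal_leI powr_mono mult_left_mono)

lemma modular_le_levels:
  assumes [measurable]: "X \<in> borel_measurable M"
  shows "modular X \<le> 1 + ennreal (2 powr b) * (\<Sum>j. \<integral>\<^sup>+x\<in>{x\<in>space M. ennreal (2 ^ j) < X x}. lev j (p x) \<partial>M)"
proof -
  have "modular X \<le> (\<integral>\<^sup>+x. 1 + (\<Sum>j. ennreal (2 powr b) * (lev j (p x) * indicator {x\<in>space M. ennreal (2 ^ j) < X x} x)) \<partial>M)"
    unfolding modular_def
  proof (rule nn_integral_mono_AE)
    show "AE x in M. epowr (X x) (p x)
      \<le> 1 + (\<Sum>j. ennreal (2 powr b) * (lev j (p x) * indicator {x\<in>space M. ennreal (2 ^ j) < X x} x))"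
      using p_bounds AE_space
    proof eventually_elim
      case (elim x)
      have "epowr (X x) (p x) \<le> 1 + (\<Sum>j. lev (Suc j) (p x) * indicator {ennreal (2 ^ j)<..} (X x))"
        using elim a_pos by (intro epowr_le_levels) auto
      also have "\<dots> \<le> 1 + (\<Sum>j. ennreal (2 powr b) * (lev j (p x) * indicator {x\<in>space M. ennreal (2 ^ j) < X x} x))"
      proof (intro add_left_mono suminf_le)
        fix j
        have "2 powr (real (Suc j) * p x) \<le> 2 powr (b + real j * p x)"
          using elim by (intro powr_mono) (auto simp: algebra_simps)
        then have "lev (Suc j) (p x) \<le> ennreal (2 powr b) * lev j (p x)"
          by (auto simp: ennreal_mult[symmetric] powr_add[symmetric] intro!: ennreal_leI)
        then show "lev (Suc j) (p x) * indicator {ennreal (2 ^ j)<..} (X x)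
           \<le> ennreal (2 powr b) * (lev j (p x) * indicator {x\<in>space M. ennreal (2 ^ j) < X x} x)"
          using elim by (auto simp: indicator_def)
      qed auto
      finally show ?case .
    qed
  qed
  also have "\<dots> = 1 + ennreal (2 powr b) * (\<Sum>j. \<integral>\<^sup>+x\<in>{x\<in>space M. ennreal (2 ^ j) < X x}. lev j (p x) \<partial>M)"
    by (simp add: nn_integral_add nn_integral_suminf nn_integral_cmult emeasure_space_1)
  finally show ?thesis .
qed

definition C2 :: "real \<Rightarrow> real" where
  "C2 d = d powr (- b) / (1 - 2 powr (- a))"

lemma C2_nonneg: "0 \<le> C2 d"
  using a_pos powr_less_one[of 2 "- a"] by (simp add: C2_def)

lemma levels_le_modular:
  assumes [measurable]: "Y \<in> borel_measurable M" and d: "0 < d" "d \<le> 1"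
  shows "(\<Sum>j. \<integral>\<^sup>+x\<in>{x\<in>space M. ennreal (d * 2 ^ j) < Y x}. lev j (p x) \<partial>M) \<le> ennreal (C2 d) * modular Y"
proof -
  have "(\<Sum>j. \<integral>\<^sup>+x\<in>{x\<in>space M. ennreal (d * 2 ^ j) < Y x}. lev j (p x) \<partial>M)
    = (\<integral>\<^sup>+x. (\<Sum>j. lev j (p x) * indicator {x\<in>space M. ennreal (d * 2 ^ j) < Y x} x) \<partial>M)"
    by (rule nn_integral_suminf[symmetric]) measurable
  also have "\<dots> \<le> (\<integral>\<^sup>+x. ennreal (C2 d) * epowr (Y x) (p x) \<partial>M)"
  proof (rule nn_integral_mono_AE)
    show "AE x in M. (\<Sum>j. lev j (p x) * indicator {x\<in>space M. ennreal (d * 2 ^ j) < Y x} x)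
      \<le> ennreal (C2 d) * epowr (Y x) (p x)"
      using p_bounds AE_space
    proof eventually_elim
      case (elim x)
      have "(\<Sum>j. lev j (p x) * indicator {ennreal (d * 2 ^ j)<..} (Y x)) \<le> ennreal (C2 d) * epowr (Y x) (p x)"
        unfolding C2_def using elim a_pos d by (intro suminf_levels_le) auto
      then show ?case using elim by (simp add: indicator_def)
    qed
  qed
  also have "\<dots> = ennreal (C2 d) * modular Y"
    unfolding modular_def by (rule nn_integral_cmult) measurable
  finally show ?thesis .
qed

end

section \<open>A good-\<open>\<lambda>\<close> inequality for variable exponents\<close>

context atomic_exponent
begin

text \<open>Homogeneous domination of modulars. Scaling by all \<open>l\<close> makes it a statement about the Luxemburg
  quasi-norms, see \<open>Lp_norm_le_of_dominated\<close> below.\<close>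

definition dominated :: "real \<Rightarrow> ('a \<Rightarrow> ennreal) \<Rightarrow> ('a \<Rightarrow> ennreal) \<Rightarrow> bool" where
  "dominated C X Y \<longleftrightarrow>
     (\<forall>l>0. modular (\<lambda>x. Y x / ennreal l) \<le> 1 \<longrightarrow> modular (\<lambda>x. X x / ennreal l) \<le> ennreal C)"

lemma above_eq_SUP: "above X t = {x\<in>space M. ennreal t < (SUP n. X n x)}"
  by (auto simp: above_def less_SUP_iff)

lemma modular_SUP_le:
  assumes X: "\<And>n. X n \<in> borel_measurable (F n)"
  shows "modular (\<lambda>x. SUP n. X n x)
    \<le> 1 + ennreal (2 powr b) * (\<Sum>j. \<integral>\<^sup>+x\<in>above X (2 ^ j). W X j x \<partial>M)"
proof -
  have [measurable]: "X n \<in> borel_measurable M" for n using X measurable_F_M by auto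
  have "modular (\<lambda>x. SUP n. X n x)
    \<le> 1 + ennreal (2 powr b) * (\<Sum>j. \<integral>\<^sup>+x\<in>above X (2 ^ j). lev j (p x) \<partial>M)"
    unfolding above_eq_SUP by (rule modular_le_levels) measurable
  also have "\<dots> \<le> 1 + ennreal (2 powr b) * (\<Sum>j. \<integral>\<^sup>+x\<in>above X (2 ^ j). W X j x \<partial>M)"
  proof (intro add_left_mono mult_left_mono suminf_le)
    fix j
    show "(\<integral>\<^sup>+x\<in>above X (2 ^ j). lev j (p x) \<partial>M) \<le> (\<integral>\<^sup>+x\<in>above X (2 ^ j). W X j x \<partial>M)"
      using AE_lev_le_W by (intro nn_integral_mono_AE) (auto intro!: mult_right_mono elim!: eventually_mono)
  qed auto
  finally show ?thesis .
qed

definition C_reg :: "real \<Rightarrow> real \<Rightarrow> real" where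
  "C_reg R d = 1 + 2 powr b * (C1 R d * C2 d)"

lemma C1_nonneg: "0 \<le> R \<Longrightarrow> 0 \<le> C1 R d"
  by (simp add: C1_def)

text \<open>The simplest situation: on every piece of every level, \<open>Y\<close> is large on a proportion \<open>1 / R\<close> of it. Then
  the weights \<open>W\<close> are controlled level by level.\<close>

lemma modular_SUP_le_of_local:
  assumes X: "\<And>n. X n \<in> borel_measurable (F n)" and [measurable]: "Y \<in> borel_measurable M"
    and Y: "modular Y \<le> 1" and d: "0 < d" "d \<le> 1" and R: "1 \<le> R"
    and loc: "\<And>j n i E. E \<in> sets (F n) \<Longrightarrow> E \<subseteq> passage X (2 ^ j) n \<inter> B n i \<Longrightarrow>
      emeasure M E \<le> ennreal R * emeasure M (E \<inter> {x\<in>space M. ennreal (d * 2 ^ j) < Y x})"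
  shows "modular (\<lambda>x. SUP n. X n x) \<le> ennreal (C_reg R d)"
    and "(\<integral>\<^sup>+x\<in>above X (2 ^ j). W X j x \<partial>M)
      \<le> ennreal (C1 R d) * (\<integral>\<^sup>+x\<in>{x\<in>space M. ennreal (d * 2 ^ j) < Y x}. lev j (p x) \<partial>M)"
proof -
  let ?Y = "\<lambda>j. {x\<in>space M. ennreal (d * 2 ^ j) < Y x}"
  have [measurable]: "W X j \<in> borel_measurable M" for j by (rule W_measurable[OF X])
  have G: "(\<integral>\<^sup>+x\<in>above X (2 ^ j). W X j x \<partial>M) \<le> ennreal (C1 R d) * (\<integral>\<^sup>+x\<in>?Y j. lev j (p x) \<partial>M)" for j
  proof -
    have "(\<integral>\<^sup>+x\<in>above X (2 ^ j). W X j x \<partial>M)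
      \<le> (\<integral>\<^sup>+x\<in>above X (2 ^ j). (ennreal (C1 R d) * (lev j (p x) * indicator (?Y j) x)) \<partial>M)"
    proof (rule integral_passage_mono[OF X])
      fix n i
      define E where "E = passage X (2 ^ j) n \<inter> B n i"
      have EF: "E \<in> sets (F n)" unfolding E_def using passage_sets_F[OF X] B_sets by auto
      then have EM [measurable]: "E \<in> sets M" by (rule sets_F_M)
      have "(\<integral>\<^sup>+x\<in>E. W X j x \<partial>M) = lev j (hi n i) * emeasure M E"
        by (rule integral_W_passage[OF EM]) (auto simp: E_def)
      also have "\<dots> \<le> ennreal (C1 R d) * (\<integral>\<^sup>+x\<in>E \<inter> ?Y j. lev j (p x) \<partial>M)"
        by (rule local_exponent[OF EF _ _ Y d R loc[OF EF]]) (auto simp: E_def)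
      also have "\<dots> = (\<integral>\<^sup>+x\<in>E. (ennreal (C1 R d) * (lev j (p x) * indicator (?Y j) x)) \<partial>M)"
        by (subst nn_integral_cmult[symmetric]) (auto intro!: nn_integral_cong simp: indicator_def)
      finally show "(\<integral>\<^sup>+x\<in>passage X (2 ^ j) n \<inter> B n i. W X j x \<partial>M)
        \<le> (\<integral>\<^sup>+x\<in>passage X (2 ^ j) n \<inter> B n i. (ennreal (C1 R d) * (lev j (p x) * indicator (?Y j) x)) \<partial>M)"
        unfolding E_def .
    qed measurable
    also have "\<dots> \<le> (\<integral>\<^sup>+x. ennreal (C1 R d) * (lev j (p x) * indicator (?Y j) x) \<partial>M)"
      by (rule nn_integral_mono) (auto simp: indicator_def)
    also have "\<dots> = ennreal (C1 R d) * (\<integral>\<^sup>+x\<in>?Y j. lev j (p x) \<partial>M)"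
      by (rule nn_integral_cmult) measurable
    finally show ?thesis .
  qed
  show "(\<integral>\<^sup>+x\<in>above X (2 ^ j). W X j x \<partial>M) \<le> ennreal (C1 R d) * (\<integral>\<^sup>+x\<in>?Y j. lev j (p x) \<partial>M)"
    by (rule G)
  have "(\<Sum>j. \<integral>\<^sup>+x\<in>above X (2 ^ j). W X j x \<partial>M)
      \<le> (\<Sum>j. ennreal (C1 R d) * (\<integral>\<^sup>+x\<in>?Y j. lev j (p x) \<partial>M))"
    by (intro suminf_le G) auto
  also have "\<dots> = ennreal (C1 R d) * (\<Sum>j. \<integral>\<^sup>+x\<in>?Y j. lev j (p x) \<partial>M)" by simp
  also have "\<dots> \<le> ennreal (C1 R d) * (ennreal (C2 d) * modular Y)"
    by (intro mult_left_mono levels_le_modular d) auto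
  also have "\<dots> \<le> ennreal (C1 R d) * (ennreal (C2 d) * 1)"
    by (intro mult_left_mono Y) auto
  finally have "modular (\<lambda>x. SUP n. X n x) \<le> 1 + ennreal (2 powr b) * (ennreal (C1 R d) * (ennreal (C2 d) * 1))"
    using modular_SUP_le[OF X] by (meson add_left_mono mult_left_mono order_trans zero_le)
  then show "modular (\<lambda>x. SUP n. X n x) \<le> ennreal (C_reg R d)"
    using R C1_nonneg[of R d] C2_nonneg[of d] by (simp add: C_reg_def ennreal_mult ennreal_plus)
qed

definition C_good :: "real \<Rightarrow> real" where
  "C_good d = 1 + 2 powr b * (2 + 2 * (C1 2 (d / 2) * C2 (d / 2)))"

text \<open>The good-\<open>\<lambda>\<close> inequality at unit scale. The condition \<open>4 * 2 powr b * \<epsilon> \<le> 1\<close> provides the factor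
  \<open>1 / 2\<close> in the recursion: one factor 2 comes from the dichotomy, and \<open>2 powr b\<close> from passing from level
  \<open>j + 1\<close> to level \<open>j\<close>.\<close>

lemma modular_SUP_le_of_good_lambda:
  assumes X: "\<And>n. X n \<in> borel_measurable (F n)" and Ym [measurable]: "Y \<in> borel_measurable M"
    and Y: "modular Y \<le> 1" and d: "0 < d" "d \<le> 1" and \<epsilon>: "0 \<le> \<epsilon>" "4 * 2 powr b * \<epsilon> \<le> 1"
    and gl: "\<And>j n E. E \<in> sets (F n) \<Longrightarrow> E \<subseteq> passage X (2 ^ j) n \<Longrightarrow>
      emeasure M (E \<inter> above X (2 * 2 ^ j) \<inter> {x\<in>space M. Y x \<le> ennreal (d * 2 ^ j)}) \<le> ennreal \<epsilon> * emeasure M E"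
  shows "modular (\<lambda>x. SUP n. X n x) \<le> ennreal (C_good d)"
proof -
  define G where "G j = (\<integral>\<^sup>+x\<in>above X (2 ^ j). W X j x \<partial>M)" for j
  define c where "c j = ennreal (C1 2 (d / 2)) * (\<integral>\<^sup>+x\<in>{x\<in>space M. ennreal (d / 2 * 2 ^ Suc j) < Y x}. lev (Suc j) (p x) \<partial>M)" for j
  have [measurable]: "W X j \<in> borel_measurable M" for j by (rule W_measurable[OF X])
  have [measurable]: "above X t \<in> sets M" for t by (rule above_sets[OF X])
  have step: "G (Suc j) \<le> c j + ennreal (1 / 2) * G j" for j
  proof -
    let ?Y = "{x\<in>space M. ennreal (d / 2 * 2 ^ Suc j) < Y x}"
    let ?N = "{x\<in>space M. Y x \<le> ennreal (d * 2 ^ j)}"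
    let ?C = "ennreal (C1 2 (d / 2))"
    \<comment> \<open>In terms of level \<open>j + 1\<close> the threshold \<open>d 2\<^sup>j\<close> is \<open>(d / 2) 2\<^sup>j\<^sup>+\<^sup>1\<close>; hence the parameter \<open>d / 2\<close>.\<close>
    have YN: "?N = space M - ?Y" by (auto simp: not_less)
    have "G (Suc j) \<le> (\<integral>\<^sup>+x\<in>above X (2 ^ Suc j). (?C * (lev (Suc j) (p x) * indicator ?Y x) + 2 * (W X (Suc j) x * indicator ?N x)) \<partial>M)"
      unfolding G_def
    proof (rule integral_passage_mono[OF X])
      fix n i
      define E where "E = passage X (2 ^ Suc j) n \<inter> B n i"
      have EF: "E \<in> sets (F n)" unfolding E_def using passage_sets_F[OF X] B_sets by auto
      then have EM [measurable]: "E \<in> sets M" by (rule sets_F_M)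
      have E: "E \<subseteq> passage X (2 ^ Suc j) n \<inter> B n i" by (simp add: E_def)
      have W: "(\<integral>\<^sup>+x\<in>E. W X (Suc j) x \<partial>M) = lev (Suc j) (hi n i) * emeasure M E"
        by (rule integral_W_passage[OF EM E])
      have split: "emeasure M E = emeasure M (E \<inter> ?Y) + emeasure M (E \<inter> ?N)"
      proof -
        have "(E \<inter> ?Y) \<union> (E \<inter> ?N) = E" using sets.sets_into_space[OF EM] by (auto simp: not_less)
        moreover have "emeasure M (E \<inter> ?Y) + emeasure M (E \<inter> ?N) = emeasure M ((E \<inter> ?Y) \<union> (E \<inter> ?N))"
          by (rule plus_emeasure) (measurable, auto)
        ultimately show ?thesis by simp
      qed
      have "(\<integral>\<^sup>+x\<in>E. W X (Suc j) x \<partial>M)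
        \<le> ?C * (\<integral>\<^sup>+x\<in>E \<inter> ?Y. lev (Suc j) (p x) \<partial>M) + 2 * (\<integral>\<^sup>+x\<in>E \<inter> ?N. W X (Suc j) x \<partial>M)"
      proof (cases "emeasure M E \<le> ennreal 2 * emeasure M (E \<inter> ?Y)")
        case True
        have "(\<integral>\<^sup>+x\<in>E. W X (Suc j) x \<partial>M) \<le> ?C * (\<integral>\<^sup>+x\<in>E \<inter> ?Y. lev (Suc j) (p x) \<partial>M)"
          unfolding W by (rule local_exponent[OF EF _ _ Y _ _ _ True]) (use d E in auto)
        then show ?thesis by (meson add_increasing2 zero_le)
      next
        case False
        have "measure M E = measure M (E \<inter> ?Y) + measure M (E \<inter> ?N)"
          using split by (simp add: emeasure_eq_measure ennreal_plus[symmetric] del: ennreal_plus)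
        moreover have "\<not> measure M E \<le> 2 * measure M (E \<inter> ?Y)"
        proof
          assume "measure M E \<le> 2 * measure M (E \<inter> ?Y)"
          then have "ennreal (measure M E) \<le> ennreal 2 * ennreal (measure M (E \<inter> ?Y))"
            by (subst ennreal_mult[symmetric]) (auto intro: ennreal_leI)
          then show False using False by (simp add: emeasure_eq_measure)
        qed
        ultimately have "measure M E \<le> 2 * measure M (E \<inter> ?N)" by linarith
        then have "ennreal (measure M E) \<le> ennreal 2 * ennreal (measure M (E \<inter> ?N))"
          by (subst ennreal_mult[symmetric]) (auto intro: ennreal_leI)
        then have "emeasure M E \<le> 2 * emeasure M (E \<inter> ?N)"
          by (simp add: emeasure_eq_measure)
        then have "lev (Suc j) (hi n i) * emeasure M E \<le> lev (Suc j) (hi n i) * (2 * emeasure M (E \<inter> ?N))"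
          by (rule mult_left_mono) auto
        also have "\<dots> = 2 * (\<integral>\<^sup>+x\<in>E \<inter> ?N. W X (Suc j) x \<partial>M)"
          by (subst integral_W_passage[where n = n and i = i]) (use E in \<open>auto simp: ac_simps\<close>)
        finally show ?thesis unfolding W by (meson add_increasing zero_le)
      qed
      also have "\<dots> = (\<integral>\<^sup>+x\<in>E. (?C * (lev (Suc j) (p x) * indicator ?Y x) + 2 * (W X (Suc j) x * indicator ?N x)) \<partial>M)"
        by (subst (1 2) nn_integral_cmult[symmetric], simp, simp, subst nn_integral_add[symmetric])
           (auto intro!: nn_integral_cong simp: indicator_def)
      finally show "(\<integral>\<^sup>+x\<in>passage X (2 ^ Suc j) n \<inter> B n i. W X (Suc j) x \<partial>M)
        \<le> (\<integral>\<^sup>+x\<in>passage X (2 ^ Suc j) n \<inter> B n i. (?C * (lev (Suc j) (p x) * indicator ?Y x) + 2 * (W X (Suc j) x * indicator ?N x)) \<partial>M)"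
        unfolding E_def .
    qed measurable
    also have "\<dots> \<le> (\<integral>\<^sup>+x. ?C * (lev (Suc j) (p x) * indicator ?Y x) + 2 * (W X (Suc j) x * indicator (above X (2 ^ Suc j) \<inter> ?N) x) \<partial>M)"
      by (rule nn_integral_mono) (auto simp: indicator_def)
    also have "\<dots> = c j + 2 * (\<integral>\<^sup>+x\<in>above X (2 ^ Suc j) \<inter> ?N. W X (Suc j) x \<partial>M)"
      unfolding c_def by (subst nn_integral_add) (simp_all add: nn_integral_cmult)
    \<comment> \<open>Level \<open>j\<close> is passed no later than level \<open>j + 1\<close>, so the exponent \<open>Hi\<close> can only grow when going back.\<close>
    also have "(\<integral>\<^sup>+x\<in>above X (2 ^ Suc j) \<inter> ?N. W X (Suc j) x \<partial>M)
      \<le> (\<integral>\<^sup>+x. ennreal (2 powr b) * (W X j x * indicator (above X (2 ^ Suc j) \<inter> ?N) x * indicator (above X (2 ^ j)) x) \<partial>M)"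
    proof (rule nn_integral_mono_AE)
      show "AE x in M. W X (Suc j) x * indicator (above X (2 ^ Suc j) \<inter> ?N) x
        \<le> ennreal (2 powr b) * (W X j x * indicator (above X (2 ^ Suc j) \<inter> ?N) x * indicator (above X (2 ^ j)) x)"
        using AE_Hi AE_Hi_antimono
      proof eventually_elim
        case (elim x)
        show ?case
        proof (cases "x \<in> above X (2 ^ Suc j)")
          case True
          define n where "n = (LEAST n. ennreal (2 ^ Suc j) < X n x)"
          define m where "m = (LEAST n. ennreal (2 ^ j) < X n x)"
          obtain k where "ennreal (2 ^ Suc j) < X k x" using True by (auto simp: above_def)
          then have "ennreal (2 ^ Suc j) < X n x" unfolding n_def by (rule LeastI)
          moreover have "ennreal (2 ^ j) \<le> ennreal (2 ^ Suc j)" by (rule ennreal_leI) auto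
          ultimately have n: "ennreal (2 ^ j) < X n x" by (rule le_less_trans[rotated])
          then have "m \<le> n" unfolding m_def by (rule Least_le)
          have aj: "x \<in> above X (2 ^ j)" using True n by (auto simp: above_def)
          have "real (Suc j) * Hi n x = real j * Hi n x + Hi n x" by (simp add: algebra_simps)
          also have "\<dots> \<le> real j * Hi m x + b"
            using elim \<open>m \<le> n\<close> by (intro add_mono mult_left_mono) auto
          finally have "2 powr (real (Suc j) * Hi n x) \<le> 2 powr (b + real j * Hi m x)"
            by (intro powr_mono) auto
          then have "W X (Suc j) x \<le> ennreal (2 powr b) * W X j x"
            unfolding W_def n_def[symmetric] m_def[symmetric]
            by (auto simp: ennreal_mult[symmetric] powr_add[symmetric] intro!: ennreal_leI)
          then show ?thesis using aj by (auto simp: indicator_def)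
        qed simp
      qed
    qed
    also have "\<dots> = ennreal (2 powr b) * (\<integral>\<^sup>+x\<in>above X (2 ^ j). (W X j x * indicator (above X (2 ^ Suc j) \<inter> ?N) x) \<partial>M)"
      by (rule nn_integral_cmult) measurable
    also have "\<dots> \<le> ennreal (2 powr b) * (\<integral>\<^sup>+x\<in>above X (2 ^ j). (ennreal \<epsilon> * W X j x) \<partial>M)"
    proof (intro mult_left_mono integral_passage_mono[OF X])
      fix n i
      define E where "E = passage X (2 ^ j) n \<inter> B n i"
      have EF: "E \<in> sets (F n)" unfolding E_def using passage_sets_F[OF X] B_sets by auto
      then have EM [measurable]: "E \<in> sets M" by (rule sets_F_M)
      have E: "E \<subseteq> passage X (2 ^ j) n \<inter> B n i" by (simp add: E_def)
      have "(\<integral>\<^sup>+x\<in>E. (W X j x * indicator (above X (2 ^ Suc j) \<inter> ?N) x) \<partial>M)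
        = (\<integral>\<^sup>+x\<in>E \<inter> above X (2 ^ Suc j) \<inter> ?N. W X j x \<partial>M)"
        by (rule nn_integral_cong) (auto simp: indicator_def)
      also have "\<dots> = lev j (hi n i) * emeasure M (E \<inter> above X (2 ^ Suc j) \<inter> ?N)"
        by (rule integral_W_passage) (use E in auto)
      also have "\<dots> \<le> lev j (hi n i) * (ennreal \<epsilon> * emeasure M E)"
        using gl[OF EF, of j] E by (intro mult_left_mono) auto
      also have "\<dots> = ennreal \<epsilon> * (\<integral>\<^sup>+x\<in>E. W X j x \<partial>M)"
        by (subst integral_W_passage[OF EM E]) (simp add: ac_simps)
      also have "\<dots> = (\<integral>\<^sup>+x\<in>E. (ennreal \<epsilon> * W X j x) \<partial>M)"
        by (subst nn_integral_cmult[symmetric]) (auto simp: ac_simps)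
      finally show "(\<integral>\<^sup>+x\<in>passage X (2 ^ j) n \<inter> B n i. (W X j x * indicator (above X (2 ^ Suc j) \<inter> ?N) x) \<partial>M)
        \<le> (\<integral>\<^sup>+x\<in>passage X (2 ^ j) n \<inter> B n i. (ennreal \<epsilon> * W X j x) \<partial>M)"
        unfolding E_def .
    qed auto
    also have "\<dots> = ennreal (2 powr b) * (ennreal \<epsilon> * G j)"
      unfolding G_def by (subst nn_integral_cmult[symmetric]) (auto simp: ac_simps)
    finally have "G (Suc j) \<le> c j + 2 * (ennreal (2 powr b) * (ennreal \<epsilon> * G j))"
      by (simp add: add_left_mono mult_left_mono)
    also have "2 * (ennreal (2 powr b) * (ennreal \<epsilon> * G j)) = ennreal (2 * 2 powr b * \<epsilon>) * G j"
      using \<epsilon> by (simp add: ennreal_mult ac_simps)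
    also have "\<dots> \<le> ennreal (1 / 2) * G j"
      using \<epsilon> by (intro mult_right_mono ennreal_leI) auto
    finally show ?thesis by (simp add: add_left_mono)
  qed
  have G0: "G 0 \<le> 1"
  proof -
    have "G 0 \<le> (\<integral>\<^sup>+x. 1 \<partial>M)"
      unfolding G_def by (rule nn_integral_mono) (auto simp: W_def indicator_def)
    then show ?thesis by (simp add: emeasure_space_1)
  qed
  have s_upto: "(\<Sum>j<N. c j) \<le> ennreal (C1 2 (d / 2) * C2 (d / 2))" for N
  proof -
    let ?g = "\<lambda>j. \<integral>\<^sup>+x\<in>{x\<in>space M. ennreal (d / 2 * 2 ^ j) < Y x}. lev j (p x) \<partial>M"
    have "(\<Sum>j<N. ?g (Suc j)) \<le> (\<Sum>j<Suc N. ?g j)"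
      by (simp only: sum.lessThan_Suc_shift add_increasing zero_le order_refl)
    also have "\<dots> \<le> (\<Sum>j. ?g j)" by (rule sum_le_suminf) auto
    also have "\<dots> \<le> ennreal (C2 (d / 2)) * modular Y"
      by (rule levels_le_modular) (use d in auto)
    also have "\<dots> \<le> ennreal (C2 (d / 2)) * 1" by (intro mult_left_mono Y) auto
    finally have "ennreal (C1 2 (d / 2)) * (\<Sum>j<N. ?g (Suc j)) \<le> ennreal (C1 2 (d / 2)) * (ennreal (C2 (d / 2)) * 1)"
      by (rule mult_left_mono) auto
    then show ?thesis
      using C1_nonneg[of 2 "d / 2"] C2_nonneg[of "d / 2"] by (simp add: c_def sum_distrib_left ennreal_mult)
  qed
  have part: "(\<Sum>j<N. G j) \<le> ennreal (2 + 2 * (C1 2 (d / 2) * C2 (d / 2)))" for N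
  proof -
    have "(\<Sum>j<N. G j) \<le> (\<Sum>j\<le>N. G j)" by (rule sum_mono2) auto
    also have "\<dots> \<le> (\<Sum>j\<le>N. G j) + G N" by simp
    also have "\<dots> \<le> 2 * G 0 + 2 * (\<Sum>j<N. c j)" by (rule sum_le_of_contraction) (rule step)
    also have "\<dots> \<le> 2 * 1 + 2 * ennreal (C1 2 (d / 2) * C2 (d / 2))"
      by (intro add_mono mult_left_mono G0 s_upto) auto
    also have "\<dots> = ennreal (2 + 2 * (C1 2 (d / 2) * C2 (d / 2)))"
      using C1_nonneg[of 2 "d / 2"] C2_nonneg[of "d / 2"] by (simp add: ennreal_plus ennreal_mult)
    finally show ?thesis .
  qed
  have "(\<Sum>j. G j) \<le> ennreal (2 + 2 * (C1 2 (d / 2) * C2 (d / 2)))"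
    by (rule suminf_le_const) (use part in auto)
  then have "modular (\<lambda>x. SUP n. X n x) \<le> 1 + ennreal (2 powr b) * ennreal (2 + 2 * (C1 2 (d / 2) * C2 (d / 2)))"
    using modular_SUP_le[OF X] unfolding G_def by (meson add_left_mono mult_left_mono order_trans zero_le)
  moreover have "0 \<le> 2 + 2 * (C1 2 (d / 2) * C2 (d / 2))"
    using C1_nonneg[of 2 "d / 2"] C2_nonneg[of "d / 2"] by simp
  then have "ennreal (C_good d) = 1 + ennreal (2 powr b) * ennreal (2 + 2 * (C1 2 (d / 2) * C2 (d / 2)))"
    unfolding C_good_def by (subst ennreal_plus) (auto simp only: ennreal_mult ennreal_1 powr_ge_zero mult_nonneg_nonneg)
  ultimately show ?thesis by simp
qed

lemma passage_divide:
  assumes "0 < l" "0 \<le> t"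
  shows "passage (\<lambda>n x. X n x / ennreal l) t n = passage X (l * t) n"
  using ennreal_less_divide[OF assms] by (auto simp: passage_def not_less[symmetric])

lemma above_divide:
  assumes "0 < l" "0 \<le> t"
  shows "above (\<lambda>n x. X n x / ennreal l) t = above X (l * t)"
  using ennreal_less_divide[OF assms] by (auto simp: above_def)

lemma dominated_of_good_lambda:
  assumes X: "\<And>n. X n \<in> borel_measurable (F n)" and [measurable]: "Y \<in> borel_measurable M"
    and d: "0 < d" "d \<le> 1" and \<epsilon>: "0 \<le> \<epsilon>" "4 * 2 powr b * \<epsilon> \<le> 1"
    and gl: "\<And>t n E. 0 < t \<Longrightarrow> E \<in> sets (F n) \<Longrightarrow> E \<subseteq> passage X t n \<Longrightarrow>
      emeasure M (E \<inter> above X (2 * t) \<inter> {x\<in>space M. Y x \<le> ennreal (d * t)}) \<le> ennreal \<epsilon> * emeasure M E"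
  shows "dominated (C_good d) (\<lambda>x. SUP n. X n x) Y"
  unfolding dominated_def
proof (intro allI impI)
  fix l :: real assume l: "0 < l" and Y: "modular (\<lambda>x. Y x / ennreal l) \<le> 1"
  have "modular (\<lambda>x. SUP n. X n x / ennreal l) \<le> ennreal (C_good d)"
  proof (rule modular_SUP_le_of_good_lambda[OF _ _ Y d \<epsilon>])
    show "(\<lambda>x. X n x / ennreal l) \<in> borel_measurable (F n)" for n using X by measurable
    fix j n E assume E: "E \<in> sets (F n)" "E \<subseteq> passage (\<lambda>n x. X n x / ennreal l) (2 ^ j) n"
    have "emeasure M (E \<inter> above X (2 * (l * 2 ^ j)) \<inter> {x\<in>space M. Y x \<le> ennreal (d * (l * 2 ^ j))})
      \<le> ennreal \<epsilon> * emeasure M E"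
      using E l by (intro gl) (auto simp: passage_divide)
    then show "emeasure M (E \<inter> above (\<lambda>n x. X n x / ennreal l) (2 * 2 ^ j) \<inter> {x\<in>space M. Y x / ennreal l \<le> ennreal (d * 2 ^ j)})
      \<le> ennreal \<epsilon> * emeasure M E"
      using l d by (simp add: above_divide le_divide_iff_ennreal mult.left_commute)
  qed auto
  then show "modular (\<lambda>x. (SUP n. X n x) / ennreal l) \<le> ennreal (C_good d)"
    by (simp add: SUP_divide_ennreal)
qed

lemma dominated_of_local:
  assumes X: "\<And>n. X n \<in> borel_measurable (F n)" and [measurable]: "Y \<in> borel_measurable M"
    and d: "0 < d" "d \<le> 1" and R: "1 \<le> R"
    and loc: "\<And>t n i E. 0 < t \<Longrightarrow> E \<in> sets (F n) \<Longrightarrow> E \<subseteq> passage X t n \<inter> B n i \<Longrightarrow>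
      emeasure M E \<le> ennreal R * emeasure M (E \<inter> {x\<in>space M. ennreal (d * t) < Y x})"
  shows "dominated (C_reg R d) (\<lambda>x. SUP n. X n x) Y"
  unfolding dominated_def
proof (intro allI impI)
  fix l :: real assume l: "0 < l" and Y: "modular (\<lambda>x. Y x / ennreal l) \<le> 1"
  have "modular (\<lambda>x. SUP n. X n x / ennreal l) \<le> ennreal (C_reg R d)"
  proof (rule modular_SUP_le_of_local(1)[OF _ _ Y d R])
    show "(\<lambda>x. X n x / ennreal l) \<in> borel_measurable (F n)" for n using X by measurable
    fix j n i E assume E: "E \<in> sets (F n)" "E \<subseteq> passage (\<lambda>n x. X n x / ennreal l) (2 ^ j) n \<inter> B n i"
    have "emeasure M E \<le> ennreal R * emeasure M (E \<inter> {x\<in>space M. ennreal (d * (l * 2 ^ j)) < Y x})"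
      using E l by (intro loc) (auto simp: passage_divide)
    then show "emeasure M E \<le> ennreal R * emeasure M (E \<inter> {x\<in>space M. ennreal (d * 2 ^ j) < Y x / ennreal l})"
      using l d by (simp add: ennreal_less_divide mult.left_commute)
  qed auto
  then show "modular (\<lambda>x. (SUP n. X n x) / ennreal l) \<le> ennreal (C_reg R d)"
    by (simp add: SUP_divide_ennreal)
qed

end

section \<open>From domination of modulars to Luxemburg quasi-norms\<close>

context atomic_exponent
begin

lemma modular_mono_AE:
  assumes "AE x in M. g x \<le> h x"
  shows "modular g \<le> modular h"
  unfolding modular_def
proof (rule nn_integral_mono_AE)
  show "AE x in M. epowr (g x) (p x) \<le> epowr (h x) (p x)"
    using assms p_bounds by eventually_elim (use a_pos in \<open>auto intro!: epowr_mono\<close>)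
qed

lemma Lp_norm_le_of_dominated:
  assumes d: "dominated C X Y" and C: "1 \<le> C" and [measurable]: "X \<in> borel_measurable M"
  shows "Lp_norm M p X \<le> ennreal (C powr (1 / a)) * Lp_norm M p Y"
proof -
  define D where "D = C powr (1 / a)"
  have D: "1 \<le> D" using C a_pos by (auto simp: D_def intro!: ge_one_powr_ge_zero)
  have Da: "D powr (- a) = 1 / C"
    using C a_pos by (simp add: D_def powr_powr powr_minus_divide)
  have "Lp_norm M p X \<le> ennreal D * ennreal l"
    if l: "0 < l" "(\<integral>\<^sup>+x. epowr (Y x / ennreal l) (p x) \<partial>M) \<le> 1" for l
  proof -
    have "modular (\<lambda>x. X x / ennreal (l * D)) \<le> (\<integral>\<^sup>+x. ennreal (1 / C) * epowr (X x / ennreal l) (p x) \<partial>M)"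
      unfolding modular_def
    proof (rule nn_integral_mono_AE)
      show "AE x in M. epowr (X x / ennreal (l * D)) (p x) \<le> ennreal (1 / C) * epowr (X x / ennreal l) (p x)"
        using p_bounds
      proof eventually_elim
        case (elim x)
        have "epowr (X x / ennreal (l * D)) (p x) = ennreal ((1 / D) powr p x) * epowr (X x / ennreal l) (p x)"
          using D l by (subst divide_mult_ennreal) (auto intro!: epowr_mult)
        also have "(1 / D) powr p x \<le> D powr (- a)"
        proof -
          have "(1 / D) powr p x = D powr (- p x)" using D by (simp add: powr_divide powr_minus_divide)
          also have "\<dots> \<le> D powr (- a)" using elim D by (intro powr_mono) auto
          finally show ?thesis .
        qed
        then have "ennreal ((1 / D) powr p x) * epowr (X x / ennreal l) (p x) \<le> ennreal (1 / C) * epowr (X x / ennreal l) (p x)"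
          unfolding Da by (intro mult_right_mono ennreal_leI) auto
        finally show ?case .
      qed
    qed
    also have "\<dots> = ennreal (1 / C) * modular (\<lambda>x. X x / ennreal l)"
      unfolding modular_def by (rule nn_integral_cmult) measurable
    also have "\<dots> \<le> ennreal (1 / C) * ennreal C"
      using d l by (intro mult_left_mono) (auto simp: dominated_def modular_def)
    also have "\<dots> = 1" using C by (simp add: ennreal_mult[symmetric])
    finally have "l * D \<in> {l. 0 < l \<and> (\<integral>\<^sup>+x. epowr (X x / ennreal l) (p x) \<partial>M) \<le> 1}"
      using l D by (simp add: modular_def)
    then have "Lp_norm M p X \<le> ennreal (l * D)" unfolding Lp_norm_def by (rule INF_lower)
    then show ?thesis using l D by (simp add: ennreal_mult mult.commute)
  qed
  then have "Lp_norm M p X \<le> ennreal D * Lp_norm M p Y"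
    unfolding Lp_norm_def[of M p Y] by (intro le_mult_INF_ennreal) (use D in auto)
  then show ?thesis by (simp add: D_def)
qed

lemma Lp_norm_mono_AE:
  assumes "AE x in M. X x \<le> Y x"
  shows "Lp_norm M p X \<le> Lp_norm M p Y"
  unfolding Lp_norm_def
proof (rule INF_superset_mono)
  have "modular (\<lambda>x. X x / ennreal l) \<le> modular (\<lambda>x. Y x / ennreal l)" for l
    by (rule modular_mono_AE) (use assms in eventually_elim, simp add: divide_right_mono_ennreal)
  then show "{l. 0 < l \<and> (\<integral>\<^sup>+x. epowr (Y x / ennreal l) (p x) \<partial>M) \<le> 1}
    \<subseteq> {l. 0 < l \<and> (\<integral>\<^sup>+x. epowr (X x / ennreal l) (p x) \<partial>M) \<le> 1}"
    unfolding modular_def by (auto intro: order_trans)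
qed simp

lemma AE_finite_of_Lp_norm:
  assumes [measurable]: "Y \<in> borel_measurable M" and fin: "Lp_norm M p Y < \<infinity>"
  shows "AE x in M. Y x < \<infinity>"
proof -
  obtain l where l: "0 < l" "(\<integral>\<^sup>+x. epowr (Y x / ennreal l) (p x) \<partial>M) \<le> 1"
    using fin unfolding Lp_norm_def by (auto simp: INF_less_iff)
  have "(\<integral>\<^sup>+x. epowr (Y x / ennreal l) (p x) \<partial>M) < \<infinity>"
    using l(2) by (rule order.strict_trans1) simp
  then have "AE x in M. epowr (Y x / ennreal l) (p x) \<noteq> \<infinity>"
    by (intro nn_integral_PInf_AE) auto
  then show ?thesis
  proof eventually_elim
    case (elim x)
    then show ?case using l by (cases "Y x") (auto simp: epowr_def ennreal_top_divide)
  qed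
qed

lemma dominated_mono:
  assumes "dominated C X Y" and "AE x in M. X' x \<le> X x"
  shows "dominated C X' Y"
proof -
  have "modular (\<lambda>x. X' x / ennreal l) \<le> modular (\<lambda>x. X x / ennreal l)" for l
    by (rule modular_mono_AE) (use assms(2) in eventually_elim, simp add: divide_right_mono_ennreal)
  then show ?thesis using assms(1) unfolding dominated_def by (meson order_trans)
qed

lemma dominated_refl: "dominated 1 Y Y"
  by (auto simp: dominated_def)

lemma dominated_add:
  assumes X: "dominated C X Y" "dominated D Z Y" "0 \<le> C" "0 \<le> D"
    and [measurable]: "X \<in> borel_measurable M" "Z \<in> borel_measurable M"
  shows "dominated (2 powr b * (C + D)) (\<lambda>x. X x + Z x) Y"
  unfolding dominated_def
proof (intro allI impI)
  fix l :: real assume l: "0 < l" "modular (\<lambda>x. Y x / ennreal l) \<le> 1"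
  have "modular (\<lambda>x. (X x + Z x) / ennreal l)
    \<le> (\<integral>\<^sup>+x. ennreal (2 powr b) * (epowr (X x / ennreal l) (p x) + epowr (Z x / ennreal l) (p x)) \<partial>M)"
    unfolding modular_def
  proof (rule nn_integral_mono_AE)
    show "AE x in M. epowr ((X x + Z x) / ennreal l) (p x)
      \<le> ennreal (2 powr b) * (epowr (X x / ennreal l) (p x) + epowr (Z x / ennreal l) (p x))"
      using p_bounds by eventually_elim (use a_pos in \<open>auto simp: add_divide_distrib_ennreal intro!: epowr_add_le\<close>)
  qed
  also have "\<dots> = ennreal (2 powr b) * (modular (\<lambda>x. X x / ennreal l) + modular (\<lambda>x. Z x / ennreal l))"
    unfolding modular_def by (simp add: nn_integral_cmult nn_integral_add)
  also have "\<dots> \<le> ennreal (2 powr b) * (ennreal C + ennreal D)"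
    using X l by (intro mult_left_mono add_mono) (auto simp: dominated_def)
  also have "\<dots> = ennreal (2 powr b * (C + D))"
    using X by (simp add: ennreal_mult ennreal_plus)
  finally show "modular (\<lambda>x. (X x + Z x) / ennreal l) \<le> ennreal (2 powr b * (C + D))" .
qed

lemma dominated_cmult:
  assumes X: "dominated C X Y" and c: "1 \<le> c" and [measurable]: "X \<in> borel_measurable M"
  shows "dominated (c powr b * C) (\<lambda>x. ennreal c * X x) Y"
  unfolding dominated_def
proof (intro allI impI)
  fix l :: real assume l: "0 < l" "modular (\<lambda>x. Y x / ennreal l) \<le> 1"
  have "modular (\<lambda>x. ennreal c * X x / ennreal l) \<le> (\<integral>\<^sup>+x. ennreal (c powr b) * epowr (X x / ennreal l) (p x) \<partial>M)"
    unfolding modular_def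
  proof (rule nn_integral_mono_AE)
    show "AE x in M. epowr (ennreal c * X x / ennreal l) (p x) \<le> ennreal (c powr b) * epowr (X x / ennreal l) (p x)"
      using p_bounds
    proof eventually_elim
      case (elim x)
      have "epowr (ennreal c * X x / ennreal l) (p x) = ennreal (c powr p x) * epowr (X x / ennreal l) (p x)"
        using c by (subst ennreal_times_divide[symmetric]) (simp add: epowr_mult)
      also have "\<dots> \<le> ennreal (c powr b) * epowr (X x / ennreal l) (p x)"
        using c elim by (intro mult_right_mono ennreal_leI powr_mono) auto
      finally show ?case .
    qed
  qed
  also have "\<dots> = ennreal (c powr b) * modular (\<lambda>x. X x / ennreal l)"
    unfolding modular_def by (rule nn_integral_cmult) measurable
  also have "\<dots> \<le> ennreal (c powr b) * ennreal C"
    using X l by (intro mult_left_mono) (auto simp: dominated_def)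
  finally show "modular (\<lambda>x. ennreal c * X x / ennreal l) \<le> ennreal (c powr b * C)"
    by (simp add: ennreal_mult')
qed

lemma C_good_ge_1: "1 \<le> C_good d"
  using C1_nonneg[of 2 "d / 2"] C2_nonneg[of "d / 2"] by (simp add: C_good_def)

lemma C_reg_ge_1: "0 \<le> R \<Longrightarrow> 1 \<le> C_reg R d"
  using C1_nonneg[of R d] C2_nonneg[of d] by (simp add: C_reg_def)

end

section \<open>Predictable majorants and stopped martingales\<close>

context filtered_prob
begin

lemma LambdaD:
  assumes "l \<in> Lambda M F"
  shows "l n \<in> borel_measurable (F n)" and "x \<in> space M \<Longrightarrow> 0 \<le> l n x"
    and "x \<in> space M \<Longrightarrow> m \<le> n \<Longrightarrow> l m x \<le> l n x"
proof -
  show "l n \<in> borel_measurable (F n)" "x \<in> space M \<Longrightarrow> 0 \<le> l n x" using assms by (auto simp: Lambda_def)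
  show "l m x \<le> l n x" if "x \<in> space M" "m \<le> n"
    using that(2) by (rule lift_Suc_mono_le[of "\<lambda>n. l n x", rotated]) (use assms that in \<open>auto simp: Lambda_def\<close>)
qed

lemma lambda_inf_eq:
  assumes l: "l \<in> Lambda M F" and x: "x \<in> space M"
  shows "lambda_inf l x = (SUP n. ennreal (l n x))"
  unfolding lambda_inf_def
  by (rule limI, rule LIMSEQ_SUP) (auto intro!: incseq_SucI ennreal_leI LambdaD(3)[OF l x])

lemma lambda_inf_le_D:
  assumes l: "l \<in> Lambda M F" and x: "x \<in> space M" and le: "lambda_inf l x \<le> ennreal c" and c: "0 \<le> c"
  shows "l n x \<le> c"
proof -
  have "ennreal (l n x) \<le> ennreal c"
    using le unfolding lambda_inf_eq[OF l x] by (simp add: SUP_le_iff)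
  then show ?thesis using c by simp
qed

lemma lambda_inf_measurable:
  assumes l: "l \<in> Lambda M F"
  shows "lambda_inf l \<in> borel_measurable M"
proof -
  have [measurable]: "l n \<in> borel_measurable M" for n using LambdaD(1)[OF l] measurable_F_M by auto
  have "(\<lambda>x. SUP n. ennreal (l n x)) \<in> borel_measurable M" by measurable
  then show ?thesis by (subst measurable_cong[OF lambda_inf_eq[OF l]])
qed

text \<open>Running maxima make an adapted sequence non-decreasing at every point, as membership in \<open>\<Lambda>\<close>
  requires.\<close>

lemma lambda_Max:
  fixes \<theta> :: "nat \<Rightarrow> 'a \<Rightarrow> real"
  assumes m: "\<And>k. \<theta> k \<in> borel_measurable (F k)" and nn: "\<And>k x. 0 \<le> \<theta> k x"
    and r_def: "r = (\<lambda>n x. Max ((\<lambda>k. \<theta> k x) ` {..n}))"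
  shows "r \<in> Lambda M F" and "\<theta> n x \<le> r n x" and "t < r n x \<Longrightarrow> \<exists>k\<le>n. t < \<theta> k x"
    and "(\<And>k. ennreal (\<theta> k x) \<le> z) \<Longrightarrow> x \<in> space M \<Longrightarrow> lambda_inf r x \<le> z"
proof -
  show ge: "\<theta> n x \<le> r n x" for n x unfolding r_def by (rule Max_ge) auto
  have att: "\<exists>k\<le>n. r n x = \<theta> k x" for n x
  proof -
    have "r n x \<in> (\<lambda>k. \<theta> k x) ` {..n}" unfolding r_def by (rule Max_in) auto
    then show ?thesis by auto
  qed
  show "t < r n x \<Longrightarrow> \<exists>k\<le>n. t < \<theta> k x" using att[of n x] by auto
  show r: "r \<in> Lambda M F"
    unfolding Lambda_def
  proof (intro CollectI conjI allI ballI)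
    show "r n \<in> borel_measurable (F n)" for n
      unfolding r_def by (rule borel_measurable_Max) (auto intro: measurable_F_mono[OF m])
    show "0 \<le> r n x" for n x using att[of n x] nn by auto
    show "r n x \<le> r (Suc n) x" for n x
      unfolding r_def by (rule Max_mono) auto
  qed
  show "lambda_inf r x \<le> z" if "\<And>k. ennreal (\<theta> k x) \<le> z" "x \<in> space M"
    unfolding lambda_inf_eq[OF r that(2)]
  proof (rule SUP_least)
    fix n
    obtain k where "r n x = \<theta> k x" using att[of n x] by auto
    then show "ennreal (r n x) \<le> z" using that by simp
  qed
qed

text \<open>The predictable event that the difference \<open>k\<close> is kept when a martingale is started at time \<open>m\<close> on \<open>E\<close>
  and stopped before \<open>l\<close> exceeds \<open>c\<close>.\<close>

definition stop_set :: "(nat \<Rightarrow> 'a \<Rightarrow> real) \<Rightarrow> 'a set \<Rightarrow> nat \<Rightarrow> real \<Rightarrow> nat \<Rightarrow> 'a set" where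
  "stop_set l E m c k = (if m < k then E \<inter> {x\<in>space M. l (k - 1) x \<le> c} else {})"

text \<open>The differences of the martingale so started and stopped.\<close>

definition stopped :: "(nat \<Rightarrow> 'a \<Rightarrow> real) \<Rightarrow> (nat \<Rightarrow> 'a \<Rightarrow> real) \<Rightarrow> 'a set \<Rightarrow> nat \<Rightarrow> real \<Rightarrow> nat \<Rightarrow> 'a \<Rightarrow> real" where
  "stopped f l E m c k x = indicator (stop_set l E m c k) x * mdiff f k x"

text \<open>What majorants of both kinds have in common: the differences are bounded by twice the predictable
  majorant, and the started and stopped martingale has energy at most \<open>4 c\<^sup>2 P(E)\<close>. For \<open>n = 0\<close> the bound
  reads \<open>\<bar>f 0\<bar> \<le> 2 * l 0\<close>.\<close>

definition controls :: "(nat \<Rightarrow> 'a \<Rightarrow> real) \<Rightarrow> (nat \<Rightarrow> 'a \<Rightarrow> real) \<Rightarrow> bool" where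
  "controls f l \<longleftrightarrow> martingale M F f \<and> l \<in> Lambda M F \<and>
     (AE x in M. \<forall>n. \<bar>mdiff f n x\<bar> \<le> 2 * l (n - 1) x) \<and>
     (\<forall>m c E N. 0 < c \<longrightarrow> E \<in> sets (F m) \<longrightarrow>
        (\<Sum>k\<le>N. \<integral>\<^sup>+x. ennreal ((stopped f l E m c k x)\<^sup>2) \<partial>M) \<le> ennreal (4 * c\<^sup>2) * emeasure M E)"

lemma stop_set_sets:
  assumes l: "l \<in> Lambda M F" and E: "E \<in> sets (F m)"
  shows "stop_set l E m c k \<in> sets (F (k - 1))"
proof (cases "m < k")
  case True
  then have [measurable]: "E \<in> sets (F (k - 1))" using sets_F_mono[OF E, of "k - 1"] by simp
  have [measurable]: "l (k - 1) \<in> borel_measurable (F (k - 1))" by (rule LambdaD(1)[OF l])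
  have "E \<inter> {x\<in>space (F (k - 1)). l (k - 1) x \<le> c} \<in> sets (F (k - 1))" by measurable
  then show ?thesis using True by (simp add: stop_set_def)
qed (simp add: stop_set_def)

lemma mds_stopped:
  assumes f: "martingale M F f" and l: "l \<in> Lambda M F"
    and bd: "AE x in M. \<forall>n. \<bar>mdiff f n x\<bar> \<le> 2 * l (n - 1) x"
    and E: "E \<in> sets (F m)" and c: "0 < c"
  shows "mds (stopped f l E m c)"
proof -
  have "mds (\<lambda>k x. indicator (stop_set l E m c k) x * mdiff f k x)"
  proof (rule mds_restrict_mdiff[OF f stop_set_sets[OF l E]])
    fix k
    have "(\<integral>\<^sup>+x. ennreal ((mdiff f k x)\<^sup>2) * indicator (stop_set l E m c k) x \<partial>M) \<le> (\<integral>\<^sup>+x. ennreal ((2 * c)\<^sup>2) \<partial>M)"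
    proof (rule nn_integral_mono_AE)
      show "AE x in M. ennreal ((mdiff f k x)\<^sup>2) * indicator (stop_set l E m c k) x \<le> ennreal ((2 * c)\<^sup>2)"
        using bd
      proof eventually_elim
        case (elim x)
        show ?case
        proof (cases "x \<in> stop_set l E m c k")
          case True
          then have "\<bar>mdiff f k x\<bar> \<le> 2 * c"
            using elim[rule_format, of k] by (auto simp: stop_set_def split: if_splits)
          then have "(mdiff f k x)\<^sup>2 \<le> (2 * c)\<^sup>2" using c by (intro abs_le_square_iff[THEN iffD1]) auto
          then show ?thesis using True by (simp add: ennreal_leI)
        qed simp
      qed
    qed
    also have "\<dots> < \<infinity>" by (simp add: emeasure_space_1)
    finally show "(\<integral>\<^sup>+x. ennreal ((mdiff f k x)\<^sup>2) * indicator (stop_set l E m c k) x \<partial>M) < \<infinity>" .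
  qed
  then show ?thesis by (simp add: stopped_def[abs_def])
qed

lemma martingale_uminus:
  assumes "martingale M F f"
  shows "martingale M F (\<lambda>n x. - f n x)"
  unfolding martingale_def
proof (intro conjI allI impI)
  fix n show "(\<lambda>x. - f n x) \<in> borel_measurable (F n)" "integrable M (\<lambda>x. - f n x)"
    using martingaleD[OF assms] by auto
next
  fix m n :: nat assume "n \<le> m"
  interpret sigma_finite_subalgebra M "F n" by (rule sfs)
  have "AE x in M. real_cond_exp M (F n) (\<lambda>x. (- 1) * f m x) x = (- 1) * real_cond_exp M (F n) (f m) x"
    by (rule real_cond_exp_cmult) (rule martingaleD[OF assms])
  then show "AE x in M. real_cond_exp M (F n) (\<lambda>x. - f m x) x = - f n x"
    using martingaleD(4)[OF assms \<open>n \<le> m\<close>] by eventually_elim simp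
qed

text \<open>Majorants bound \<open>f\<^sub>n\<close> for \<open>n \<ge> 1\<close> only; the bound is inherited by \<open>f\<^sub>0\<close>. As \<open>l\<close> need not be integrable, the
  proof integrates \<open>f\<^sub>0 - f\<^sub>1\<close> over the event that \<open>f\<^sub>0\<close> exceeds \<open>l\<close> instead of conditioning \<open>l\<close>.\<close>

lemma martingale_start_le:
  assumes f: "martingale M F f" and l [measurable]: "l \<in> borel_measurable (F 0)"
    and le: "AE x in M. f 1 x \<le> l x"
  shows "AE x in M. f 0 x \<le> l x"
proof -
  interpret sigma_finite_subalgebra M "F 0" by (rule sfs)
  define H where "H = {x\<in>space M. l x < f 0 x}"
  have [measurable]: "f 0 \<in> borel_measurable (F 0)" by (rule martingaleD[OF f])
  have "{x\<in>space (F 0). l x < f 0 x} \<in> sets (F 0)" by measurable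
  then have HF: "H \<in> sets (F 0)" by (simp add: H_def)
  then have HM [measurable]: "H \<in> sets M" by (rule sets_F_M)
  have [measurable]: "f 0 \<in> borel_measurable M" "f 1 \<in> borel_measurable M" by (rule martingaleD[OF f])+
  have int: "integrable M (\<lambda>x. indicator H x * f n x)" for n
    using integrable_mult_indicator[OF HM martingaleD(2)[OF f, of n]] by simp
  have "(\<integral>x. indicator H x * f 1 x \<partial>M) = (\<integral>x. indicator H x * real_cond_exp M (F 0) (f 1) x \<partial>M)"
    using real_cond_exp_intA[OF martingaleD(2)[OF f, of 1] HF] by (simp add: set_lebesgue_integral_def)
  also have "\<dots> = (\<integral>x. indicator H x * f 0 x \<partial>M)"
  proof (rule integral_cong_AE)
    show "AE x in M. indicator H x * real_cond_exp M (F 0) (f 1) x = indicator H x * f 0 x"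
      using martingaleD(4)[OF f zero_le, of 1] by eventually_elim simp
  qed measurable
  finally have "(\<integral>x. indicator H x * f 0 x - indicator H x * f 1 x \<partial>M) = 0"
    using int by simp
  moreover have nn: "AE x in M. 0 \<le> indicator H x * f 0 x - indicator H x * f 1 x"
    using le by eventually_elim (auto simp: H_def indicator_def)
  ultimately have "AE x in M. indicator H x * f 0 x - indicator H x * f 1 x = 0"
    using integral_nonneg_eq_0_iff_AE[OF _ nn] int by simp
  then show ?thesis
    using le AE_space by eventually_elim (auto simp: H_def indicator_def split: if_splits)
qed

lemma sum_stopped_eq:
  assumes l: "l \<in> Lambda M F" and x: "x \<in> space M" "x \<in> E" and N: "m \<le> N" "l N x \<le> c" and k: "k \<le> Suc N"
  shows "stopped f l E m c k x = (if m < k then mdiff f k x else 0)"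
proof -
  have "l (k - 1) x \<le> l N x" using k by (intro LambdaD(3)[OF l]) (use x in auto)
  then show ?thesis using N x by (auto simp: stopped_def stop_set_def)
qed

lemma P_majorant_bound:
  assumes f: "martingale M F f" and l: "l \<in> P_majorants M F p f"
  shows "AE x in M. \<forall>n. \<bar>f (Suc n) x\<bar> \<le> l n x \<and> \<bar>f n x\<bar> \<le> l n x"
proof -
  have lL: "l \<in> Lambda M F" using l by (simp add: P_majorants_def)
  have "AE x in M. \<forall>n. \<bar>f (Suc n) x\<bar> \<le> l n x"
    unfolding AE_all_countable
  proof
    fix n
    have "\<forall>n\<ge>1. AE x in M. \<bar>f n x\<bar> \<le> l (n - 1) x" using l by (simp add: P_majorants_def)
    from this[rule_format, of "Suc n"] show "AE x in M. \<bar>f (Suc n) x\<bar> \<le> l n x" by simp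
  qed
  moreover have "AE x in M. f 0 x \<le> l 0 x"
    by (rule martingale_start_le[OF f LambdaD(1)[OF lL]]) (use calculation in \<open>eventually_elim, metis One_nat_def abs_le_D1\<close>)
  moreover have "AE x in M. - f 0 x \<le> l 0 x"
    by (rule martingale_start_le[OF martingale_uminus[OF f] LambdaD(1)[OF lL]])
       (use calculation in \<open>eventually_elim, metis One_nat_def abs_le_D2\<close>)
  ultimately show ?thesis
    using AE_space
  proof eventually_elim
    case (elim x)
    show ?case
    proof
      fix n
      show "\<bar>f (Suc n) x\<bar> \<le> l n x \<and> \<bar>f n x\<bar> \<le> l n x"
      proof (cases n)
        case (Suc k)
        then have "\<bar>f n x\<bar> \<le> l k x" using elim by simp
        also have "\<dots> \<le> l n x" using Suc by (intro LambdaD(3)[OF lL]) (use elim in auto)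
        finally show ?thesis using elim by simp
      qed (use elim in auto)
    qed
  qed
qed

lemma controls_of_P_majorant:
  assumes f: "martingale M F f" and l: "l \<in> P_majorants M F p f"
  shows "controls f l"
proof -
  have lL: "l \<in> Lambda M F" using l by (simp add: P_majorants_def)
  note bd = P_majorant_bound[OF f l]
  have dbd: "AE x in M. \<forall>n. \<bar>mdiff f n x\<bar> \<le> 2 * l (n - 1) x"
    using bd AE_space
  proof eventually_elim
    case (elim x)
    show ?case
    proof
      fix n
      show "\<bar>mdiff f n x\<bar> \<le> 2 * l (n - 1) x"
      proof (cases n)
        case 0
        then show ?thesis using elim(1)[rule_format, of 0] LambdaD(2)[OF lL elim(2), of 0] by (simp add: mdiff_def)
      next
        case (Suc k)
        then show ?thesis using elim(1)[rule_format, of k] by (auto simp: mdiff_def abs_le_iff)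
      qed
    qed
  qed
  show ?thesis unfolding controls_def
  proof (intro conjI allI impI f lL dbd)
    fix m N :: nat and c :: real and E assume c: "0 < c" and E: "E \<in> sets (F m)"
    have [measurable]: "E \<in> sets M" using E sets_F_M by auto
    note mds = mds_stopped[OF f lL dbd E c]
    have "(\<Sum>k\<le>N. \<integral>\<^sup>+x. ennreal ((stopped f l E m c k x)\<^sup>2) \<partial>M)
      = (\<Sum>k\<le>N. ennreal (\<integral>x. (stopped f l E m c k x)\<^sup>2 \<partial>M))"
      using mds by (intro sum.cong nn_integral_eq_integral) (auto simp: mds_def)
    also have "\<dots> = ennreal (\<integral>x. (\<Sum>k\<le>N. stopped f l E m c k x)\<^sup>2 \<partial>M)"
      by (simp add: mds_partial_sum(3)[OF mds])
    also have "\<dots> = (\<integral>\<^sup>+x. ennreal ((\<Sum>k\<le>N. stopped f l E m c k x)\<^sup>2) \<partial>M)"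
      by (rule nn_integral_eq_integral[symmetric]) (auto simp: mds_partial_sum(2)[OF mds])
    also have "\<dots> \<le> (\<integral>\<^sup>+x. ennreal (4 * c\<^sup>2) * indicator E x \<partial>M)"
    proof (rule nn_integral_mono_AE)
      show "AE x in M. ennreal ((\<Sum>k\<le>N. stopped f l E m c k x)\<^sup>2) \<le> ennreal (4 * c\<^sup>2) * indicator E x"
        using bd AE_space
      proof eventually_elim
        case (elim x)
        show ?case
        proof (cases "x \<in> E")
          case True
          have "\<bar>\<Sum>k\<le>N. stopped f l E m c k x\<bar> \<le> 2 * c"
          proof (induction N)
            case 0
            then show ?case using c by (simp add: stopped_def stop_set_def)
          next
            case (Suc N)
            show ?case
            proof (cases "m \<le> N \<and> l N x \<le> c")
              case run: True
              have "(\<Sum>k\<le>Suc N. stopped f l E m c k x) = (\<Sum>k\<le>Suc N. if m < k then mdiff f k x else 0)"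
                using run True elim by (intro sum.cong sum_stopped_eq[OF lL]) auto
              also have "\<dots> = f (Suc N) x - f m x"
                using run by (subst sum_after) (auto simp: sum_mdiff simp del: sum.atMost_Suc)
              finally have eq: "(\<Sum>k\<le>Suc N. stopped f l E m c k x) = f (Suc N) x - f m x" .
              have "\<bar>f m x\<bar> \<le> l m x" "\<bar>f (Suc N) x\<bar> \<le> l N x" "l m x \<le> l N x"
                using elim run LambdaD(3)[OF lL, of x m N] by auto
              then show ?thesis unfolding eq using run by linarith
            next
              case False
              then have "stopped f l E m c (Suc N) x = 0" by (auto simp: stopped_def stop_set_def)
              then show ?thesis using Suc by simp
            qed
          qed
          then have "(\<Sum>k\<le>N. stopped f l E m c k x)\<^sup>2 \<le> (2 * c)\<^sup>2"
            using c by (intro abs_le_square_iff[THEN iffD1]) auto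
          then show ?thesis using True by (simp add: ennreal_leI)
        next
          case False
          then have "stopped f l E m c k x = 0" for k by (simp add: stopped_def stop_set_def)
          then show ?thesis by simp
        qed
      qed
    qed
    also have "\<dots> = ennreal (4 * c\<^sup>2) * emeasure M E" by (simp add: nn_integral_cmult_indicator)
    finally show "(\<Sum>k\<le>N. \<integral>\<^sup>+x. ennreal ((stopped f l E m c k x)\<^sup>2) \<partial>M) \<le> ennreal (4 * c\<^sup>2) * emeasure M E" .
  qed
qed

lemma square_fn_upto_eq: "square_fn_upto f n x = run_sq n (\<lambda>k. mdiff f k x)"
  by (simp add: square_fn_upto_def run_sq_def)

lemma Q_majorant_bound:
  assumes l: "l \<in> Q_majorants M F p f"
  shows "AE x in M. \<forall>n. run_sq (Suc n) (\<lambda>k. mdiff f k x) \<le> l n x"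
  unfolding AE_all_countable
proof
  fix n
  have "\<forall>n\<ge>1. AE x in M. square_fn_upto f n x \<le> l (n - 1) x" using l by (simp add: Q_majorants_def)
  from this[rule_format, of "Suc n"] show "AE x in M. run_sq (Suc n) (\<lambda>k. mdiff f k x) \<le> l n x"
    by (simp add: square_fn_upto_eq)
qed

lemma controls_of_Q_majorant:
  assumes f: "martingale M F f" and l: "l \<in> Q_majorants M F p f"
  shows "controls f l"
proof -
  have lL: "l \<in> Lambda M F" using l by (simp add: Q_majorants_def)
  note bd = Q_majorant_bound[OF l]
  have mem: "\<bar>u k\<bar> \<le> run_sq n u" if "k \<le> n" for u k n
  proof -
    have "(u k)\<^sup>2 \<le> (\<Sum>k\<le>n. (u k)\<^sup>2)" using that by (intro member_le_sum) auto
    then have "sqrt ((u k)\<^sup>2) \<le> run_sq n u" unfolding run_sq_def by (rule real_sqrt_le_mono)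
    then show ?thesis by simp
  qed
  have dbd: "AE x in M. \<forall>n. \<bar>mdiff f n x\<bar> \<le> 2 * l (n - 1) x"
    using bd AE_space
  proof eventually_elim
    case (elim x)
    show ?case
    proof
      fix n
      have "\<bar>mdiff f n x\<bar> \<le> run_sq (Suc (n - 1)) (\<lambda>k. mdiff f k x)" by (rule mem) auto
      also have "\<dots> \<le> l (n - 1) x" using elim by blast
      also have "\<dots> \<le> 2 * l (n - 1) x" using LambdaD(2)[OF lL elim(2), of "n - 1"] by simp
      finally show "\<bar>mdiff f n x\<bar> \<le> 2 * l (n - 1) x" .
    qed
  qed
  show ?thesis unfolding controls_def
  proof (intro conjI allI impI f lL dbd)
    fix m N :: nat and c :: real and E assume c: "0 < c" and E: "E \<in> sets (F m)"
    have [measurable]: "E \<in> sets M" using E sets_F_M by auto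
    have mds: "mds (stopped f l E m c)" by (rule mds_stopped[OF f lL dbd E c])
    have [measurable]: "stopped f l E m c k \<in> borel_measurable M" for k
      using mds measurable_F_M by (auto simp: mds_def)
    have "(\<Sum>k\<le>N. \<integral>\<^sup>+x. ennreal ((stopped f l E m c k x)\<^sup>2) \<partial>M)
      = (\<integral>\<^sup>+x. ennreal (\<Sum>k\<le>N. (stopped f l E m c k x)\<^sup>2) \<partial>M)"
      by (subst nn_integral_sum[symmetric]) auto
    also have "\<dots> \<le> (\<integral>\<^sup>+x. ennreal (4 * c\<^sup>2) * indicator E x \<partial>M)"
    proof (rule nn_integral_mono_AE)
      show "AE x in M. ennreal (\<Sum>k\<le>N. (stopped f l E m c k x)\<^sup>2) \<le> ennreal (4 * c\<^sup>2) * indicator E x"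
        using bd AE_space
      proof eventually_elim
        case (elim x)
        show ?case
        proof (cases "x \<in> E")
          case True
          have "(\<Sum>k\<le>N. (stopped f l E m c k x)\<^sup>2) \<le> c\<^sup>2"
          proof (induction N)
            case 0
            then show ?case using c by (simp add: stopped_def stop_set_def)
          next
            case (Suc N)
            show ?case
            proof (cases "m \<le> N \<and> l N x \<le> c")
              case run: True
              have "(\<Sum>k\<le>Suc N. (stopped f l E m c k x)\<^sup>2) \<le> (\<Sum>k\<le>Suc N. (mdiff f k x)\<^sup>2)"
                by (rule sum_mono) (auto simp: stopped_def indicator_def)
              also have "\<dots> = (run_sq (Suc N) (\<lambda>k. mdiff f k x))\<^sup>2"
                unfolding run_sq_def by (rule real_sqrt_pow2[symmetric]) (auto intro: sum_nonneg simp del: sum.atMost_Suc)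
              also have "\<dots> \<le> c\<^sup>2"
              proof (rule power_mono)
                show "run_sq (Suc N) (\<lambda>k. mdiff f k x) \<le> c" using elim(1)[rule_format, of N] run by linarith
                show "0 \<le> run_sq (Suc N) (\<lambda>k. mdiff f k x)"
                  unfolding run_sq_def by (auto intro!: sum_nonneg simp del: sum.atMost_Suc)
              qed
              finally show ?thesis .
            next
              case False
              then have "stopped f l E m c (Suc N) x = 0" by (auto simp: stopped_def stop_set_def)
              then show ?thesis using Suc by simp
            qed
          qed
          also have "\<dots> \<le> 4 * c\<^sup>2" by simp
          finally show ?thesis using True by (simp add: ennreal_leI)
        next
          case False
          then have "stopped f l E m c k x = 0" for k by (simp add: stopped_def stop_set_def)
          then show ?thesis by simp
        qed
      qed
    qed
    also have "\<dots> = ennreal (4 * c\<^sup>2) * emeasure M E" by (simp add: nn_integral_cmult_indicator)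
    finally show "(\<Sum>k\<le>N. \<integral>\<^sup>+x. ennreal ((stopped f l E m c k x)\<^sup>2) \<partial>M) \<le> ennreal (4 * c\<^sup>2) * emeasure M E" .
  qed
qed

text \<open>The summands \<open>\<bbbE>\<^sub>k\<^sub>-\<^sub>1 \<bar>d\<^sub>k f\<bar>\<^sup>2\<close> of the conditional square function.\<close>

definition csq :: "(nat \<Rightarrow> 'a \<Rightarrow> real) \<Rightarrow> nat \<Rightarrow> 'a \<Rightarrow> ennreal" where
  "csq f k x = nn_cond_exp M (F (k - 1)) (\<lambda>y. ennreal (\<bar>mdiff f k y\<bar>\<^sup>2)) x"

lemma csq_measurable: "csq f k \<in> borel_measurable (F (k - 1))" "csq f k \<in> borel_measurable M"
  unfolding csq_def[abs_def] by measurable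

lemma csq_indicator:
  assumes f: "martingale M F f" and H: "H \<in> sets (F (k - 1))"
  shows "(\<integral>\<^sup>+x. csq f k x * indicator H x \<partial>M) = (\<integral>\<^sup>+x. ennreal ((indicator H x * mdiff f k x)\<^sup>2) \<partial>M)"
proof -
  have [measurable]: "mdiff f k \<in> borel_measurable M" by (rule mdiff_measurable[OF f])
  have "(\<integral>\<^sup>+x. csq f k x * indicator H x \<partial>M) = (\<integral>\<^sup>+x. ennreal (\<bar>mdiff f k x\<bar>\<^sup>2) * indicator H x \<partial>M)"
    unfolding csq_def by (rule nn_cond_exp_indicator[OF H]) measurable
  also have "\<dots> = (\<integral>\<^sup>+x. ennreal ((indicator H x * mdiff f k x)\<^sup>2) \<partial>M)"
    by (rule nn_integral_cong) (simp add: indicator_def)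
  finally show ?thesis .
qed

lemma csq_0:
  assumes f: "martingale M F f"
  shows "AE x in M. csq f 0 x = ennreal ((mdiff f 0 x)\<^sup>2)"
proof -
  interpret sigma_finite_subalgebra M "F 0" by (rule sfs)
  have [measurable]: "mdiff f 0 \<in> borel_measurable (F 0)" by (rule mdiff_measurable[OF f])
  have "AE x in M. ennreal (\<bar>mdiff f 0 x\<bar>\<^sup>2) = nn_cond_exp M (F 0) (\<lambda>x. ennreal (\<bar>mdiff f 0 x\<bar>\<^sup>2)) x"
    by (rule nn_cond_exp_F_meas) measurable
  then show ?thesis by eventually_elim (simp add: csq_def)
qed

text \<open>The conditional square function up to time \<open>n\<close>. It is measurable at time \<open>n - 1\<close>, and for this
  reason its shift by one is used as an adapted process.\<close>

definition s_upto :: "(nat \<Rightarrow> 'a \<Rightarrow> real) \<Rightarrow> nat \<Rightarrow> 'a \<Rightarrow> ennreal" where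
  "s_upto f n x = epowr (\<Sum>k\<le>n. csq f k x) (1/2)"

lemma s_upto_measurable: "s_upto f (Suc n) \<in> borel_measurable (F n)"
proof -
  have "csq f k \<in> borel_measurable (F n)" if "k \<le> Suc n" for k
    using measurable_F_mono[OF csq_measurable(1)[of f k], of n] that by auto
  then have [measurable]: "(\<lambda>x. \<Sum>k\<le>Suc n. csq f k x) \<in> borel_measurable (F n)"
    by (intro borel_measurable_sum) auto
  show ?thesis unfolding s_upto_def[abs_def] by measurable
qed

lemma s_upto_mono: "m \<le> n \<Longrightarrow> s_upto f m x \<le> s_upto f n x"
  unfolding s_upto_def by (intro epowr_mono sum_mono2) auto

lemma s_upto_Suc_SUP: "(SUP n. s_upto f (Suc n) x) = cond_square_fn M F f x"
proof (rule antisym)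
  show "(SUP n. s_upto f (Suc n) x) \<le> cond_square_fn M F f x"
    unfolding cond_square_fn_def csq_def[symmetric] s_upto_def
    by (intro SUP_least epowr_mono sum_le_suminf) auto
  show "cond_square_fn M F f x \<le> (SUP n. s_upto f (Suc n) x)"
  proof (rule ccontr)
    assume *: "\<not> cond_square_fn M F f x \<le> (SUP n. s_upto f (Suc n) x)"
    then obtain y where y: "(SUP n. s_upto f (Suc n) x) = ennreal y" "0 \<le> y"
      by (cases "SUP n. s_upto f (Suc n) x") auto
    then have "ennreal y < epowr (\<Sum>k. csq f k x) (1/2)"
      using * by (simp add: cond_square_fn_def csq_def not_le)
    then have "ennreal (y\<^sup>2) < (\<Sum>k. csq f k x)" using less_epowr_half y by auto
    then have "ennreal (y\<^sup>2) < (SUP n. \<Sum>k<n. csq f k x)" by (simp add: suminf_eq_SUP)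
    then obtain n where "ennreal (y\<^sup>2) < (\<Sum>k<n. csq f k x)" by (auto simp: less_SUP_iff)
    also have "\<dots> \<le> (\<Sum>k\<le>Suc n. csq f k x)" by (rule sum_mono2) auto
    finally have "ennreal y < s_upto f (Suc n) x" unfolding s_upto_def using less_epowr_half y by auto
    also have "\<dots> \<le> (SUP n. s_upto f (Suc n) x)" by (rule SUP_upper) simp
    finally show False using y by simp
  qed
qed

lemma cond_square_fn_measurable: "cond_square_fn M F f \<in> borel_measurable M"
proof -
  have [measurable]: "s_upto f (Suc n) \<in> borel_measurable M" for n
    using s_upto_measurable measurable_F_M by auto
  have "(\<lambda>x. SUP n. s_upto f (Suc n) x) \<in> borel_measurable M" by measurable
  then show ?thesis by (simp add: s_upto_Suc_SUP)
qed

end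

section \<open>Estimates by a predictable majorant\<close>

locale path_exponent = atomic_exponent M F p a b K B lo hi + path_functional M F q
  for M :: "'a measure" and F p a b K B lo hi q

context atomic_exponent
begin

text \<open>The parameter \<open>d\<close> of the good-\<open>\<lambda>\<close> inequality, small enough for \<open>\<epsilon> = 64 \<delta>\<^sup>2\<close>.\<close>

definition \<delta> :: real where "\<delta> = 2 powr (- b / 2) / 16"

lemma \<delta>: "0 < \<delta>" "\<delta> \<le> 1 / 16" "4 * 2 powr b * (64 * \<delta>\<^sup>2) \<le> 1"
proof -
  show "0 < \<delta>" by (simp add: \<delta>_def)
  have "2 powr (- b / 2) \<le> (2::real) powr 0" using b_pos by (intro powr_mono) auto
  then show "\<delta> \<le> 1 / 16" by (simp add: \<delta>_def)
  have "(2 powr (- b / 2))\<^sup>2 = (2::real) powr (- b)"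
    by (simp add: power2_eq_square powr_add[symmetric])
  then have "\<delta>\<^sup>2 = 2 powr (- b) / 256" by (simp add: \<delta>_def power_divide)
  then show "4 * 2 powr b * (64 * \<delta>\<^sup>2) \<le> 1" by (simp add: powr_minus_divide)
qed

text \<open>On the good event nothing is stopped, so the growth of the conditional square function after the
  passage time is that of the stopped martingale, whose expectation is its energy.\<close>

lemma s_upto_dominated_of_controls:
  assumes ctrl: "controls f l"
  shows "dominated (C_good \<delta>) (cond_square_fn M F f) (lambda_inf l)"
proof -
  have f: "martingale M F f" and l: "l \<in> Lambda M F"
    and bd: "AE x in M. \<forall>n. \<bar>mdiff f n x\<bar> \<le> 2 * l (n - 1) x"
    using ctrl by (auto simp: controls_def)
  have [measurable]: "lambda_inf l \<in> borel_measurable M" by (rule lambda_inf_measurable[OF l])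
  have "dominated (C_good \<delta>) (\<lambda>x. SUP n. s_upto f (Suc n) x) (lambda_inf l)"
  proof (rule dominated_of_good_lambda[OF s_upto_measurable _ _ _ _ \<delta>(3)])
    fix t :: real and m E
    let ?X = "\<lambda>n. s_upto f (Suc n)"
    assume t: "0 < t" and E: "E \<in> sets (F m)" "E \<subseteq> passage ?X t m"
    have [measurable]: "E \<in> sets M" using E sets_F_M by auto
    have [measurable]: "above ?X (2 * t) \<in> sets M" by (rule above_sets) (rule s_upto_measurable)
    define c where "c = \<delta> * t"
    have c: "0 < c" "c \<le> t / 16" using t \<delta> mult_right_mono[OF \<delta>(2), of t] by (auto simp: c_def)
    define A where "A = E \<inter> above ?X (2 * t) \<inter> {x\<in>space M. lambda_inf l x \<le> ennreal (\<delta> * t)}"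
    define Z where "Z N x = (\<Sum>k\<le>N. csq f k x * indicator (stop_set l E m c k) x)" for N x
    have [measurable]: "csq f k \<in> borel_measurable M" for k by (rule csq_measurable)
    have S: "stop_set l E m c k \<in> sets (F (k - 1))" for k by (rule stop_set_sets[OF l E(1)])
    then have [measurable]: "stop_set l E m c k \<in> sets M" for k using sets_F_M by blast
    have "emeasure M A \<le> ennreal (64 * \<delta>\<^sup>2) * emeasure M E"
    proof (rule emeasure_le_of_Markov[where Z = Z and \<theta> = "t\<^sup>2"])
      show "Z N \<in> borel_measurable M" for N unfolding Z_def[abs_def] by measurable
      show "A \<in> sets M" unfolding A_def by measurable
      show "Z N x \<le> Z (Suc N) x" for N x by (simp add: Z_def)
      fix N
      have "(\<integral>\<^sup>+x. Z N x \<partial>M) = (\<Sum>k\<le>N. \<integral>\<^sup>+x. csq f k x * indicator (stop_set l E m c k) x \<partial>M)"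
        unfolding Z_def by (rule nn_integral_sum) measurable
      also have "\<dots> = (\<Sum>k\<le>N. \<integral>\<^sup>+x. ennreal ((stopped f l E m c k x)\<^sup>2) \<partial>M)"
        by (simp add: csq_indicator[OF f S] stopped_def)
      also have "\<dots> \<le> ennreal (4 * c\<^sup>2) * emeasure M E"
        using ctrl c(1) E(1) by (auto simp: controls_def)
      also have "\<dots> \<le> ennreal (64 * \<delta>\<^sup>2 * t\<^sup>2) * emeasure M E"
        by (intro mult_right_mono ennreal_leI) (auto simp: c_def power_mult_distrib)
      finally show "(\<integral>\<^sup>+x. Z N x \<partial>M) \<le> ennreal (64 * \<delta>\<^sup>2 * t\<^sup>2) * emeasure M E" .
    next
      show "AE x in M. x \<in> A \<longrightarrow> (\<exists>N. ennreal (t\<^sup>2) \<le> Z N x)"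
        using bd csq_0[OF f] AE_space
      proof eventually_elim
        case (elim x)
        show ?case
        proof
          assume x: "x \<in> A"
          have lc: "l n x \<le> c" for n
            by (rule lambda_inf_le_D[OF l elim(3)]) (use x c in \<open>auto simp: A_def c_def\<close>)
          have xE: "x \<in> E" "x \<in> passage ?X t m" using x E by (auto simp: A_def)
          \<comment> \<open>Up to index \<open>m\<close> the level is not passed, since \<open>m\<close> is the first time for the shifted process; for
            \<open>m = 0\<close> the only summand is \<open>\<bar>f 0\<bar>\<^sup>2\<close>.\<close>
          have start: "(\<Sum>k\<le>m. csq f k x) \<le> ennreal (t\<^sup>2)"
          proof (cases m)
            case 0
            have "\<bar>mdiff f 0 x\<bar> \<le> t" using elim(1)[rule_format, of 0] lc[of 0] c by simp
            then have "(mdiff f 0 x)\<^sup>2 \<le> t\<^sup>2" using t by (intro abs_le_square_iff[THEN iffD1]) auto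
            then show ?thesis using 0 elim by (simp add: ennreal_leI)
          next
            case (Suc m')
            then have "s_upto f m x \<le> ennreal t" using xE by (auto simp: passage_def)
            then show ?thesis using t by (simp add: s_upto_def epowr_half_le)
          qed
          obtain N where "ennreal (2 * t) < s_upto f (Suc N) x" using x by (auto simp: A_def above_def)
          also have "\<dots> \<le> s_upto f (Suc (max N m)) x" by (rule s_upto_mono) auto
          finally have big: "ennreal ((2 * t)\<^sup>2) < (\<Sum>k\<le>Suc (max N m). csq f k x)"
            using t by (simp add: s_upto_def less_epowr_half del: sum.atMost_Suc)
          define n where "n = Suc (max N m)"
          have Zn: "Z n x = (\<Sum>k\<in>{m<..n}. csq f k x)"
          proof -
            have "Z n x = (\<Sum>k\<le>n. if k \<in> {m<..n} then csq f k x else 0)"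
              unfolding Z_def by (rule sum.cong) (use xE elim lc in \<open>auto simp: stop_set_def\<close>)
            also have "\<dots> = (\<Sum>k\<in>{m<..n}. csq f k x)"
              by (subst sum.inter_restrict[symmetric]) (auto intro!: sum.cong)
            finally show ?thesis .
          qed
          have "{..n} = {..m} \<union> {m<..n}" by (auto simp: n_def)
          then have "(\<Sum>k\<le>n. csq f k x) = (\<Sum>k\<le>m. csq f k x) + Z n x"
            unfolding Zn by (simp only:) (rule sum.union_disjoint, auto)
          then have "ennreal ((2 * t)\<^sup>2) < (\<Sum>k\<le>m. csq f k x) + Z n x"
            using big by (simp only: n_def)
          also have "\<dots> \<le> ennreal (t\<^sup>2) + Z n x" by (rule add_right_mono[OF start])
          finally have lt: "ennreal ((2 * t)\<^sup>2) < ennreal (t\<^sup>2) + Z n x" .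
          have "ennreal (t\<^sup>2) \<le> Z n x"
          proof (rule ccontr)
            assume "\<not> ennreal (t\<^sup>2) \<le> Z n x"
            then have "ennreal (t\<^sup>2) + Z n x \<le> ennreal (t\<^sup>2) + ennreal (t\<^sup>2)"
              by (intro add_left_mono) auto
            also have "\<dots> \<le> ennreal ((2 * t)\<^sup>2)"
              by (auto simp: ennreal_plus[symmetric] power_mult_distrib simp del: ennreal_plus intro!: ennreal_leI)
            finally show False using lt by simp
          qed
          then show "\<exists>N. ennreal (t\<^sup>2) \<le> Z N x" by blast
        qed
      qed
    qed (use t in auto)
    then show "emeasure M (E \<inter> above ?X (2 * t) \<inter> {x\<in>space M. lambda_inf l x \<le> ennreal (\<delta> * t)})
      \<le> ennreal (64 * \<delta>\<^sup>2) * emeasure M E" by (simp add: A_def)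
  qed (use \<delta> in auto)
  then show ?thesis by (simp add: s_upto_Suc_SUP)
qed

definition C_norm :: real where
  "C_norm = C_good \<delta> powr (1 / a)"

lemma cond_square_le_of_controls:
  assumes "controls f l"
  shows "Lp_norm M p (cond_square_fn M F f) \<le> ennreal C_norm * Lp_norm M p (lambda_inf l)"
  unfolding C_norm_def
  by (rule Lp_norm_le_of_dominated[OF s_upto_dominated_of_controls[OF assms] C_good_ge_1 cond_square_fn_measurable])

definition C_maj :: real where
  "C_maj = (2 powr b * (C_good \<delta> + 2 powr b)) powr (1 / a)"

end

context path_exponent
begin

text \<open>The path functional of a martingale up to time \<open>n\<close>, and its supremum over all times.\<close>

definition run :: "(nat \<Rightarrow> 'a \<Rightarrow> real) \<Rightarrow> nat \<Rightarrow> 'a \<Rightarrow> real" where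
  "run f n x = q n (\<lambda>k. mdiff f k x)"

definition run_sup :: "(nat \<Rightarrow> 'a \<Rightarrow> real) \<Rightarrow> 'a \<Rightarrow> ennreal" where
  "run_sup f x = (SUP n. ennreal (run f n x))"

lemma run_measurable:
  assumes "martingale M F f"
  shows "run f n \<in> borel_measurable (F n)"
  unfolding run_def[abs_def]
  by (rule q_measurable) (rule measurable_F_mono[OF mdiff_measurable(1)[OF assms]])

lemma run_sup_measurable:
  assumes "martingale M F f"
  shows "run_sup f \<in> borel_measurable M"
proof -
  have [measurable]: "run f n \<in> borel_measurable M" for n using run_measurable[OF assms] measurable_F_M by auto
  show ?thesis unfolding run_sup_def[abs_def] by measurable
qed

text \<open>At the passage time the functional is at most \<open>t + 2 \<delta> t\<close> because the jump is controlled; to pass \<open>2 t\<close>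
  later, the functional of the stopped differences must exceed \<open>t / 2\<close>.\<close>

lemma run_sup_dominated_of_controls:
  assumes ctrl: "controls f l"
  shows "dominated (C_good \<delta>) (run_sup f) (lambda_inf l)"
proof -
  have f: "martingale M F f" and l: "l \<in> Lambda M F"
    and bd: "AE x in M. \<forall>n. \<bar>mdiff f n x\<bar> \<le> 2 * l (n - 1) x"
    using ctrl by (auto simp: controls_def)
  have [measurable]: "lambda_inf l \<in> borel_measurable M" by (rule lambda_inf_measurable[OF l])
  let ?X = "\<lambda>n x. ennreal (run f n x)"
  have Xm: "?X n \<in> borel_measurable (F n)" for n using run_measurable[OF f] by measurable
  have "dominated (C_good \<delta>) (\<lambda>x. SUP n. ?X n x) (lambda_inf l)"
  proof (rule dominated_of_good_lambda[OF Xm _ _ _ _ \<delta>(3)])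
    fix t :: real and m E
    assume t: "0 < t" and E: "E \<in> sets (F m)" "E \<subseteq> passage ?X t m"
    have [measurable]: "E \<in> sets M" using E sets_F_M by auto
    have [measurable]: "above ?X (2 * t) \<in> sets M" by (rule above_sets) (rule Xm)
    define c where "c = \<delta> * t"
    have c: "0 < c" "c \<le> t / 16" using t \<delta> mult_right_mono[OF \<delta>(2), of t] by (auto simp: c_def)
    have mds: "mds (stopped f l E m c)" by (rule mds_stopped[OF f l bd E(1) c(1)])
    define A where "A = E \<inter> above ?X (2 * t) \<inter> {x\<in>space M. lambda_inf l x \<le> ennreal (\<delta> * t)}"
    define Z where "Z N x = ennreal ((q N (\<lambda>k. stopped f l E m c k x))\<^sup>2)" for N x
    have "emeasure M A \<le> ennreal (64 * \<delta>\<^sup>2) * emeasure M E"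
    proof (rule emeasure_le_of_Markov[where Z = Z and \<theta> = "t\<^sup>2 / 4"])
      show "Z N \<in> borel_measurable M" for N
      proof -
        have [measurable]: "(\<lambda>x. q N (\<lambda>k. stopped f l E m c k x)) \<in> borel_measurable M"
          by (rule q_measurable) (use mds measurable_F_M in \<open>auto simp: mds_def\<close>)
        show ?thesis unfolding Z_def[abs_def] by measurable
      qed
      show "A \<in> sets M" unfolding A_def by measurable
      show "Z N x \<le> Z (Suc N) x" for N x
        unfolding Z_def by (intro ennreal_leI power_mono q_le_Suc q_nonneg)
      fix N
      have "(\<integral>\<^sup>+x. Z N x \<partial>M) \<le> 4 * (\<Sum>k\<le>N. \<integral>\<^sup>+x. ennreal ((stopped f l E m c k x)\<^sup>2) \<partial>M)"
        unfolding Z_def by (rule q_L2[OF mds])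
      also have "\<dots> \<le> 4 * (ennreal (4 * c\<^sup>2) * emeasure M E)"
        using ctrl c(1) E(1) by (intro mult_left_mono) (auto simp: controls_def)
      also have "\<dots> = ennreal 4 * ennreal (4 * c\<^sup>2) * emeasure M E"
        by (simp add: mult.assoc)
      also have "\<dots> = ennreal (64 * \<delta>\<^sup>2 * (t\<^sup>2 / 4)) * emeasure M E"
        by (subst ennreal_mult[symmetric]) (auto simp: c_def power_mult_distrib mult_ac)
      finally show "(\<integral>\<^sup>+x. Z N x \<partial>M) \<le> ennreal (64 * \<delta>\<^sup>2 * (t\<^sup>2 / 4)) * emeasure M E" .
    next
      show "AE x in M. x \<in> A \<longrightarrow> (\<exists>N. ennreal (t\<^sup>2 / 4) \<le> Z N x)"
        using bd AE_space
      proof eventually_elim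
        case (elim x)
        show ?case
        proof
          assume x: "x \<in> A"
          let ?d = "\<lambda>k. mdiff f k x"
          have lc: "l n x \<le> c" for n
            by (rule lambda_inf_le_D[OF l elim(2)]) (use x c in \<open>auto simp: A_def c_def\<close>)
          have xE: "x \<in> E" "x \<in> passage ?X t m" using x E by (auto simp: A_def)
          have jump: "\<bar>?d k\<bar> \<le> 2 * c" for k
            using elim(1)[rule_format, of k] lc[of "k - 1"] by simp
          have start: "q m ?d \<le> t + 2 * c"
          proof (cases m)
            case 0
            then show ?thesis using jump[of 0] t by (simp add: q_0)
          next
            case (Suc m')
            then have "q m' ?d \<le> t" using xE t by (auto simp: passage_def run_def)
            then show ?thesis using q_Suc_le[of m' ?d] jump[of m] Suc by simp
          qed
          obtain N' where N': "2 * t < q N' ?d" using x t by (auto simp: A_def above_def run_def ennreal_less_iff)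
          define N where "N = max N' m"
          have "2 * t < q N ?d" using N' q_mono[of N' N ?d] by (simp add: N_def)
          also have "q N ?d = q N (\<lambda>k. (if k \<le> m then ?d k else 0) + (if m < k then ?d k else 0))"
            by (rule arg_cong[where f = "q N"]) auto
          also have "\<dots> \<le> q N (\<lambda>k. if k \<le> m then ?d k else 0) + q N (\<lambda>k. if m < k then ?d k else 0)"
            by (rule q_add)
          also have "q N (\<lambda>k. if k \<le> m then ?d k else 0) = q m (\<lambda>k. if k \<le> m then ?d k else 0)"
            by (rule q_stop) (auto simp: N_def)
          also have "\<dots> = q m ?d" by (rule q_cong) auto
          also have "(\<lambda>k. if m < k then ?d k else 0) = (\<lambda>k. stopped f l E m c k x)"
            using xE lc elim by (auto simp: stopped_def stop_set_def fun_eq_iff)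
          finally have "t / 2 \<le> q N (\<lambda>k. stopped f l E m c k x)" using start c t by linarith
          then have "(t / 2)\<^sup>2 \<le> (q N (\<lambda>k. stopped f l E m c k x))\<^sup>2" using t by (intro power_mono) auto
          then have "ennreal (t\<^sup>2 / 4) \<le> Z N x" unfolding Z_def by (intro ennreal_leI) (simp add: power_divide)
          then show "\<exists>N. ennreal (t\<^sup>2 / 4) \<le> Z N x" by blast
        qed
      qed
    qed (use t in auto)
    then show "emeasure M (E \<inter> above ?X (2 * t) \<inter> {x\<in>space M. lambda_inf l x \<le> ennreal (\<delta> * t)})
      \<le> ennreal (64 * \<delta>\<^sup>2) * emeasure M E" by (simp add: A_def)
  qed (use \<delta> in auto)
  then show ?thesis by (simp add: run_sup_def[abs_def])
qed

lemma run_sup_le_of_controls: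
  assumes ctrl: "controls f l"
  shows "Lp_norm M p (run_sup f) \<le> ennreal C_norm * Lp_norm M p (lambda_inf l)"
  unfolding C_norm_def
  by (rule Lp_norm_le_of_dominated[OF run_sup_dominated_of_controls[OF ctrl] C_good_ge_1 run_sup_measurable])
     (use ctrl in \<open>simp add: controls_def\<close>)

text \<open>The values up to time \<open>n\<close> together with the bound \<open>2 l n\<close> for the next jump form a predictable
  majorant.\<close>

lemma majorant_of_controls:
  assumes ctrl: "controls f l"
  obtains r where "r \<in> Lambda M F" "\<And>n. AE x in M. run f (Suc n) x \<le> r n x"
    "Lp_norm M p (lambda_inf r) \<le> ennreal C_maj * Lp_norm M p (lambda_inf l)"
proof
  have f: "martingale M F f" and l: "l \<in> Lambda M F"
    and bd: "AE x in M. \<forall>n. \<bar>mdiff f n x\<bar> \<le> 2 * l (n - 1) x"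
    using ctrl by (auto simp: controls_def)
  define r where "r n x = run f n x + 2 * l n x" for n x
  have rm: "r n \<in> borel_measurable (F n)" for n
    unfolding r_def[abs_def] using run_measurable[OF f, of n] LambdaD(1)[OF l, of n] by measurable
  show r: "r \<in> Lambda M F"
    unfolding Lambda_def using rm q_nonneg q_le_Suc LambdaD(2)[OF l] LambdaD(3)[OF l _ le_SucI[OF le_refl]]
    by (auto simp: r_def run_def intro!: add_mono add_nonneg_nonneg)
  show "AE x in M. run f (Suc n) x \<le> r n x" for n
    using bd
  proof eventually_elim
    case (elim x)
    then show ?case using elim[rule_format, of "Suc n"] q_Suc_le[of n "\<lambda>k. mdiff f k x"]
      by (simp add: r_def run_def)
  qed
  have [measurable]: "lambda_inf l \<in> borel_measurable M" "run_sup f \<in> borel_measurable M"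
    by (rule lambda_inf_measurable[OF l], rule run_sup_measurable[OF f])
  have le: "AE x in M. lambda_inf r x \<le> run_sup f x + ennreal 2 * lambda_inf l x"
  proof (rule AE_I2)
    fix x assume x: "x \<in> space M"
    show "lambda_inf r x \<le> run_sup f x + ennreal 2 * lambda_inf l x"
      unfolding lambda_inf_eq[OF r x]
    proof (rule SUP_least)
      fix n
      have "ennreal (r n x) = ennreal (run f n x) + ennreal 2 * ennreal (l n x)"
        using q_nonneg LambdaD(2)[OF l x] by (simp add: r_def run_def ennreal_plus ennreal_mult)
      also have "\<dots> \<le> run_sup f x + ennreal 2 * lambda_inf l x"
        unfolding run_sup_def lambda_inf_eq[OF l x] by (intro add_mono mult_left_mono SUP_upper) auto
      finally show "ennreal (r n x) \<le> run_sup f x + ennreal 2 * lambda_inf l x" .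
    qed
  qed
  have "dominated (2 powr b * 1) (\<lambda>x. ennreal 2 * lambda_inf l x) (lambda_inf l)"
    by (rule dominated_cmult[OF dominated_refl]) auto
  then have "dominated (2 powr b * (C_good \<delta> + 2 powr b)) (\<lambda>x. run_sup f x + ennreal 2 * lambda_inf l x) (lambda_inf l)"
    using C_good_ge_1[of \<delta>] by (intro dominated_add run_sup_dominated_of_controls[OF ctrl]) auto
  from dominated_mono[OF this le]
  show "Lp_norm M p (lambda_inf r) \<le> ennreal C_maj * Lp_norm M p (lambda_inf l)"
    unfolding C_maj_def
  proof (rule Lp_norm_le_of_dominated)
    have "1 * 1 \<le> 2 powr b * (C_good \<delta> + 2 powr b)"
      using b_pos C_good_ge_1[of \<delta>] by (intro mult_mono ge_one_powr_ge_zero add_increasing2) auto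
    then show "1 \<le> 2 powr b * (C_good \<delta> + 2 powr b)" by simp
  qed (rule lambda_inf_measurable[OF r])
qed

end

section \<open>Layers of the conditional square function\<close>

context filtered_prob
begin

lemma s_upto_measurable_pred: "s_upto f k \<in> borel_measurable (F (k - 1))"
proof (cases k)
  case 0
  have [measurable]: "csq f 0 \<in> borel_measurable (F 0)" using csq_measurable(1)[of f 0] by simp
  show ?thesis using 0 unfolding s_upto_def[abs_def] by simp
next
  case (Suc n)
  then show ?thesis using s_upto_measurable[of f n] by simp
qed

lemma sum_csq_below_le:
  assumes c: "0 \<le> c" and H: "\<And>k. x \<in> H k \<Longrightarrow> s_upto f k x \<le> ennreal c"
  shows "(\<Sum>k\<le>N. csq f k x * indicator (H k) x) \<le> ennreal (c\<^sup>2)"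
proof (induction N)
  case 0
  show ?case using H[of 0] c by (cases "x \<in> H 0") (auto simp: s_upto_def epowr_half_le)
next
  case (Suc N)
  show ?case
  proof (cases "x \<in> H (Suc N)")
    case True
    have "(\<Sum>k\<le>Suc N. csq f k x * indicator (H k) x) \<le> (\<Sum>k\<le>Suc N. csq f k x)"
      by (rule sum_mono) (simp add: indicator_def)
    also have "\<dots> \<le> ennreal (c\<^sup>2)"
      using H[OF True] c unfolding s_upto_def by (simp only: epowr_half_le)
    finally show ?thesis .
  qed (use Suc in simp)
qed

text \<open>Differences kept only on predictable events on which the conditional square function is at most \<open>c\<close>
  have energy at most \<open>c\<^sup>2\<close>.\<close>

lemma energy_below:
  assumes f: "martingale M F f" and H: "\<And>k. H k \<in> sets (F (k - 1))"
    and HE: "\<And>k. H k \<subseteq> E" and E: "E \<in> sets M" and c: "0 \<le> c"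
    and Hc: "\<And>k x. x \<in> H k \<Longrightarrow> s_upto f k x \<le> ennreal c"
  shows "(\<Sum>k\<le>N. \<integral>\<^sup>+x. ennreal ((indicator (H k) x * mdiff f k x)\<^sup>2) \<partial>M) \<le> ennreal (c\<^sup>2) * emeasure M E"
    and "mds (\<lambda>k x. indicator (H k) x * mdiff f k x)"
proof -
  have [measurable]: "H k \<in> sets M" "csq f k \<in> borel_measurable M" for k
    using sets_F_M[OF H] csq_measurable by auto
  note E [measurable]
  show le: "(\<Sum>k\<le>N. \<integral>\<^sup>+x. ennreal ((indicator (H k) x * mdiff f k x)\<^sup>2) \<partial>M) \<le> ennreal (c\<^sup>2) * emeasure M E" for N
  proof -
    have "(\<Sum>k\<le>N. \<integral>\<^sup>+x. ennreal ((indicator (H k) x * mdiff f k x)\<^sup>2) \<partial>M)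
      = (\<integral>\<^sup>+x. (\<Sum>k\<le>N. csq f k x * indicator (H k) x) \<partial>M)"
      by (subst nn_integral_sum) (auto simp: csq_indicator[OF f H])
    also have "\<dots> \<le> (\<integral>\<^sup>+x. ennreal (c\<^sup>2) * indicator E x \<partial>M)"
    proof (rule nn_integral_mono)
      fix x
      show "(\<Sum>k\<le>N. csq f k x * indicator (H k) x) \<le> ennreal (c\<^sup>2) * indicator E x"
      proof (cases "x \<in> E")
        case True
        then show ?thesis using sum_csq_below_le[OF c Hc, of x H] by simp
      next
        case False
        then have "x \<notin> H k" for k using HE by auto
        then show ?thesis by simp
      qed
    qed
    also have "\<dots> = ennreal (c\<^sup>2) * emeasure M E" by (simp add: nn_integral_cmult_indicator)
    finally show ?thesis .
  qed
  show "mds (\<lambda>k x. indicator (H k) x * mdiff f k x)"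
  proof (rule mds_restrict_mdiff[OF f H])
    fix k
    have "(\<integral>\<^sup>+x. ennreal ((mdiff f k x)\<^sup>2) * indicator (H k) x \<partial>M)
      = (\<integral>\<^sup>+x. ennreal ((indicator (H k) x * mdiff f k x)\<^sup>2) \<partial>M)"
      by (rule nn_integral_cong) (simp add: indicator_def)
    also have "\<dots> \<le> (\<Sum>k\<le>k. \<integral>\<^sup>+x. ennreal ((indicator (H k) x * mdiff f k x)\<^sup>2) \<partial>M)"
      by (rule member_le_sum) auto
    also have "\<dots> \<le> ennreal (c\<^sup>2) * emeasure M E" by (rule le)
    also have "\<dots> < \<infinity>" by (simp add: emeasure_eq_measure ennreal_mult[symmetric])
    finally show "(\<integral>\<^sup>+x. ennreal ((mdiff f k x)\<^sup>2) * indicator (H k) x \<partial>M) < \<infinity>" .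
  qed
qed

text \<open>The events, measurable at time \<open>k - 1\<close>, that the conditional square function up to time \<open>k\<close>, divided
  by the scale \<open>l\<close>, lies between \<open>2\<^sup>i\<close> and \<open>2\<^sup>i\<^sup>+\<^sup>1\<close>, respectively is at most 1.\<close>

definition layer :: "(nat \<Rightarrow> 'a \<Rightarrow> real) \<Rightarrow> real \<Rightarrow> nat \<Rightarrow> nat \<Rightarrow> 'a set" where
  "layer f l i k = {x\<in>space M. ennreal (2 ^ i) < s_upto f k x / ennreal l \<and> s_upto f k x / ennreal l \<le> ennreal (2 ^ Suc i)}"

definition base :: "(nat \<Rightarrow> 'a \<Rightarrow> real) \<Rightarrow> real \<Rightarrow> nat \<Rightarrow> 'a set" where
  "base f l k = {x\<in>space M. s_upto f k x / ennreal l \<le> ennreal 1}"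

lemma layer_sets: "layer f l i k \<in> sets (F (k - 1))" "base f l k \<in> sets (F (k - 1))"
proof -
  have [measurable]: "s_upto f k \<in> borel_measurable (F (k - 1))" by (rule s_upto_measurable_pred)
  have "{x\<in>space (F (k - 1)). ennreal (2 ^ i) < s_upto f k x / ennreal l \<and> s_upto f k x / ennreal l \<le> ennreal (2 ^ Suc i)} \<in> sets (F (k - 1))"
    "{x\<in>space (F (k - 1)). s_upto f k x / ennreal l \<le> ennreal 1} \<in> sets (F (k - 1))"
    by measurable
  then show "layer f l i k \<in> sets (F (k - 1))" "base f l k \<in> sets (F (k - 1))"
    by (simp_all add: layer_def base_def)
qed

lemma mdiff_layers:
  assumes s: "s_upto f k x / ennreal l \<le> ennreal s" and x: "x \<in> space M"
  shows "mdiff f k x = indicator (base f l k) x * mdiff f k x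
    + (\<Sum>i | (2::real) ^ i < s. indicator (layer f l i k) x * mdiff f k x)"
proof -
  obtain v where v: "s_upto f k x / ennreal l = ennreal v" "0 \<le> v"
    using s by (cases "s_upto f k x / ennreal l") (auto simp: top_unique)
  have in_layer: "x \<in> layer f l i k \<longleftrightarrow> 2 ^ i < v \<and> v \<le> 2 ^ Suc i" for i
    using x v by (auto simp: layer_def ennreal_less_iff)
  show ?thesis
  proof (cases "v \<le> 1")
    case True
    have "x \<notin> layer f l i k" for i
    proof
      assume "x \<in> layer f l i k"
      then have "2 ^ i < v" by (simp add: in_layer)
      moreover have "(1::real) \<le> 2 ^ i" by simp
      ultimately show False using True by linarith
    qed
    moreover have "x \<in> base f l k" using True x v by (simp add: base_def)
    ultimately show ?thesis by simp
  next
    case False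
    define j where "j = Max {i::nat. (2::real) ^ i < v}"
    have ne: "0 \<in> {i::nat. (2::real) ^ i < v}" using False by auto
    have j: "2 ^ j < v" using Max_in[OF finite_dyadic_below, of v] ne unfolding j_def by blast
    have "Suc j \<notin> {i::nat. (2::real) ^ i < v}"
      using Max_ge[OF finite_dyadic_below, of "Suc j" v] by (auto simp: j_def)
    then have j': "v \<le> 2 ^ Suc j" by auto
    have uniq: "x \<in> layer f l i k \<longleftrightarrow> i = j" for i
    proof
      assume "x \<in> layer f l i k"
      then have "(2::real) ^ i < 2 ^ Suc j" "(2::real) ^ j < 2 ^ Suc i"
        using j j' unfolding in_layer by linarith+
      then have "i < Suc j" "j < Suc i"
        by (meson one_less_numeral_iff power_less_imp_less_exp semiring_norm(76))+
      then show "i = j" by simp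
    qed (use j j' in \<open>simp add: in_layer\<close>)
    have "v \<le> s" using s v
      by (metis ennreal_le_iff2 ennreal_neg linorder_not_le v(1) False nle_le order_trans zero_le_one)
    then have "2 ^ j < s" using j by linarith
    then have "(\<Sum>i | (2::real) ^ i < s. indicator (layer f l i k) x * mdiff f k x)
      = (\<Sum>i | (2::real) ^ i < s. if i = j then mdiff f k x else 0)"
      by (intro sum.cong) (auto simp: uniq indicator_def)
    also have "\<dots> = mdiff f k x" using finite_dyadic_below[of s] \<open>2 ^ j < s\<close> by (simp add: sum.delta)
    finally show ?thesis using False v x by (simp add: base_def)
  qed
qed

end

context path_exponent
begin

text \<open>The square of the path functional of the differences kept on the events \<open>H\<^sub>k\<close>, at scale \<open>l\<close>.\<close>

definition energy :: "(nat \<Rightarrow> 'a \<Rightarrow> real) \<Rightarrow> real \<Rightarrow> (nat \<Rightarrow> 'a set) \<Rightarrow> 'a \<Rightarrow> ennreal" where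
  "energy f l H x = (SUP N. ennreal ((q N (\<lambda>k. indicator (H k) x * mdiff f k x) / l)\<^sup>2))"

lemma energy_measurable:
  assumes f: "martingale M F f" and H: "\<And>k. H k \<in> sets (F (k - 1))"
  shows "energy f l H \<in> borel_measurable M"
proof -
  have [measurable]: "(\<lambda>x. q N (\<lambda>k. indicator (H k) x * mdiff f k x)) \<in> borel_measurable M" for N
  proof (rule q_measurable)
    fix k
    have [measurable]: "H k \<in> sets M" "mdiff f k \<in> borel_measurable M"
      using sets_F_M[OF H] mdiff_measurable[OF f] by auto
    show "(\<lambda>x. indicator (H k) x * mdiff f k x) \<in> borel_measurable M" by measurable
  qed
  show ?thesis unfolding energy_def[abs_def] by measurable
qed

lemma integral_energy_le:
  assumes f: "martingale M F f" and H: "\<And>k. H k \<in> sets (F (k - 1))"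
    and HE: "\<And>k. H k \<subseteq> E" and E: "E \<in> sets M" and c: "0 \<le> c" and l: "0 < l"
    and Hc: "\<And>k x. x \<in> H k \<Longrightarrow> s_upto f k x \<le> ennreal (l * c)"
  shows "(\<integral>\<^sup>+x. energy f l H x \<partial>M) \<le> ennreal (4 * c\<^sup>2) * emeasure M E"
proof -
  let ?q = "\<lambda>N x. q N (\<lambda>k. indicator (H k) x * mdiff f k x)"
  have lc: "0 \<le> l * c" using c l by simp
  note en = energy_below[OF f H HE E lc Hc]
  have [measurable]: "?q N \<in> borel_measurable M" for N
    by (rule q_measurable) (use en(2) measurable_F_M in \<open>auto simp: mds_def\<close>)
  have "(\<integral>\<^sup>+x. energy f l H x \<partial>M) = (SUP N. \<integral>\<^sup>+x. ennreal ((?q N x / l)\<^sup>2) \<partial>M)"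
    unfolding energy_def
  proof (rule nn_integral_monotone_convergence_SUP)
    show "incseq (\<lambda>N x. ennreal ((?q N x / l)\<^sup>2))"
      using l by (auto simp: incseq_Suc_iff le_fun_def intro!: ennreal_leI power_mono divide_right_mono q_le_Suc divide_nonneg_nonneg q_nonneg)
  qed measurable
  also have "\<dots> \<le> ennreal (4 * c\<^sup>2) * emeasure M E"
  proof (rule SUP_least)
    fix N
    have "(\<integral>\<^sup>+x. ennreal ((?q N x / l)\<^sup>2) \<partial>M) = (\<integral>\<^sup>+x. ennreal (1 / l\<^sup>2) * ennreal ((?q N x)\<^sup>2) \<partial>M)"
      by (rule nn_integral_cong) (simp add: power_divide ennreal_mult[symmetric])
    also have "\<dots> = ennreal (1 / l\<^sup>2) * (\<integral>\<^sup>+x. ennreal ((?q N x)\<^sup>2) \<partial>M)"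
      by (rule nn_integral_cmult) measurable
    also have "\<dots> \<le> ennreal (1 / l\<^sup>2) * (4 * (\<Sum>k\<le>N. \<integral>\<^sup>+x. ennreal ((indicator (H k) x * mdiff f k x)\<^sup>2) \<partial>M))"
      by (intro mult_left_mono q_L2 en) auto
    also have "\<dots> \<le> ennreal (1 / l\<^sup>2) * (4 * (ennreal ((l * c)\<^sup>2) * emeasure M E))"
      by (intro mult_left_mono en) auto
    also have "\<dots> = (ennreal (1 / l\<^sup>2) * (ennreal 4 * ennreal ((l * c)\<^sup>2))) * emeasure M E"
      by (simp add: mult_ac)
    also have "ennreal (1 / l\<^sup>2) * (ennreal 4 * ennreal ((l * c)\<^sup>2)) = ennreal (4 * c\<^sup>2)"
      using l by (subst ennreal_mult[symmetric], simp, simp, subst ennreal_mult[symmetric], simp, simp)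
        (simp add: power_mult_distrib)
    finally show "(\<integral>\<^sup>+x. ennreal ((?q N x / l)\<^sup>2) \<partial>M) \<le> ennreal (4 * c\<^sup>2) * emeasure M E" .
  qed
  finally show ?thesis .
qed

lemma integral_energy_layer_le:
  assumes f: "martingale M F f" and l: "0 < l"
    and E: "E \<in> sets (F n)" "E \<subseteq> passage (\<lambda>n x. s_upto f (Suc n) x / ennreal l) (2 ^ i) n"
  shows "(\<integral>\<^sup>+x\<in>E. energy f l (layer f l i) x \<partial>M) \<le> ennreal (16 * 4 ^ i) * emeasure M E"
proof -
  \<comment> \<open>On \<open>E\<close> no difference of layer \<open>i\<close> occurs up to time \<open>n\<close> unless \<open>n = 0\<close>, so the events of the layer may
    be intersected with \<open>E\<close> without losing predictability.\<close>
  define H where "H k = layer f l i k \<inter> (if n < k \<or> n = 0 then E else {})" for k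
  have HF: "H k \<in> sets (F (k - 1))" for k
    using layer_sets(1)[of f l i k] sets_F_mono[OF E(1), of "k - 1"] by (auto simp: H_def)
  have lH: "indicator (layer f l i k) x = (indicator (H k) x :: real)" if "x \<in> E" for k x
  proof (cases "n < k \<or> n = 0")
    case False
    then obtain n' where n': "n = Suc n'" "k \<le> n" by (cases n) auto
    have "s_upto f k x / ennreal l \<le> s_upto f n x / ennreal l"
      using n' by (intro divide_right_mono_ennreal s_upto_mono) auto
    also have "\<dots> \<le> ennreal (2 ^ i)" using E that n' by (auto simp: passage_def)
    finally have "x \<notin> layer f l i k" by (simp add: layer_def not_less[symmetric])
    then show ?thesis by (simp add: H_def)
  qed (use that in \<open>auto simp: H_def indicator_def\<close>)
  have "(\<integral>\<^sup>+x\<in>E. energy f l (layer f l i) x \<partial>M) \<le> (\<integral>\<^sup>+x. energy f l H x \<partial>M)"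
  proof (rule nn_integral_mono)
    fix x
    show "energy f l (layer f l i) x * indicator E x \<le> energy f l H x"
      by (cases "x \<in> E") (simp_all add: energy_def lH)
  qed
  also have "\<dots> \<le> ennreal (4 * (2 ^ Suc i)\<^sup>2) * emeasure M E"
  proof (rule integral_energy_le[OF f HF _ sets_F_M[OF E(1)] _ l])
    show "s_upto f k x \<le> ennreal (l * 2 ^ Suc i)" if "x \<in> H k" for k x
      using that le_divide_iff_ennreal[OF l, of "2 ^ Suc i" "s_upto f k x"] by (auto simp: H_def layer_def)
  qed (auto simp: H_def)
  also have "(4::real) * (2 ^ Suc i)\<^sup>2 = 16 * 4 ^ i"
    by (simp add: power_mult_distrib power_mult[symmetric] mult.commute[of _ 2] power_mult)
  finally show ?thesis .
qed

lemma integral_energy_base_le: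
  assumes f: "martingale M F f" and l: "0 < l"
  shows "(\<integral>\<^sup>+x. energy f l (base f l) x \<partial>M) \<le> 4"
proof -
  have "(\<integral>\<^sup>+x. energy f l (base f l) x \<partial>M) \<le> ennreal (4 * 1\<^sup>2) * emeasure M (space M)"
  proof (rule integral_energy_le[OF f layer_sets(2) _ _ _ l])
    show "s_upto f k x \<le> ennreal (l * 1)" if "x \<in> base f l k" for k x
      using that le_divide_iff_ennreal[OF l, of 1 "s_upto f k x"] by (auto simp: base_def)
  qed (auto simp: base_def)
  then show ?thesis by (simp add: emeasure_space_1)
qed

end

section \<open>Estimates by the conditional square function\<close>

context atomic_exponent
begin

text \<open>The exponent \<open>\<eta>\<close> of \<open>powr_sum_dyadic_le\<close>; it is positive when \<open>b < 2\<close>.\<close>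

definition \<eta> :: real where "\<eta> = a / 4 * ((2 - b) / b)"

definition D_geo :: "real \<Rightarrow> real" where "D_geo r = 1 / (1 - 2 powr (- r))"

lemma D_geo_ge_1: "0 < r \<Longrightarrow> 1 \<le> D_geo r"
  using powr_less_one[of 2 "- r"] by (simp add: D_geo_def)

definition C_one :: real where
  "C_one = 2 powr b * (5 + D_geo \<eta> powr b * (16 * (C1 1 1 * C2 1) + D_geo (a / 2)))"

lemma C_one_ge_1:
  assumes "b < 2"
  shows "1 \<le> C_one"
proof -
  have "0 \<le> C1 1 1 * C2 1" "1 \<le> D_geo (a / 2)"
    using C1_nonneg[of 1 1] C2_nonneg[of 1] D_geo_ge_1[of "a / 2"] a_pos by simp_all
  then have "1 * 1 \<le> C_one" unfolding C_one_def using b_pos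
    by (intro mult_mono ge_one_powr_ge_zero add_increasing2) auto
  then show ?thesis by simp
qed

end

context path_exponent
begin

text \<open>Subadditivity of the path functional over the layers, followed by \<open>powr_sum_dyadic_le\<close> with
  \<open>u\<^sub>i\<close> the functional of layer \<open>i\<close> divided by \<open>2\<^sup>i\<close>.\<close>

lemma layer_pointwise:
  assumes b2: "b < 2" and l: "0 < l" and x: "x \<in> space M" and px: "a \<le> p x" "p x \<le> b"
    and s: "cond_square_fn M F f x / ennreal l = ennreal s" "0 \<le> s"
    and z: "energy f l (base f l) x = ennreal z" "0 \<le> z"
    and e: "\<And>i. energy f l (layer f l i) x = ennreal (e i)" "\<And>i. 0 \<le> e i"
  shows "epowr (run_sup f x / ennreal l) (p x) \<le> ennreal (2 powr b) *
    ((1 + energy f l (base f l) x) + ennreal (D_geo \<eta> powr b) *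
      ((\<Sum>i. lev i (p x) * (energy f l (layer f l i) x * ennreal (1 / 4 ^ i))
            * indicator {x\<in>space M. ennreal (2 ^ i) < cond_square_fn M F f x / ennreal l} x)
        + ennreal (D_geo (a / 2)) * epowr (cond_square_fn M F f x / ennreal l) (p x)))"
proof -
  let ?I = "{i::nat. (2::real) ^ i < s}"
  let ?d = "\<lambda>k. mdiff f k x"
  define u where "u i = sqrt (e i) / 2 ^ i" for i
  define T where "T = (\<Sum>i\<in>?I. 2 ^ i * u i)"
  have p0: "0 < p x" using px a_pos by simp
  have \<eta>: "0 < \<eta>" using b2 a_pos b_pos by (simp add: \<eta>_def)
  have u0: "0 \<le> u i" for i by (simp add: u_def e)
  have T0: "0 \<le> T" unfolding T_def by (intro sum_nonneg mult_nonneg_nonneg u0) auto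
  have qle: "q N (\<lambda>k. indicator (H k) x * ?d k) \<le> l * sqrt w"
    if "energy f l H x = ennreal w" "0 \<le> w" for N H w
  proof -
    have "ennreal ((q N (\<lambda>k. indicator (H k) x * ?d k) / l)\<^sup>2) \<le> energy f l H x"
      unfolding energy_def by (rule SUP_upper) simp
    then have "(q N (\<lambda>k. indicator (H k) x * ?d k) / l)\<^sup>2 \<le> w" using that by simp
    then have "q N (\<lambda>k. indicator (H k) x * ?d k) / l \<le> sqrt w" by (rule real_le_rsqrt)
    then show ?thesis using l by (simp add: field_simps)
  qed
  have cs: "s_upto f k x / ennreal l \<le> ennreal s" for k
  proof -
    have "s_upto f k x \<le> s_upto f (Suc k) x" by (rule s_upto_mono) simp
    also have "\<dots> \<le> cond_square_fn M F f x" unfolding s_upto_Suc_SUP[symmetric] by (rule SUP_upper) simp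
    finally show ?thesis unfolding s(1)[symmetric] by (rule divide_right_mono_ennreal)
  qed
  have QN: "run f N x \<le> l * (sqrt z + T)" for N
  proof -
    have "run f N x = q N (\<lambda>k. indicator (base f l k) x * ?d k + (\<Sum>i\<in>?I. indicator (layer f l i k) x * ?d k))"
      unfolding run_def by (rule q_cong) (rule mdiff_layers[OF cs x])
    also have "\<dots> \<le> q N (\<lambda>k. indicator (base f l k) x * ?d k) + q N (\<lambda>k. \<Sum>i\<in>?I. indicator (layer f l i k) x * ?d k)"
      by (rule q_add)
    also have "\<dots> \<le> l * sqrt z + (\<Sum>i\<in>?I. l * sqrt (e i))"
      by (intro add_mono qle z order_trans[OF q_sum_le[OF finite_dyadic_below]] sum_mono e)
    also have "\<dots> = l * (sqrt z + T)"
      by (simp add: T_def u_def distrib_left sum_distrib_left)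
    finally show ?thesis .
  qed
  have "run_sup f x / ennreal l \<le> ennreal (sqrt z) + ennreal T"
  proof -
    have "run_sup f x \<le> ennreal (l * (sqrt z + T))"
      unfolding run_sup_def by (intro SUP_least ennreal_leI QN)
    then have "run_sup f x / ennreal l \<le> ennreal (l * (sqrt z + T)) / ennreal l"
      by (rule divide_right_mono_ennreal)
    also have "\<dots> = ennreal (sqrt z + T)" using l z T0 by (simp add: divide_ennreal)
    also have "\<dots> = ennreal (sqrt z) + ennreal T" using z T0 by (simp add: ennreal_plus)
    finally show ?thesis .
  qed
  then have "epowr (run_sup f x / ennreal l) (p x) \<le> epowr (ennreal (sqrt z) + ennreal T) (p x)"
    using p0 by (intro epowr_mono) auto
  also have "\<dots> \<le> ennreal (2 powr b) * (epowr (ennreal (sqrt z)) (p x) + epowr (ennreal T) (p x))"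
    by (rule epowr_add_le[OF p0 px(2)])
  also have "\<dots> \<le> ennreal (2 powr b) *
    ((1 + energy f l (base f l) x) + ennreal (D_geo \<eta> powr b) *
      ((\<Sum>i. lev i (p x) * (energy f l (layer f l i) x * ennreal (1 / 4 ^ i))
            * indicator {x\<in>space M. ennreal (2 ^ i) < cond_square_fn M F f x / ennreal l} x)
        + ennreal (D_geo (a / 2)) * epowr (cond_square_fn M F f x / ennreal l) (p x)))"
  proof (intro mult_left_mono add_mono)
    have "sqrt z powr p x \<le> 1 + z"
    proof (cases "z \<le> 1")
      case True
      then have "sqrt z powr p x \<le> 1" using p0 z by (intro powr_le1) auto
      then show ?thesis using z by simp
    next
      case False
      then have "sqrt z powr p x \<le> sqrt z powr 2" using px b2 by (intro powr_mono) auto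
      then show ?thesis using z by simp
    qed
    then have "ennreal (sqrt z powr p x) \<le> ennreal (1 + z)" by (rule ennreal_leI)
    then have "epowr (ennreal (sqrt z)) (p x) \<le> ennreal (1 + z)"
      using z by (subst epowr_ennreal) auto
    then show "epowr (ennreal (sqrt z)) (p x) \<le> 1 + energy f l (base f l) x"
      using z by (simp add: ennreal_plus)
  next
    let ?f = "\<lambda>i. lev i (p x) * (energy f l (layer f l i) x * ennreal (1 / 4 ^ i))
            * indicator {x\<in>space M. ennreal (2 ^ i) < cond_square_fn M F f x / ennreal l} x"
    have D: "D_geo \<eta> powr p x \<le> D_geo \<eta> powr b" using px D_geo_ge_1[OF \<eta>] by (intro powr_mono) auto
    have D2: "1 \<le> D_geo (a / 2)" using a_pos by (intro D_geo_ge_1) auto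
    have u2: "(u i)\<^sup>2 = e i * (1 / 4 ^ i)" for i
      by (simp add: u_def power_divide e power_mult[symmetric] mult.commute[of _ 2] power_mult)
    have "T powr p x \<le> D_geo \<eta> powr b * ((\<Sum>i\<in>?I. 2 powr (real i * p x) * (u i)\<^sup>2) + D_geo (a / 2) * s powr p x)"
    proof (cases "s = 0")
      case True
      then have "?I = {}" by (auto simp: not_less)
      then have "T = 0" unfolding T_def by (simp only:) simp
      moreover have "0 \<le> (\<Sum>i\<in>?I. 2 powr (real i * p x) * (u i)\<^sup>2)" by (intro sum_nonneg) auto
      ultimately show ?thesis using D2 by simp
    next
      case False
      then have s0: "0 < s" using s by simp
      have "T powr p x \<le> D_geo \<eta> powr p x * ((\<Sum>i\<in>?I. 2 powr (real i * p x) * (u i)\<^sup>2) + s powr p x / (1 - 2 powr (- (a / 2))))"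
        unfolding T_def D_geo_def \<eta>_def by (rule powr_sum_dyadic_le[OF a_pos px b2 s0 u0])
      also have "\<dots> \<le> D_geo \<eta> powr b * ((\<Sum>i\<in>?I. 2 powr (real i * p x) * (u i)\<^sup>2) + s powr p x / (1 - 2 powr (- (a / 2))))"
        using a_pos powr_less_one[of 2 "- (a / 2)"]
        by (intro mult_right_mono D add_nonneg_nonneg sum_nonneg divide_nonneg_nonneg) auto
      finally show ?thesis by (simp add: D_geo_def)
    qed
    note T_le = this
    have "ennreal (T powr p x) \<le> ennreal (D_geo \<eta> powr b) *
      (ennreal (\<Sum>i\<in>?I. 2 powr (real i * p x) * (u i)\<^sup>2) + ennreal (D_geo (a / 2)) * ennreal (s powr p x))"
    proof -
      have *: "ennreal t \<le> ennreal v * (ennreal y + ennreal d * ennreal w)"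
        if "t \<le> v * (y + d * w)" "0 \<le> v" "0 \<le> y" "0 \<le> d" "0 \<le> w" for t v y d w :: real
      proof -
        have "ennreal t \<le> ennreal (v * (y + d * w))" using that(1) by (rule ennreal_leI)
        also have "\<dots> = ennreal v * (ennreal y + ennreal d * ennreal w)"
          using that by (simp add: ennreal_mult ennreal_plus)
        finally show ?thesis .
      qed
      show ?thesis by (rule *[OF T_le]) (use D2 in \<open>auto intro!: sum_nonneg\<close>)
    qed
    also have "ennreal (\<Sum>i\<in>?I. 2 powr (real i * p x) * (u i)\<^sup>2) \<le> (\<Sum>i. ?f i)"
    proof -
      have "ennreal (\<Sum>i\<in>?I. 2 powr (real i * p x) * (u i)\<^sup>2) = (\<Sum>i\<in>?I. ennreal (2 powr (real i * p x) * (u i)\<^sup>2))"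
        by (rule sum_ennreal[symmetric]) auto
      also have "\<dots> = (\<Sum>i\<in>?I. ?f i)"
      proof (intro sum.cong refl)
        fix i assume "i \<in> ?I"
        then have "?f i = lev i (p x) * (ennreal (e i) * ennreal (1 / 4 ^ i))"
          using x s e(1)[of i] by (simp add: ennreal_less_iff)
        also have "\<dots> = ennreal (2 powr (real i * p x) * (u i)\<^sup>2)"
          unfolding u2
          by (subst ennreal_mult[symmetric], simp add: e(2), simp, subst ennreal_mult[symmetric]) (simp_all add: e(2))
        finally show "ennreal (2 powr (real i * p x) * (u i)\<^sup>2) = ?f i" by (rule sym)
      qed
      also have "\<dots> \<le> (\<Sum>i. ?f i)" by (rule sum_le_suminf) (auto simp: finite_dyadic_below)
      finally show ?thesis .
    qed
    then have "ennreal (D_geo \<eta> powr b) *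
      (ennreal (\<Sum>i\<in>?I. 2 powr (real i * p x) * (u i)\<^sup>2) + ennreal (D_geo (a / 2)) * ennreal (s powr p x))
      \<le> ennreal (D_geo \<eta> powr b) * ((\<Sum>i. ?f i) + ennreal (D_geo (a / 2)) * ennreal (s powr p x))"
      by (intro mult_left_mono add_right_mono) auto
    finally show "epowr (ennreal T) (p x) \<le> ennreal (D_geo \<eta> powr b) * ((\<Sum>i. ?f i)
        + ennreal (D_geo (a / 2)) * epowr (cond_square_fn M F f x / ennreal l) (p x))"
      using T0 s by (simp add: epowr_ennreal)
  qed auto
  finally show ?thesis .
qed

text \<open>Integration of \<open>layer_pointwise\<close>. On each atom the weight of level \<open>i\<close> is replaced by the constant
  \<open>W\<close>, the energy of layer \<open>i\<close> integrates to at most \<open>16 * 4 ^ i\<close> times the probability, and the remaining sum of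
  the weights is controlled by \<open>s(f)\<close> itself.\<close>

lemma run_sup_dominated_of_cond_square:
  assumes f: "martingale M F f" and b2: "b < 2"
  shows "dominated C_one (run_sup f) (cond_square_fn M F f)"
  unfolding dominated_def
proof (intro allI impI)
  fix l :: real
  let ?S = "\<lambda>x. cond_square_fn M F f x / ennreal l"
  let ?X = "\<lambda>n x. s_upto f (Suc n) x / ennreal l"
  assume l: "0 < l" and S1: "modular ?S \<le> 1"
  have Xm: "?X n \<in> borel_measurable (F n)" for n
    using s_upto_measurable[of f n] by measurable
  have Sm [measurable]: "cond_square_fn M F f \<in> borel_measurable M" by (rule cond_square_fn_measurable)
  have [measurable]: "energy f l (base f l) \<in> borel_measurable M" "energy f l (layer f l i) \<in> borel_measurable M" for i
    by (rule energy_measurable[OF f layer_sets(2)], rule energy_measurable[OF f layer_sets(1)])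
  have [measurable]: "W ?X i \<in> borel_measurable M" for i by (rule W_measurable[OF Xm])
  have [measurable]: "above ?X t \<in> sets M" for t by (rule above_sets[OF Xm])
  have SX: "(SUP n. ?X n x) = ?S x" for x by (simp add: SUP_divide_ennreal[symmetric] s_upto_Suc_SUP)
  have above: "above ?X t = {x\<in>space M. ennreal t < ?S x}" for t
    unfolding above_eq_SUP SX ..
  have b_geo: "0 < \<eta>" using b2 a_pos b_pos by (simp add: \<eta>_def)

  have finS: "AE x in M. ?S x < \<infinity>"
  proof -
    have "modular ?S < \<infinity>" using S1 by (rule order.strict_trans1) simp
    then have "AE x in M. epowr (?S x) (p x) \<noteq> \<infinity>"
      unfolding modular_def by (intro nn_integral_PInf_AE) auto
    then show ?thesis by eventually_elim (auto simp: epowr_def less_top split: if_splits)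
  qed
  have finb: "AE x in M. energy f l (base f l) x \<noteq> \<infinity>"
    by (rule nn_integral_PInf_AE) (use integral_energy_base_le[OF f l] in \<open>auto simp: top_unique\<close>)
  have "AE x in M. energy f l (layer f l i) x \<noteq> \<infinity>" for i
  proof (rule nn_integral_PInf_AE)
    have "(\<integral>\<^sup>+x. energy f l (layer f l i) x \<partial>M) \<le> ennreal (4 * (2 ^ Suc i)\<^sup>2) * emeasure M (space M)"
    proof (rule integral_energy_le[OF f layer_sets(1) _ _ _ l])
      show "s_upto f k x \<le> ennreal (l * 2 ^ Suc i)" if "x \<in> layer f l i k" for k x
        using that le_divide_iff_ennreal[OF l, of "2 ^ Suc i" "s_upto f k x"] by (auto simp: layer_def)
    qed (auto simp: layer_def)
    then show "(\<integral>\<^sup>+x. energy f l (layer f l i) x \<partial>M) \<noteq> \<infinity>" by (auto simp: emeasure_space_1 top_unique)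
  qed simp
  then have finl: "AE x in M. \<forall>i. energy f l (layer f l i) x \<noteq> \<infinity>" by (simp add: AE_all_countable)

  let ?g = "\<lambda>i x. energy f l (layer f l i) x * ennreal (1 / 4 ^ i)"
  let ?h = "\<lambda>i x. lev i (p x) * ?g i x * indicator (above ?X (2 ^ i)) x"
  have "modular (\<lambda>x. run_sup f x / ennreal l)
    \<le> (\<integral>\<^sup>+x. ennreal (2 powr b) * ((1 + energy f l (base f l) x) + ennreal (D_geo \<eta> powr b) *
        ((\<Sum>i. ?h i x) + ennreal (D_geo (a / 2)) * epowr (?S x) (p x))) \<partial>M)"
    unfolding modular_def
  proof (rule nn_integral_mono_AE)
    show "AE x in M. epowr (run_sup f x / ennreal l) (p x) \<le> ennreal (2 powr b) * ((1 + energy f l (base f l) x)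
      + ennreal (D_geo \<eta> powr b) * ((\<Sum>i. ?h i x) + ennreal (D_geo (a / 2)) * epowr (?S x) (p x)))"
      using finS finb finl p_bounds AE_space
    proof eventually_elim
      case (elim x)
      show ?case unfolding above
      proof (rule layer_pointwise[OF b2 l])
        show "?S x = ennreal (enn2real (?S x))" "0 \<le> enn2real (?S x)" using elim by auto
        show "energy f l (base f l) x = ennreal (enn2real (energy f l (base f l) x))"
          "0 \<le> enn2real (energy f l (base f l) x)" using elim by (auto simp: less_top)
        show "energy f l (layer f l i) x = ennreal (enn2real (energy f l (layer f l i) x))"
          "0 \<le> enn2real (energy f l (layer f l i) x)" for i using elim by (auto simp: less_top)
      qed (use elim in auto)
    qed
  qed
  also have "\<dots> = ennreal (2 powr b) * ((1 + (\<integral>\<^sup>+x. energy f l (base f l) x \<partial>M)) + ennreal (D_geo \<eta> powr b) *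
        ((\<Sum>i. \<integral>\<^sup>+x. ?h i x \<partial>M) + ennreal (D_geo (a / 2)) * modular ?S))"
    unfolding modular_def by (simp add: nn_integral_cmult nn_integral_add nn_integral_suminf emeasure_space_1)
  also have "\<dots> \<le> ennreal (2 powr b) * ((1 + 4) + ennreal (D_geo \<eta> powr b) *
        (ennreal (16 * (C1 1 1 * C2 1)) + ennreal (D_geo (a / 2)) * 1))"
  proof (intro mult_left_mono add_mono order_refl S1 integral_energy_base_le[OF f l])
    have step: "(\<integral>\<^sup>+x. ?h i x \<partial>M) \<le> ennreal 16 * (ennreal (C1 1 1) * (\<integral>\<^sup>+x\<in>{x\<in>space M. ennreal (1 * 2 ^ i) < ?S x}. lev i (p x) \<partial>M))" for i
    proof -
      have "(\<integral>\<^sup>+x. ?h i x \<partial>M) \<le> (\<integral>\<^sup>+x\<in>above ?X (2 ^ i). (W ?X i x * ?g i x) \<partial>M)"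
        by (rule nn_integral_mono_AE) (use AE_lev_le_W in eventually_elim, auto intro!: mult_right_mono)
      also have "\<dots> \<le> (\<integral>\<^sup>+x\<in>above ?X (2 ^ i). (ennreal 16 * W ?X i x) \<partial>M)"
      proof (rule integral_passage_mono[OF Xm])
        fix n j
        define E where "E = passage ?X (2 ^ i) n \<inter> B n j"
        have EF: "E \<in> sets (F n)" unfolding E_def using passage_sets_F[OF Xm] B_sets by auto
        then have EM [measurable]: "E \<in> sets M" by (rule sets_F_M)
        have E: "E \<subseteq> passage ?X (2 ^ i) n \<inter> B n j" by (simp add: E_def)
        have Wc: "W ?X i x = lev i (hi n j)" if "x \<in> E" for x
          using that E passage_Least[of x ?X "2 ^ i" n] idx_eq[of x n j] by (auto simp: W_def Hi_def)
        have "(\<integral>\<^sup>+x\<in>E. (W ?X i x * ?g i x) \<partial>M)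
          = (\<integral>\<^sup>+x. (lev i (hi n j) * ennreal (1 / 4 ^ i)) * (energy f l (layer f l i) x * indicator E x) \<partial>M)"
          by (rule nn_integral_cong) (auto simp: Wc indicator_def mult_ac)
        also have "\<dots> = (lev i (hi n j) * ennreal (1 / 4 ^ i)) * (\<integral>\<^sup>+x\<in>E. energy f l (layer f l i) x \<partial>M)"
          by (rule nn_integral_cmult) measurable
        also have "\<dots> \<le> (lev i (hi n j) * ennreal (1 / 4 ^ i)) * (ennreal (16 * 4 ^ i) * emeasure M E)"
          by (intro mult_left_mono integral_energy_layer_le[OF f l EF]) (use E in auto)
        also have "\<dots> = lev i (hi n j) * ((ennreal (1 / 4 ^ i) * ennreal (16 * 4 ^ i)) * emeasure M E)"
          by (simp only: mult.assoc)
        also have "ennreal (1 / 4 ^ i) * ennreal (16 * 4 ^ i) = ennreal 16"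
          by (subst ennreal_mult[symmetric]) auto
        also have "lev i (hi n j) * (ennreal 16 * emeasure M E) = ennreal 16 * (\<integral>\<^sup>+x\<in>E. W ?X i x \<partial>M)"
          by (subst integral_W_passage[OF EM E]) (simp only: mult.left_commute)
        also have "\<dots> = (\<integral>\<^sup>+x\<in>E. (ennreal 16 * W ?X i x) \<partial>M)"
          by (subst nn_integral_cmult[symmetric]) (auto simp: mult.assoc)
        finally show "(\<integral>\<^sup>+x\<in>passage ?X (2 ^ i) n \<inter> B n j. (W ?X i x * ?g i x) \<partial>M)
          \<le> (\<integral>\<^sup>+x\<in>passage ?X (2 ^ i) n \<inter> B n j. (ennreal 16 * W ?X i x) \<partial>M)"
          unfolding E_def .
      qed measurable
      also have "\<dots> = ennreal 16 * (\<integral>\<^sup>+x\<in>above ?X (2 ^ i). W ?X i x \<partial>M)"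
        by (subst nn_integral_cmult[symmetric]) (auto simp: mult.assoc)
      also have "\<dots> \<le> ennreal 16 * (ennreal (C1 1 1) * (\<integral>\<^sup>+x\<in>{x\<in>space M. ennreal (1 * 2 ^ i) < ?S x}. lev i (p x) \<partial>M))"
      proof (intro mult_left_mono modular_SUP_le_of_local(2)[OF Xm _ S1])
        fix j n k E assume E: "E \<in> sets (F n)" "E \<subseteq> passage ?X (2 ^ j) n \<inter> B n k"
        have "E \<subseteq> {x\<in>space M. ennreal (1 * 2 ^ j) < ?S x}"
        proof
          fix x assume "x \<in> E"
          then have "x \<in> above ?X (2 ^ j)" using E above_eq_UN_passage[of ?X "2 ^ j"] by blast
          then show "x \<in> {x\<in>space M. ennreal (1 * 2 ^ j) < ?S x}" by (simp add: above)
        qed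
        then have "E \<inter> {x\<in>space M. ennreal (1 * 2 ^ j) < ?S x} = E" by blast
        then show "emeasure M E \<le> ennreal 1 * emeasure M (E \<inter> {x\<in>space M. ennreal (1 * 2 ^ j) < ?S x})"
          by simp
      qed auto
      finally show ?thesis .
    qed
    have "(\<Sum>i. \<integral>\<^sup>+x. ?h i x \<partial>M)
      \<le> (\<Sum>i. ennreal 16 * (ennreal (C1 1 1) * (\<integral>\<^sup>+x\<in>{x\<in>space M. ennreal (1 * 2 ^ i) < ?S x}. lev i (p x) \<partial>M)))"
      by (intro suminf_le step) auto
    also have "\<dots> = ennreal 16 * (ennreal (C1 1 1) * (\<Sum>i. \<integral>\<^sup>+x\<in>{x\<in>space M. ennreal (1 * 2 ^ i) < ?S x}. lev i (p x) \<partial>M))"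
      by (simp only: ennreal_suminf_cmult)
    also have "\<dots> \<le> ennreal 16 * (ennreal (C1 1 1) * (ennreal (C2 1) * modular ?S))"
      by (intro mult_left_mono levels_le_modular) auto
    also have "\<dots> \<le> ennreal 16 * (ennreal (C1 1 1) * (ennreal (C2 1) * 1))"
      by (intro mult_left_mono S1) auto
    also have "\<dots> = ennreal (16 * (C1 1 1 * C2 1))"
      using C1_nonneg[of 1 1] C2_nonneg[of 1] by (simp add: ennreal_mult)
    finally show "(\<Sum>i. \<integral>\<^sup>+x. ?h i x \<partial>M) \<le> ennreal (16 * (C1 1 1 * C2 1))" .
  qed auto
  also have "\<dots> = ennreal C_one"
  proof -
    have nn: "0 \<le> 16 * (C1 1 1 * C2 1)" "0 \<le> D_geo (a / 2)"
      using C1_nonneg[of 1 1] C2_nonneg[of 1] D_geo_ge_1[of "a / 2"] a_pos by simp_all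
    define u where "u = 16 * (C1 1 1 * C2 1)"
    define v where "v = D_geo \<eta> powr b"
    define w where "w = D_geo (a / 2)"
    have "0 \<le> u" "0 \<le> v" "0 \<le> w" using nn by (simp_all add: u_def v_def w_def)
    then have "ennreal (2 powr b * (5 + v * (u + w))) = ennreal (2 powr b) * (5 + ennreal v * (ennreal u + ennreal w))"
      by (simp add: ennreal_mult ennreal_plus del: distrib_left_numeral)
    moreover have "1 + 4 = (5::ennreal)" by simp
    ultimately show ?thesis
      unfolding C_one_def u_def[symmetric] v_def[symmetric] w_def[symmetric] by simp
  qed
  finally show "modular (\<lambda>x. run_sup f x / ennreal l) \<le> ennreal C_one" .
qed

lemma run_sup_le_cond_square:
  assumes "martingale M F f" "b < 2"
  shows "Lp_norm M p (run_sup f) \<le> ennreal (C_one powr (1 / a)) * Lp_norm M p (cond_square_fn M F f)"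
  by (rule Lp_norm_le_of_dominated[OF run_sup_dominated_of_cond_square[OF assms] C_one_ge_1[OF assms(2)] run_sup_measurable[OF assms(1)]])

end

section \<open>Regular filtrations\<close>

text \<open>The constant of regularity is taken to be at least 1.\<close>

locale regular_exponent = atomic_exponent M F p a b K B lo hi
  for M :: "'a measure" and F p a b K B lo hi +
  fixes R :: real
  assumes R: "1 \<le> R"
    and regular: "A \<in> sets (F (Suc n)) \<Longrightarrow> \<exists>C\<in>sets (F n). A \<subseteq> C \<and> measure M C \<le> R * measure M A"
begin

lemma measure_le_of_regular:
  assumes E: "E \<in> sets (F n)" "E \<subseteq> B n i" and A: "A \<in> sets (F (Suc n))" "A \<subseteq> E" "measure M A \<noteq> 0"
  shows "measure M E \<le> R * measure M A"
proof -
  obtain C where C: "C \<in> sets (F n)" "A \<subseteq> C" "measure M C \<le> R * measure M A"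
    using regular[OF A(1)] by blast
  have CM: "C \<in> sets M" "E \<in> sets M" using C E sets_F_M by auto
  have "measure M A \<le> measure M (C \<inter> E)"
    by (rule finite_measure_mono) (use C A CM in auto)
  then have "measure M (C \<inter> E) \<noteq> 0" using A(3) measure_nonneg[of M A] by linarith
  then have "measure M (C \<inter> E) = measure M (B n i)"
    using B_indivisible[of "C \<inter> E" n i] C E by auto
  moreover have "measure M E \<le> measure M (B n i)" using E by (intro finite_measure_mono) auto
  moreover have "measure M (C \<inter> E) \<le> measure M C" by (rule finite_measure_mono) (use CM in auto)
  ultimately show ?thesis using C by linarith
qed

text \<open>On an atom the conditional expectation is constant. Instead of this constant, rational numbers
  \<open>c1 < c2\<close> separating \<open>R E\<^sub>n u\<close> from \<open>u\<close> are used: if within the part \<open>E\<close> of an atom on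
  which \<open>R E\<^sub>n u \<le> c1\<close> the event \<open>u > c2\<close> were not null, it would have at least the proportion \<open>1 / R\<close> of \<open>E\<close>,
  and the integral of \<open>u\<close> over \<open>E\<close> would be too large.\<close>

lemma le_cond_exp_of_regular:
  assumes u: "u \<in> borel_measurable (F (Suc n))"
  shows "AE x in M. u x \<le> ennreal R * nn_cond_exp M (F n) u x"
proof -
  let ?g = "nn_cond_exp M (F n) u"
  have [measurable]: "u \<in> borel_measurable M" by (rule measurable_F_M[OF u])
  have gF [measurable]: "?g \<in> borel_measurable (F n)" "?g \<in> borel_measurable M" by measurable
  have "AE x in M. 0 \<le> c1 \<and> c1 < c2 \<longrightarrow> \<not> (x \<in> B n i \<and> ennreal R * ?g x \<le> ennreal c1 \<and> ennreal c2 < u x)"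
    for c1 c2 :: real and i
  proof (cases "0 \<le> c1 \<and> c1 < c2")
    case True
    define E where "E = B n i \<inter> {x\<in>space (F n). ennreal R * ?g x \<le> ennreal c1}"
    define A where "A = E \<inter> {x\<in>space (F (Suc n)). ennreal c2 < u x}"
    have EF: "E \<in> sets (F n)" unfolding E_def using B_sets by measurable
    have [measurable]: "E \<in> sets (F (Suc n))" by (rule sets_F_mono[OF EF]) simp
    have AF: "A \<in> sets (F (Suc n))" unfolding A_def using u by measurable
    have [measurable]: "E \<in> sets M" "A \<in> sets M" using EF AF sets_F_M by auto
    have "measure M A = 0"
    proof (rule ccontr)
      assume nz: "measure M A \<noteq> 0"
      have le: "measure M E \<le> R * measure M A"
        by (rule measure_le_of_regular[OF EF _ AF _ nz]) (auto simp: E_def A_def)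
      have "ennreal c2 * emeasure M A = (\<integral>\<^sup>+x. ennreal c2 * indicator A x \<partial>M)"
        by (simp add: nn_integral_cmult_indicator)
      also have "\<dots> \<le> (\<integral>\<^sup>+x. u x * indicator E x \<partial>M)"
        by (rule nn_integral_mono) (auto simp: A_def indicator_def)
      also have "\<dots> = (\<integral>\<^sup>+x. ?g x * indicator E x \<partial>M)"
        by (rule nn_cond_exp_indicator[OF EF, symmetric]) measurable
      finally have "ennreal R * (ennreal c2 * emeasure M A) \<le> ennreal R * (\<integral>\<^sup>+x. ?g x * indicator E x \<partial>M)"
        by (rule mult_left_mono) auto
      also have "\<dots> = (\<integral>\<^sup>+x. ennreal R * (?g x * indicator E x) \<partial>M)"
        by (rule nn_integral_cmult[symmetric]) measurable
      also have "\<dots> \<le> (\<integral>\<^sup>+x. ennreal c1 * indicator E x \<partial>M)"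
        by (rule nn_integral_mono) (auto simp: E_def indicator_def)
      also have "\<dots> = ennreal c1 * emeasure M E" by (simp add: nn_integral_cmult_indicator)
      finally have "ennreal (R * (c2 * measure M A)) \<le> ennreal (c1 * measure M E)"
        using True R by (simp add: emeasure_eq_measure ennreal_mult)
      then have "R * (c2 * measure M A) \<le> c1 * measure M E" using True by (subst (asm) ennreal_le_iff) auto
      also have "\<dots> \<le> c1 * (R * measure M A)" by (rule mult_left_mono[OF le]) (use True in auto)
      finally have "c2 * (R * measure M A) \<le> c1 * (R * measure M A)" by (simp add: mult_ac)
      moreover have "0 < R * measure M A" using R nz by (simp add: zero_less_measure_iff)
      ultimately show False using True mult_strict_right_mono[of c1 c2 "R * measure M A"] by linarith
    qed
    then have "AE x in M. x \<notin> A" by (intro AE_not_in_null) auto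
    then show ?thesis using AE_space by eventually_elim (auto simp: A_def E_def)
  qed auto
  note rat = this
  have "AE x in M. \<forall>(r1::rat) (r2::rat) i. 0 \<le> real_of_rat r1 \<and> real_of_rat r1 < real_of_rat r2 \<longrightarrow>
      \<not> (x \<in> B n i \<and> ennreal R * ?g x \<le> ennreal (real_of_rat r1) \<and> ennreal (real_of_rat r2) < u x)"
    unfolding AE_all_countable by (intro allI) (rule rat)
  then show ?thesis
    using AE_space
  proof eventually_elim
    case (elim x)
    show ?case
    proof (rule ccontr)
      assume "\<not> u x \<le> ennreal R * ?g x"
      then obtain r2 :: rat where r2: "ennreal R * ?g x < ennreal (real_of_rat r2)" "ennreal (real_of_rat r2) < u x"
        using ennreal_rat_dense[of "ennreal R * ?g x" "u x"] by (auto simp: not_le)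
      obtain r1 :: rat where r1: "ennreal R * ?g x < ennreal (real_of_rat r1)" "ennreal (real_of_rat r1) < ennreal (real_of_rat r2)"
        using ennreal_rat_dense[OF r2(1)] by auto
      have "real_of_rat r1 < real_of_rat r2"
        using r1(2) by (meson ennreal_leI leD not_le)
      moreover have "0 \<le> real_of_rat r1"
        using r1(1) by (metis ennreal_neg less_le not_less_zero linorder_not_le)
      ultimately show False
        using elim(1)[rule_format, of r1 r2 "idx n x"] in_B_idx[OF elim(2)] r1 r2 by auto
    qed
  qed
qed

definition C_pred :: real where "C_pred = C_reg R (1 / (2 * R)) powr (1 / a)"

definition C_hs :: real where "C_hs = (sqrt R powr b) powr (1 / a)"

text \<open>Under regularity \<open>\<bar>d\<^sub>k f\<bar>\<^sup>2 \<le> R \<bbbE>\<^sub>k\<^sub>-\<^sub>1 \<bar>d\<^sub>k f\<bar>\<^sup>2\<close>, so the predictable function \<open>s\<^sub>n(f)\<close> itself provides a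
  majorant.\<close>

lemma square_majorant_of_cond_square:
  assumes f: "martingale M F f" and fin: "Lp_norm M p (cond_square_fn M F f) < \<infinity>"
  obtains r where "r \<in> Lambda M F" "\<And>n. AE x in M. square_fn_upto f (Suc n) x \<le> r n x"
    "Lp_norm M p (lambda_inf r) \<le> ennreal C_hs * Lp_norm M p (cond_square_fn M F f)"
proof
  define \<theta> where "\<theta> k x = enn2real (ennreal (sqrt R) * s_upto f (Suc k) x)" for k x
  define r where "r = (\<lambda>n x. Max ((\<lambda>k. \<theta> k x) ` {..n}))"
  have \<theta>m: "\<theta> k \<in> borel_measurable (F k)" for k
    unfolding \<theta>_def[abs_def] using s_upto_measurable[of f k] by measurable
  have \<theta>0: "0 \<le> \<theta> k x" for k x by (simp add: \<theta>_def)
  note L = lambda_Max[OF \<theta>m \<theta>0 r_def]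
  show r: "r \<in> Lambda M F" by (rule L(1))
  have Sm [measurable]: "cond_square_fn M F f \<in> borel_measurable M" by (rule cond_square_fn_measurable)
  have s_upto_le: "s_upto f (Suc k) x \<le> cond_square_fn M F f x" for k x
    unfolding s_upto_Suc_SUP[symmetric] by (rule SUP_upper) simp
  have "AE x in M. ennreal ((mdiff f k x)\<^sup>2) \<le> ennreal R * csq f k x" for k
  proof (cases k)
    case 0
    show ?thesis using csq_0[OF f]
    proof eventually_elim
      case (elim x)
      have "1 * csq f k x \<le> ennreal R * csq f k x"
        using R by (intro mult_right_mono) auto
      then show ?case using elim 0 by simp
    qed
  next
    case (Suc n)
    have "(\<lambda>y. ennreal (\<bar>mdiff f k y\<bar>\<^sup>2)) \<in> borel_measurable (F (Suc n))"
    proof -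
      have [measurable]: "mdiff f k \<in> borel_measurable (F (Suc n))" using mdiff_measurable(1)[OF f, of k] Suc by simp
      show ?thesis by measurable
    qed
    from le_cond_exp_of_regular[OF this] show ?thesis by (simp add: csq_def Suc)
  qed
  then have "AE x in M. \<forall>k. ennreal ((mdiff f k x)\<^sup>2) \<le> ennreal R * csq f k x"
    by (simp add: AE_all_countable)
  then show "AE x in M. square_fn_upto f (Suc n) x \<le> r n x" for n
    using AE_finite_of_Lp_norm[OF Sm fin]
  proof eventually_elim
    case (elim x)
    have "s_upto f (Suc n) x < \<infinity>" using s_upto_le elim(2) by (rule le_less_trans)
    then obtain c where c: "s_upto f (Suc n) x = ennreal c" "0 \<le> c"
      by (cases "s_upto f (Suc n) x") auto
    then have "(\<Sum>k\<le>Suc n. csq f k x) \<le> ennreal (c\<^sup>2)"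
      using epowr_half_le[of c "\<Sum>k\<le>Suc n. csq f k x"] by (simp add: s_upto_def del: sum.atMost_Suc)
    have "ennreal (\<Sum>k\<le>Suc n. (mdiff f k x)\<^sup>2) = (\<Sum>k\<le>Suc n. ennreal ((mdiff f k x)\<^sup>2))"
      by (rule sum_ennreal[symmetric]) auto
    also have "\<dots> \<le> (\<Sum>k\<le>Suc n. ennreal R * csq f k x)" using elim by (intro sum_mono) auto
    also have "\<dots> = ennreal R * (\<Sum>k\<le>Suc n. csq f k x)" by (rule sum_distrib_left[symmetric])
    also have "\<dots> \<le> ennreal R * ennreal (c\<^sup>2)" by (rule mult_left_mono) (fact, simp)
    also have "\<dots> = ennreal (R * c\<^sup>2)" using R by (simp add: ennreal_mult)
    finally have "(\<Sum>k\<le>Suc n. (mdiff f k x)\<^sup>2) \<le> R * c\<^sup>2"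
      using R by (subst (asm) ennreal_le_iff) auto
    then have "square_fn_upto f (Suc n) x \<le> sqrt (R * c\<^sup>2)"
      unfolding square_fn_upto_def by (simp del: sum.atMost_Suc)
    also have "\<dots> = \<theta> n x" using c R by (simp add: \<theta>_def ennreal_mult[symmetric] real_sqrt_mult)
    also have "\<dots> \<le> r n x" by (rule L(2))
    finally show ?case .
  qed
  have "AE x in M. lambda_inf r x \<le> ennreal (sqrt R) * cond_square_fn M F f x"
  proof (rule AE_I2, rule L(4))
    fix x k
    have "ennreal (\<theta> k x) \<le> ennreal (sqrt R) * s_upto f (Suc k) x"
      unfolding \<theta>_def by (cases "ennreal (sqrt R) * s_upto f (Suc k) x") auto
    also have "\<dots> \<le> ennreal (sqrt R) * cond_square_fn M F f x"
      by (intro mult_left_mono s_upto_le) auto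
    finally show "ennreal (\<theta> k x) \<le> ennreal (sqrt R) * cond_square_fn M F f x" .
  qed
  moreover have "dominated (sqrt R powr b * 1) (\<lambda>x. ennreal (sqrt R) * cond_square_fn M F f x) (cond_square_fn M F f)"
    by (rule dominated_cmult[OF dominated_refl]) (use R in auto)
  ultimately have "dominated (sqrt R powr b) (lambda_inf r) (cond_square_fn M F f)"
    using dominated_mono by simp
  then show "Lp_norm M p (lambda_inf r) \<le> ennreal C_hs * Lp_norm M p (cond_square_fn M F f)"
    unfolding C_hs_def
    by (rule Lp_norm_le_of_dominated) (use R b_pos lambda_inf_measurable[OF r] in \<open>auto intro: ge_one_powr_ge_zero\<close>)
qed

end

locale regular_path = path_exponent M F p a b K B lo hi q + regular_exponent M F p a b K B lo hi R
  for M :: "'a measure" and F p a b K B lo hi q R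
begin

text \<open>The majorant is the running maximum of \<open>R E\<^sub>n u\<^sub>n\<^sub>+\<^sub>1\<close>, where \<open>u\<^sub>n\<close> is the path functional up to time \<open>n\<close>. Where
  it passes \<open>t\<close>, the function \<open>u\<^sub>n\<^sub>+\<^sub>1\<close> exceeds \<open>t / (2 R)\<close> on a non-null part of the atom, which by regularity is a
  fixed proportion of it.\<close>

lemma majorant_of_run_sup:
  assumes f: "martingale M F f"
  obtains r where "r \<in> Lambda M F" "\<And>n. AE x in M. run f (Suc n) x \<le> r n x"
    "Lp_norm M p (lambda_inf r) \<le> ennreal C_pred * Lp_norm M p (run_sup f)"
proof
  let ?u = "\<lambda>k x. ennreal (run f k x)"
  define g where "g k = nn_cond_exp M (F k) (?u (Suc k))" for k
  define \<theta> where "\<theta> k x = enn2real (ennreal R * g k x)" for k x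
  define r where "r = (\<lambda>n x. Max ((\<lambda>k. \<theta> k x) ` {..n}))"
  have uF: "?u k \<in> borel_measurable (F k)" for k using run_measurable[OF f, of k] by measurable
  have um [measurable]: "?u k \<in> borel_measurable M" for k by (rule measurable_F_M[OF uF])
  have gF: "g k \<in> borel_measurable (F k)" for k unfolding g_def by measurable
  have gM [measurable]: "g k \<in> borel_measurable M" for k by (rule measurable_F_M[OF gF])
  have \<theta>m: "\<theta> k \<in> borel_measurable (F k)" for k
    unfolding \<theta>_def[abs_def] using gF[of k] by measurable
  have \<theta>0: "0 \<le> \<theta> k x" for k x by (simp add: \<theta>_def)
  note L = lambda_Max[OF \<theta>m \<theta>0 r_def]
  show r: "r \<in> Lambda M F" by (rule L(1))
  show "AE x in M. run f (Suc n) x \<le> r n x" for n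
  proof -
    have "(\<integral>\<^sup>+x. g n x * indicator (space M) x \<partial>M) = (\<integral>\<^sup>+x. ?u (Suc n) x * indicator (space M) x \<partial>M)"
      unfolding g_def by (rule nn_cond_exp_indicator) (auto simp: space_F[of n, symmetric] simp del: space_F)
    also have "\<dots> \<le> (\<integral>\<^sup>+x. ennreal (norm (\<Sum>k\<le>Suc n. \<bar>mdiff f k x\<bar>)) \<partial>M)"
    proof (rule nn_integral_mono)
      fix x
      have "run f (Suc n) x \<le> norm (\<Sum>k\<le>Suc n. \<bar>mdiff f k x\<bar>)"
        using q_le_sum[of "Suc n" "\<lambda>k. mdiff f k x"] unfolding run_def real_norm_def by linarith
      then show "?u (Suc n) x * indicator (space M) x \<le> ennreal (norm (\<Sum>k\<le>Suc n. \<bar>mdiff f k x\<bar>))"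
        by (auto simp: indicator_def simp del: sum.atMost_Suc intro!: ennreal_leI)
    qed
    also have "\<dots> < \<infinity>"
    proof -
      have "integrable M (\<lambda>x. \<Sum>k\<le>Suc n. \<bar>mdiff f k x\<bar>)"
        using mdiff_measurable(2)[OF f] by (intro Bochner_Integration.integrable_sum integrable_abs) auto
      then show ?thesis by (simp add: integrable_iff_bounded)
    qed
    finally have "(\<integral>\<^sup>+x. g n x \<partial>M) < \<infinity>"
      by (subst (asm) nn_integral_cong[where v = "g n"]) auto
    then have "AE x in M. g n x \<noteq> \<infinity>" by (intro nn_integral_PInf_AE) auto
    moreover have "AE x in M. ?u (Suc n) x \<le> ennreal R * g n x"
      unfolding g_def by (rule le_cond_exp_of_regular[OF uF])
    ultimately show ?thesis
    proof eventually_elim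
      case (elim x)
      then obtain c where c: "g n x = ennreal c" "0 \<le> c" by (cases "g n x") auto
      then have "?u (Suc n) x \<le> ennreal (R * c)" using elim R by (simp add: ennreal_mult)
      then have "run f (Suc n) x \<le> R * c" using c R by simp
      also have "\<dots> = \<theta> n x" using c R by (simp add: \<theta>_def ennreal_mult[symmetric])
      also have "\<dots> \<le> r n x" by (rule L(2))
      finally show ?case .
    qed
  qed
  let ?X = "\<lambda>n x. ennreal (r n x)"
  have Xm: "?X n \<in> borel_measurable (F n)" for n using LambdaD(1)[OF r, of n] by measurable
  have "dominated (C_reg R (1 / (2 * R))) (\<lambda>x. SUP n. ?X n x) (run_sup f)"
  proof (rule dominated_of_local[OF Xm run_sup_measurable[OF f]])
    fix t :: real and n i E
    assume t: "0 < t" and E: "E \<in> sets (F n)" "E \<subseteq> passage ?X t n \<inter> B n i"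
    have [measurable]: "E \<in> sets M" using E sets_F_M by auto
    have [measurable]: "E \<in> sets (F (Suc n))" by (rule sets_F_mono[OF E(1)]) simp
    have big: "ennreal t \<le> ennreal R * g n x" if "x \<in> E" for x
    proof -
      have x: "t < r n x" "\<forall>k<n. r k x \<le> t"
        using that E t by (auto simp: passage_def ennreal_less_iff)
      then obtain k where k: "k \<le> n" "t < \<theta> k x" using L(3) by blast
      then have "k = n" using x(2) L(2)[of k x] by (cases "k < n") force+
      then have "t < \<theta> n x" using k by simp
      then have "ennreal t \<le> ennreal (\<theta> n x)" by (intro ennreal_leI) simp
      also have "\<dots> \<le> ennreal R * g n x"
        unfolding \<theta>_def by (cases "ennreal R * g n x") auto
      finally show ?thesis .
    qed
    define A where "A = E \<inter> {x\<in>space (F (Suc n)). ennreal (1 / (2 * R) * t) < ?u (Suc n) x}"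
    have AF: "A \<in> sets (F (Suc n))" unfolding A_def using uF[of "Suc n"] by measurable
    then have [measurable]: "A \<in> sets M" by (rule sets_F_M)
    have "measure M E \<le> R * measure M A"
    proof (cases "measure M A = 0")
      case False
      then show ?thesis by (intro measure_le_of_regular[OF E(1) _ AF]) (use E in \<open>auto simp: A_def\<close>)
    next
      case True
      then have nA: "AE x in M. x \<notin> A" by (intro AE_not_in_null) auto
      have "ennreal t * emeasure M E = (\<integral>\<^sup>+x. ennreal t * indicator E x \<partial>M)"
        by (simp add: nn_integral_cmult_indicator)
      also have "\<dots> \<le> (\<integral>\<^sup>+x. ennreal R * (g n x * indicator E x) \<partial>M)"
        by (rule nn_integral_mono) (use big in \<open>auto simp: indicator_def\<close>)
      also have "\<dots> = ennreal R * (\<integral>\<^sup>+x. g n x * indicator E x \<partial>M)"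
        by (rule nn_integral_cmult) measurable
      also have "(\<integral>\<^sup>+x. g n x * indicator E x \<partial>M) = (\<integral>\<^sup>+x. ?u (Suc n) x * indicator E x \<partial>M)"
        unfolding g_def by (rule nn_cond_exp_indicator[OF E(1)]) measurable
      also have "\<dots> \<le> (\<integral>\<^sup>+x. ennreal (1 / (2 * R) * t) * indicator E x \<partial>M)"
      proof (rule nn_integral_mono_AE)
        show "AE x in M. ?u (Suc n) x * indicator E x \<le> ennreal (1 / (2 * R) * t) * indicator E x"
          using nA AE_space by eventually_elim (auto simp: A_def indicator_def not_less)
      qed
      also have "\<dots> = ennreal (1 / (2 * R) * t) * emeasure M E"
        by (simp add: nn_integral_cmult_indicator)
      finally have "ennreal t * ennreal (measure M E) \<le> ennreal R * (ennreal (1 / (2 * R) * t) * ennreal (measure M E))"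
        by (simp add: emeasure_eq_measure mult_left_mono)
      then have "ennreal (t * measure M E) \<le> ennreal (R * (1 / (2 * R) * t * measure M E))"
        unfolding mult.assoc[of "1 / (2 * R) * t"]
      proof -
        have "ennreal (t * m) \<le> ennreal (R * (w * m))"
          if "ennreal t * ennreal m \<le> ennreal R * (ennreal w * ennreal m)" "0 \<le> m" "0 \<le> w" for m w :: real
          using that t R by (simp add: ennreal_mult)
        from this[OF \<open>ennreal t * ennreal (measure M E) \<le> _\<close>] show ?thesis
          using t R by simp
      qed
      then have "t * measure M E \<le> R * (1 / (2 * R) * t * measure M E)"
        using t R by (subst (asm) ennreal_le_iff) auto
      then have "t * measure M E \<le> t * measure M E / 2" using R by simp
      then have "measure M E = 0" using t by (simp add: measure_le_0_iff)
      then show ?thesis using True by simp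
    qed
    also have "R * measure M A \<le> R * measure M (E \<inter> {x\<in>space M. ennreal (1 / (2 * R) * t) < run_sup f x})"
    proof (intro mult_left_mono finite_measure_mono)
      have "?u (Suc n) x \<le> run_sup f x" for x unfolding run_sup_def by (rule SUP_upper) simp
      then show "A \<subseteq> E \<inter> {x\<in>space M. ennreal (1 / (2 * R) * t) < run_sup f x}"
        by (auto simp: A_def intro: less_le_trans)
    qed (use R run_sup_measurable[OF f] in auto)
    finally have "ennreal (measure M E) \<le> ennreal (R * measure M (E \<inter> {x\<in>space M. ennreal (1 / (2 * R) * t) < run_sup f x}))"
      by (rule ennreal_leI)
    then show "emeasure M E \<le> ennreal R * emeasure M (E \<inter> {x\<in>space M. ennreal (1 / (2 * R) * t) < run_sup f x})"
      using R by (simp add: emeasure_eq_measure ennreal_mult)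
  qed (use R in auto)
  moreover have "AE x in M. lambda_inf r x \<le> (SUP n. ?X n x)"
    by (rule AE_I2) (simp add: lambda_inf_eq[OF r])
  ultimately have "dominated (C_reg R (1 / (2 * R))) (lambda_inf r) (run_sup f)" by (rule dominated_mono)
  then show "Lp_norm M p (lambda_inf r) \<le> ennreal C_pred * Lp_norm M p (run_sup f)"
    unfolding C_pred_def
    by (rule Lp_norm_le_of_dominated) (use R C_reg_ge_1[of R] lambda_inf_measurable[OF r] in auto)
qed

end

section \<open>Martingale Hardy spaces\<close>

text \<open>A countable family of generating atoms is made disjoint. The set \<open>N\<close> left uncovered is added: every
  measurable set contains \<open>N\<close> or is disjoint from it, so \<open>N\<close> is itself an atom unless it is a null set.\<close>

lemma (in prob_space) exists_indivisible_partition: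
  assumes sub: "subalgebra M G" and gen: "generated_by_countably_many_atoms M G"
  obtains B :: "nat \<Rightarrow> 'a set" where "\<And>i. B i \<in> sets G" "disjoint_family B" "(\<Union>i. B i) = space M"
    "\<And>i A. A \<in> sets G \<Longrightarrow> A \<subseteq> B i \<Longrightarrow> measure M A = 0 \<or> measure M A = measure M (B i)"
proof -
  obtain \<A> where A: "countable \<A>" "\<And>A. A \<in> \<A> \<Longrightarrow> is_atom M G A" "sets G = sigma_sets (space M) \<A>"
    using gen by (auto simp: generated_by_countably_many_atoms_def)
  have spG: "space G = space M" using sub by (simp add: subalgebra_def)
  have GM: "X \<in> sets M" if "X \<in> sets G" for X using sub that by (auto simp: subalgebra_def)
  define E where "E = from_nat_into (insert {} \<A>)"
  have rE: "range E = insert {} \<A>" unfolding E_def using A(1) by (intro range_from_nat_into) auto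
  have EG: "E i \<in> sets G" for i
    using rE A(2) by (metis insert_iff is_atom_def rangeI sets.empty_sets)
  define N where "N = space M - (\<Union>i. E i)"
  have NG: "N \<in> sets G" unfolding N_def spG[symmetric] using EG by auto
  have N: "X \<inter> N = {} \<or> N \<subseteq> X" if "X \<in> sigma_sets (space M) \<A>" for X
    using that
  proof (induction rule: sigma_sets.induct)
    case (Basic X)
    then have "X \<in> range E" using rE by simp
    then have "X \<inter> N = {}" by (auto simp: N_def)
    then show ?case by simp
  next
    case (Compl X)
    then show ?case by (auto simp: N_def)
  qed auto
  define B where "B i = (case i of 0 \<Rightarrow> N | Suc j \<Rightarrow> disjointed E j)" for i
  show ?thesis
  proof
    show "B i \<in> sets G" for i
      using NG sets.range_disjointed_sets[of E G] EG by (auto simp: B_def split: nat.split)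
    show "disjoint_family B"
      unfolding disjoint_family_on_def
    proof (intro ballI impI)
      fix i j :: nat assume "i \<noteq> j"
      have *: "N \<inter> disjointed E k = {}" for k using disjointed_subset[of E k] by (auto simp: N_def)
      show "B i \<inter> B j = {}"
        using \<open>i \<noteq> j\<close> * disjoint_family_disjointed[of E]
        by (cases i; cases j) (auto simp: B_def disjoint_family_on_def)
    qed
    show "(\<Union>i. B i) = space M"
    proof -
      have "(\<Union>i. B i) = N \<union> (\<Union>j. disjointed E j)"
        by (auto simp: B_def split: nat.splits)
      also have "\<dots> = space M"
        unfolding UN_disjointed_eq N_def using sets.sets_into_space[OF EG] spG by auto
      finally show ?thesis .
    qed
    fix i X assume X: "X \<in> sets G" "X \<subseteq> B i"
    show "measure M X = 0 \<or> measure M X = measure M (B i)"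
    proof (cases i)
      case 0
      then have "X \<subseteq> N" using X by (simp add: B_def)
      then have "X = {} \<or> X = N" using N[of X] X A(3) by auto
      then show ?thesis using 0 by (auto simp: B_def)
    next
      case (Suc j)
      then have XE: "X \<subseteq> disjointed E j" "disjointed E j \<subseteq> E j"
        using X disjointed_subset[of E j] by (auto simp: B_def)
      have dG: "disjointed E j \<in> sets G" using sets.range_disjointed_sets[of E G] EG by auto
      show ?thesis
      proof (cases "E j = {}")
        case True
        then show ?thesis using XE by simp
      next
        case False
        then have "E j \<in> \<A>" using rE by (metis insertE rangeI)
        then have at: "is_atom M G (E j)" by (rule A(2))
        have le: "measure M X \<le> measure M (disjointed E j)" "measure M (disjointed E j) \<le> measure M (E j)"
          using XE GM[OF X(1)] GM[OF dG] GM[OF EG[of j]] by (auto intro!: finite_measure_mono)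
        show ?thesis
        proof (cases "measure M X < measure M (E j)")
          case True
          then show ?thesis using at X XE by (auto simp: is_atom_def)
        next
          case False
          then show ?thesis using le Suc by (simp add: B_def)
        qed
      qed
    qed
  qed
qed

lemma AE_le_p_plus:
  assumes "A \<in> sets M" "p \<in> borel_measurable M"
  shows "AE x in M. x \<in> A \<longrightarrow> ereal (p x) \<le> p_plus M p A"
proof -
  have "AE x in restrict_space M A. ereal (p x) \<le> p_plus M p A"
    unfolding p_plus_def by (rule esssup_AE)
  then show ?thesis using assms by (subst (asm) AE_restrict_space_iff) auto
qed

lemma AE_p_minus_le:
  assumes "A \<in> sets M" "p \<in> borel_measurable M"
  shows "AE x in M. x \<in> A \<longrightarrow> p_minus M p A \<le> ereal (p x)"
proof -
  have "AE x in restrict_space M A. - ereal (p x) \<le> - p_minus M p A"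
    unfolding p_minus_def ereal_uminus_uminus by (rule esssup_AE)
  then have "AE x in restrict_space M A. p_minus M p A \<le> ereal (p x)"
    by (simp only: ereal_minus_le_minus)
  then show ?thesis using assms by (subst (asm) AE_restrict_space_iff) auto
qed

lemma p_plus_leI:
  assumes "A \<in> sets M" "p \<in> borel_measurable M" "AE x in M. x \<in> A \<longrightarrow> p x \<le> c"
  shows "p_plus M p A \<le> ereal c"
proof -
  have "(\<lambda>x. ereal (p x)) \<in> borel_measurable (restrict_space M A)"
    using assms by (intro measurable_restrict_space1) auto
  moreover have "AE x in restrict_space M A. ereal (p x) \<le> ereal c"
    using assms by (subst AE_restrict_space_iff) auto
  ultimately show ?thesis unfolding p_plus_def by (rule esssup_I)
qed

lemma p_minus_geI:
  assumes "A \<in> sets M" "p \<in> borel_measurable M" "AE x in M. x \<in> A \<longrightarrow> c \<le> p x"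
  shows "ereal c \<le> p_minus M p A"
proof -
  have "(\<lambda>x. - ereal (p x)) \<in> borel_measurable (restrict_space M A)"
    using assms by (intro measurable_restrict_space1) auto
  moreover have "AE x in restrict_space M A. - ereal (p x) \<le> - ereal c"
    using assms by (subst AE_restrict_space_iff) auto
  ultimately have "esssup (restrict_space M A) (\<lambda>x. - ereal (p x)) \<le> - ereal c" by (rule esssup_I)
  then have "- (- ereal c) \<le> - esssup (restrict_space M A) (\<lambda>x. - ereal (p x))"
    by (simp only: ereal_minus_le_minus)
  then show ?thesis by (simp add: p_minus_def)
qed

lemma equivalent_onI:
  assumes "0 < A" "0 < C" and "\<And>f. f \<in> X \<Longrightarrow> N f \<le> ennreal A * N' f" "\<And>f. f \<in> X \<Longrightarrow> N' f \<le> ennreal C * N f"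
  shows "equivalent_on X N N'"
  unfolding equivalent_on_def
proof (rule exI[of _ "1 / A"], rule exI[of _ C], intro conjI ballI)
  fix f assume f: "f \<in> X"
  have "ennreal (1 / A) * N f \<le> ennreal (1 / A) * (ennreal A * N' f)"
    by (intro mult_left_mono assms f) auto
  also have "\<dots> = N' f" using assms by (simp add: mult.assoc[symmetric] ennreal_mult[symmetric])
  finally show "ennreal (1 / A) * N f \<le> N' f" .
qed (use assms in auto)

lemma (in filtered_prob) maximal_fn_eq: "maximal_fn f x = (SUP n. ennreal (run_max n (\<lambda>k. mdiff f k x)))"
  unfolding maximal_fn_def
proof (intro antisym SUP_least)
  fix n
  have "\<bar>f n x\<bar> \<le> run_max n (\<lambda>k. mdiff f k x)"
    using run_max_ge[of n n "\<lambda>k. mdiff f k x"] by (simp add: sum_mdiff)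
  then show "ennreal \<bar>f n x\<bar> \<le> (SUP n. ennreal (run_max n (\<lambda>k. mdiff f k x)))"
    by (intro SUP_upper2[of n] ennreal_leI) auto
next
  fix n
  have "run_max n (\<lambda>k. mdiff f k x) \<in> (\<lambda>j. \<bar>\<Sum>k\<le>j. mdiff f k x\<bar>) ` {..n}"
    unfolding run_max_def by (rule Max_in) auto
  then obtain j where "run_max n (\<lambda>k. mdiff f k x) = \<bar>f j x\<bar>" by (auto simp: sum_mdiff)
  then show "ennreal (run_max n (\<lambda>k. mdiff f k x)) \<le> (SUP n. ennreal \<bar>f n x\<bar>)"
    by (auto intro: SUP_upper2)
qed

lemma (in filtered_prob) square_fn_eq: "square_fn f x = (SUP n. ennreal (run_sq n (\<lambda>k. mdiff f k x)))"
  unfolding square_fn_def square_fn_upto_eq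
  by (rule limI, rule LIMSEQ_SUP) (auto intro!: incseq_SucI ennreal_leI simp: run_sq_def)

context atomic_exponent
begin

text \<open>The two path functionals that matter: the running maximum and the running square function.\<close>

sublocale mx: path_exponent M F p a b K B lo hi run_max
  by (intro path_exponent.intro path_functional_run_max) unfold_locales

sublocale sq: path_exponent M F p a b K B lo hi run_sq
  by (intro path_exponent.intro path_functional_run_sq) unfold_locales

lemma HM_norm_eq: "HM_norm M p f = Lp_norm M p (mx.run_sup f)"
  by (simp add: HM_norm_def maximal_fn_eq[abs_def] mx.run_sup_def[abs_def] mx.run_def)

lemma HS_norm_eq: "HS_norm M p f = Lp_norm M p (sq.run_sup f)"
  by (simp add: HS_norm_def square_fn_eq[abs_def] sq.run_sup_def[abs_def] sq.run_def)

lemma C_norm_pos: "0 < C_norm"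
  using C_good_ge_1[of \<delta>] by (simp add: C_norm_def)

lemma C_maj_pos: "0 < C_maj"
proof -
  have "0 < 2 powr b * (C_good \<delta> + 2 powr b)"
    using C_good_ge_1[of \<delta>] by (intro mult_pos_pos add_pos_pos) auto
  then show ?thesis unfolding C_maj_def by (subst powr_gt_zero) (rule less_imp_neq[symmetric])
qed

lemma P_majorantsI:
  assumes "r \<in> Lambda M F" "\<And>n. AE x in M. mx.run f (Suc n) x \<le> r n x" "Lp_norm M p (lambda_inf r) < \<infinity>"
  shows "r \<in> P_majorants M F p f"
  unfolding P_majorants_def
proof (intro CollectI conjI allI impI)
  show "lambda_inf r \<in> Lp_space M p"
    using assms lambda_inf_measurable by (simp add: Lp_space_def)
  fix n :: nat assume "1 \<le> n"
  then obtain m where m: "n = Suc m" by (cases n) auto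
  show "AE x in M. \<bar>f n x\<bar> \<le> r (n - 1) x"
    using assms(2)[of m]
  proof eventually_elim
    case (elim x)
    have "\<bar>f n x\<bar> \<le> mx.run f n x"
      using run_max_ge[of n n "\<lambda>k. mdiff f k x"] by (simp add: sum_mdiff mx.run_def)
    then show ?case using elim m by simp
  qed
qed (fact assms)

lemma Q_majorantsI:
  assumes "r \<in> Lambda M F" "\<And>n. AE x in M. square_fn_upto f (Suc n) x \<le> r n x" "Lp_norm M p (lambda_inf r) < \<infinity>"
  shows "r \<in> Q_majorants M F p f"
  unfolding Q_majorants_def
proof (intro CollectI conjI allI impI)
  show "lambda_inf r \<in> Lp_space M p"
    using assms lambda_inf_measurable by (simp add: Lp_space_def)
  fix n :: nat assume "1 \<le> n"
  then obtain m where "n = Suc m" by (cases n) auto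
  then show "AE x in M. square_fn_upto f n x \<le> r (n - 1) x" using assms(2)[of m] by simp
qed (fact assms)

lemma P_norm_le:
  assumes "r \<in> P_majorants M F p f" "Lp_norm M p (lambda_inf r) \<le> z"
  shows "P_norm M F p f \<le> z"
  unfolding P_norm_def by (rule order_trans[OF _ assms(2)], rule INF_lower[OF assms(1)])

lemma Q_norm_le:
  assumes "r \<in> Q_majorants M F p f" "Lp_norm M p (lambda_inf r) \<le> z"
  shows "Q_norm M F p f \<le> z"
  unfolding Q_norm_def by (rule order_trans[OF _ assms(2)], rule INF_lower[OF assms(1)])

lemma majorant_finite:
  "l \<in> P_majorants M F p f \<Longrightarrow> Lp_norm M p (lambda_inf l) < \<infinity>"
  "l \<in> Q_majorants M F p f \<Longrightarrow> Lp_norm M p (lambda_inf l) < \<infinity>"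
  by (auto simp: P_majorants_def Q_majorants_def Lp_space_def)

lemma HM_le_P:
  assumes f: "f \<in> P_space M F p"
  shows "HM_norm M p f \<le> P_norm M F p f"
  unfolding P_norm_def
proof (rule INF_greatest)
  fix l assume l: "l \<in> P_majorants M F p f"
  then have lL: "l \<in> Lambda M F" by (simp add: P_majorants_def)
  have "martingale M F f" using f by (simp add: P_space_def)
  note P_majorant_bound[OF this l]
  then have "AE x in M. maximal_fn f x \<le> lambda_inf l x"
    using AE_space
  proof eventually_elim
    case (elim x)
    show ?case unfolding maximal_fn_def lambda_inf_eq[OF lL elim(2)]
      using elim by (intro SUP_mono') (auto intro!: ennreal_leI)
  qed
  then show "HM_norm M p f \<le> Lp_norm M p (lambda_inf l)"
    unfolding HM_norm_def by (rule Lp_norm_mono_AE)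
qed

lemma HS_le_Q:
  assumes f: "f \<in> Q_space M F p"
  shows "HS_norm M p f \<le> Q_norm M F p f"
  unfolding Q_norm_def
proof (rule INF_greatest)
  fix l assume l: "l \<in> Q_majorants M F p f"
  then have lL: "l \<in> Lambda M F" by (simp add: Q_majorants_def)
  have "AE x in M. square_fn f x \<le> lambda_inf l x"
    using Q_majorant_bound[OF l] AE_space
  proof eventually_elim
    case (elim x)
    show ?case unfolding square_fn_eq lambda_inf_eq[OF lL elim(2)]
    proof (rule SUP_mono')
      fix n
      have "run_sq n (\<lambda>k. mdiff f k x) \<le> run_sq (Suc n) (\<lambda>k. mdiff f k x)" by (rule sq.q_le_Suc)
      also have "\<dots> \<le> l n x" using elim by blast
      finally show "ennreal (run_sq n (\<lambda>k. mdiff f k x)) \<le> ennreal (l n x)" by (rule ennreal_leI)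
    qed
  qed
  then show "HS_norm M p f \<le> Lp_norm M p (lambda_inf l)"
    unfolding HS_norm_def by (rule Lp_norm_mono_AE)
qed

lemma P_bounds:
  assumes f: "f \<in> P_space M F p"
  shows "HS_norm M p f \<le> ennreal C_norm * P_norm M F p f"
    and "Hs_norm M F p f \<le> ennreal C_norm * P_norm M F p f"
    and "Q_norm M F p f \<le> ennreal C_maj * P_norm M F p f"
    and "f \<in> Q_space M F p"
proof -
  have m: "martingale M F f" and ne: "P_majorants M F p f \<noteq> {}" using f by (auto simp: P_space_def)
  note ctrl = controls_of_P_majorant[OF m]
  show "HS_norm M p f \<le> ennreal C_norm * P_norm M F p f"
    unfolding P_norm_def HS_norm_eq
    by (rule le_mult_INF_ennreal[OF C_norm_pos]) (rule sq.run_sup_le_of_controls[OF ctrl])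
  show "Hs_norm M F p f \<le> ennreal C_norm * P_norm M F p f"
    unfolding P_norm_def Hs_norm_def
    by (rule le_mult_INF_ennreal[OF C_norm_pos]) (rule cond_square_le_of_controls[OF ctrl])
  have *: "\<exists>r\<in>Q_majorants M F p f. Lp_norm M p (lambda_inf r) \<le> ennreal C_maj * Lp_norm M p (lambda_inf l)"
    if l: "l \<in> P_majorants M F p f" for l
  proof -
    obtain r where r: "r \<in> Lambda M F" "\<And>n. AE x in M. sq.run f (Suc n) x \<le> r n x"
      "Lp_norm M p (lambda_inf r) \<le> ennreal C_maj * Lp_norm M p (lambda_inf l)"
      using sq.majorant_of_controls[OF ctrl[OF l]] by blast
    have "Lp_norm M p (lambda_inf r) < \<infinity>"
      using r(3) majorant_finite(1)[OF l] by (auto simp: ennreal_mult_less_top intro: le_less_trans)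
    then have "r \<in> Q_majorants M F p f"
      using r(1,2) by (intro Q_majorantsI) (auto simp: sq.run_def square_fn_upto_eq)
    then show ?thesis using r(3) by blast
  qed
  show "Q_norm M F p f \<le> ennreal C_maj * P_norm M F p f"
    unfolding P_norm_def
    by (rule le_mult_INF_ennreal[OF C_maj_pos]) (use * Q_norm_le in blast)
  show "f \<in> Q_space M F p" using m ne * by (auto simp: Q_space_def)
qed

lemma Q_bounds:
  assumes f: "f \<in> Q_space M F p"
  shows "HM_norm M p f \<le> ennreal C_norm * Q_norm M F p f"
    and "Hs_norm M F p f \<le> ennreal C_norm * Q_norm M F p f"
    and "P_norm M F p f \<le> ennreal C_maj * Q_norm M F p f"
    and "f \<in> P_space M F p"
proof -
  have m: "martingale M F f" and ne: "Q_majorants M F p f \<noteq> {}" using f by (auto simp: Q_space_def)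
  note ctrl = controls_of_Q_majorant[OF m]
  show "HM_norm M p f \<le> ennreal C_norm * Q_norm M F p f"
    unfolding Q_norm_def HM_norm_eq
    by (rule le_mult_INF_ennreal[OF C_norm_pos]) (rule mx.run_sup_le_of_controls[OF ctrl])
  show "Hs_norm M F p f \<le> ennreal C_norm * Q_norm M F p f"
    unfolding Q_norm_def Hs_norm_def
    by (rule le_mult_INF_ennreal[OF C_norm_pos]) (rule cond_square_le_of_controls[OF ctrl])
  have *: "\<exists>r\<in>P_majorants M F p f. Lp_norm M p (lambda_inf r) \<le> ennreal C_maj * Lp_norm M p (lambda_inf l)"
    if l: "l \<in> Q_majorants M F p f" for l
  proof -
    obtain r where r: "r \<in> Lambda M F" "\<And>n. AE x in M. mx.run f (Suc n) x \<le> r n x"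
      "Lp_norm M p (lambda_inf r) \<le> ennreal C_maj * Lp_norm M p (lambda_inf l)"
      using mx.majorant_of_controls[OF ctrl[OF l]] by blast
    have "Lp_norm M p (lambda_inf r) < \<infinity>"
      using r(3) majorant_finite(2)[OF l] by (auto simp: ennreal_mult_less_top intro: le_less_trans)
    then have "r \<in> P_majorants M F p f"
      using r(1,2) by (intro P_majorantsI) auto
    then show ?thesis using r(3) by blast
  qed
  show "P_norm M F p f \<le> ennreal C_maj * Q_norm M F p f"
    unfolding Q_norm_def
    by (rule le_mult_INF_ennreal[OF C_maj_pos]) (use * P_norm_le in blast)
  show "f \<in> P_space M F p" using m ne * by (auto simp: P_space_def)
qed

lemma P_norm_finite: "f \<in> P_space M F p \<Longrightarrow> P_norm M F p f < \<infinity>"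
  unfolding P_space_def P_norm_def using majorant_finite(1) by (auto simp: INF_less_iff)

lemma Q_norm_finite: "f \<in> Q_space M F p \<Longrightarrow> Q_norm M F p f < \<infinity>"
  unfolding Q_space_def Q_norm_def using majorant_finite(2) by (auto simp: INF_less_iff)

lemma Hs_bounds:
  assumes "b < 2" and f: "f \<in> Hs_space M F p"
  shows "HM_norm M p f \<le> ennreal (C_one powr (1 / a)) * Hs_norm M F p f"
    and "HS_norm M p f \<le> ennreal (C_one powr (1 / a)) * Hs_norm M F p f"
  unfolding HM_norm_eq HS_norm_eq Hs_norm_def
  using mx.run_sup_le_cond_square[OF _ assms(1)] sq.run_sup_le_cond_square[OF _ assms(1)] f
  by (auto simp: Hs_space_def)

end

context regular_exponent
begin

sublocale rmx: regular_path M F p a b K B lo hi run_max R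
  by unfold_locales

sublocale rsq: regular_path M F p a b K B lo hi run_sq R
  by unfold_locales

lemma C_pred_pos: "0 < C_pred"
  using C_reg_ge_1[of R "1 / (2 * R)"] R by (simp add: C_pred_def)

lemma C_hs_pos: "0 < C_hs"
  using R by (simp add: C_hs_def)

lemma HM_regular:
  assumes f: "f \<in> HM_space M F p"
  shows "f \<in> P_space M F p" "P_norm M F p f \<le> ennreal C_pred * HM_norm M p f"
proof -
  have m: "martingale M F f" and fin: "Lp_norm M p (mx.run_sup f) < \<infinity>"
    using f by (auto simp: HM_space_def HM_norm_eq)
  obtain r where r: "r \<in> Lambda M F" "\<And>n. AE x in M. mx.run f (Suc n) x \<le> r n x"
    "Lp_norm M p (lambda_inf r) \<le> ennreal C_pred * Lp_norm M p (mx.run_sup f)"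
    using rmx.majorant_of_run_sup[OF m] by blast
  have "Lp_norm M p (lambda_inf r) < \<infinity>"
    using r(3) fin by (auto simp: ennreal_mult_less_top intro: le_less_trans)
  then have P: "r \<in> P_majorants M F p f" using r(1,2) by (intro P_majorantsI) auto
  then show "f \<in> P_space M F p" using m by (auto simp: P_space_def)
  show "P_norm M F p f \<le> ennreal C_pred * HM_norm M p f"
    unfolding HM_norm_eq by (rule P_norm_le[OF P r(3)])
qed

lemma HS_regular:
  assumes f: "f \<in> HS_space M F p"
  shows "f \<in> Q_space M F p" "Q_norm M F p f \<le> ennreal C_pred * HS_norm M p f"
proof -
  have m: "martingale M F f" and fin: "Lp_norm M p (sq.run_sup f) < \<infinity>"
    using f by (auto simp: HS_space_def HS_norm_eq)
  obtain r where r: "r \<in> Lambda M F" "\<And>n. AE x in M. sq.run f (Suc n) x \<le> r n x"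
    "Lp_norm M p (lambda_inf r) \<le> ennreal C_pred * Lp_norm M p (sq.run_sup f)"
    using rsq.majorant_of_run_sup[OF m] by blast
  have "Lp_norm M p (lambda_inf r) < \<infinity>"
    using r(3) fin by (auto simp: ennreal_mult_less_top intro: le_less_trans)
  then have P: "r \<in> Q_majorants M F p f"
    using r(1,2) by (intro Q_majorantsI) (auto simp: sq.run_def square_fn_upto_eq)
  then show "f \<in> Q_space M F p" using m by (auto simp: Q_space_def)
  show "Q_norm M F p f \<le> ennreal C_pred * HS_norm M p f"
    unfolding HS_norm_eq by (rule Q_norm_le[OF P r(3)])
qed

lemma Hs_regular:
  assumes f: "f \<in> Hs_space M F p"
  shows "f \<in> Q_space M F p" "Q_norm M F p f \<le> ennreal C_hs * Hs_norm M F p f"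
proof -
  have m: "martingale M F f" and fin: "Lp_norm M p (cond_square_fn M F f) < \<infinity>"
    using f by (auto simp: Hs_space_def Hs_norm_def)
  obtain r where r: "r \<in> Lambda M F" "\<And>n. AE x in M. square_fn_upto f (Suc n) x \<le> r n x"
    "Lp_norm M p (lambda_inf r) \<le> ennreal C_hs * Lp_norm M p (cond_square_fn M F f)"
    using square_majorant_of_cond_square[OF m fin] by blast
  have "Lp_norm M p (lambda_inf r) < \<infinity>"
    using r(3) fin by (auto simp: ennreal_mult_less_top intro: le_less_trans)
  then have P: "r \<in> Q_majorants M F p f" using r(1,2) by (intro Q_majorantsI) auto
  then show "f \<in> Q_space M F p" using m by (auto simp: Q_space_def)
  show "Q_norm M F p f \<le> ennreal C_hs * Hs_norm M F p f"
    unfolding Hs_norm_def by (rule Q_norm_le[OF P r(3)])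
qed

lemma spaces_eq:
  "HS_space M F p = Q_space M F p" "Q_space M F p = P_space M F p"
  "P_space M F p = HM_space M F p" "HM_space M F p = Hs_space M F p"
proof -
  have QP: "Q_space M F p = P_space M F p" using Q_bounds(4) P_bounds(4) by blast
  have "f \<in> HS_space M F p" if f: "f \<in> Q_space M F p" for f
  proof -
    have "martingale M F f" using f by (simp add: Q_space_def)
    moreover have "HS_norm M p f < \<infinity>" using HS_le_Q[OF f] Q_norm_finite[OF f] by (rule le_less_trans)
    ultimately show ?thesis by (simp add: HS_space_def)
  qed
  then show "HS_space M F p = Q_space M F p" using HS_regular(1) by blast
  have PM: "f \<in> HM_space M F p" if f: "f \<in> P_space M F p" for f
  proof -
    have "martingale M F f" using f by (simp add: P_space_def)
    moreover have "HM_norm M p f < \<infinity>" using HM_le_P[OF f] P_norm_finite[OF f] by (rule le_less_trans)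
    ultimately show ?thesis by (simp add: HM_space_def)
  qed
  then show PHM: "P_space M F p = HM_space M F p" using HM_regular(1) by blast
  have "f \<in> Hs_space M F p" if f: "f \<in> P_space M F p" for f
  proof -
    have "martingale M F f" using f by (simp add: P_space_def)
    moreover have "Hs_norm M F p f < \<infinity>"
      using P_bounds(2)[OF f] P_norm_finite[OF f] by (auto simp: ennreal_mult_less_top intro: le_less_trans)
    ultimately show ?thesis by (simp add: Hs_space_def)
  qed
  then show "HM_space M F p = Hs_space M F p" using Hs_regular(1) QP PHM by blast
  show "Q_space M F p = P_space M F p" by (rule QP)
qed

lemma norms_equivalent:
  "equivalent_on (HS_space M F p) (HS_norm M p) (Q_norm M F p)"
  "equivalent_on (HS_space M F p) (Q_norm M F p) (P_norm M F p)"
  "equivalent_on (HS_space M F p) (P_norm M F p) (HM_norm M p)"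
  "equivalent_on (HS_space M F p) (HM_norm M p) (Hs_norm M F p)"
proof -
  have sp: "f \<in> Q_space M F p" "f \<in> P_space M F p" "f \<in> HM_space M F p" "f \<in> Hs_space M F p"
    if "f \<in> HS_space M F p" for f
    using that spaces_eq by auto
  show "equivalent_on (HS_space M F p) (HS_norm M p) (Q_norm M F p)"
    by (rule equivalent_onI[where A = 1 and C = C_pred]) (use C_pred_pos HS_le_Q HS_regular sp in auto)
  show "equivalent_on (HS_space M F p) (Q_norm M F p) (P_norm M F p)"
    by (rule equivalent_onI[where A = C_maj and C = C_maj]) (use C_maj_pos P_bounds(3) Q_bounds(3) sp in auto)
  show "equivalent_on (HS_space M F p) (P_norm M F p) (HM_norm M p)"
    by (rule equivalent_onI[where A = C_pred and C = 1]) (use C_pred_pos HM_le_P HM_regular sp in auto)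
  show "equivalent_on (HS_space M F p) (HM_norm M p) (Hs_norm M F p)"
  proof (rule equivalent_onI[where A = "C_norm * C_hs" and C = "C_norm * C_pred"])
    fix f assume f: "f \<in> HS_space M F p"
    have "HM_norm M p f \<le> ennreal C_norm * Q_norm M F p f" by (rule Q_bounds(1)[OF sp(1)[OF f]])
    also have "\<dots> \<le> ennreal C_norm * (ennreal C_hs * Hs_norm M F p f)"
      by (rule mult_left_mono[OF Hs_regular(2)[OF sp(4)[OF f]]]) simp
    finally show "HM_norm M p f \<le> ennreal (C_norm * C_hs) * Hs_norm M F p f"
      using C_norm_pos C_hs_pos by (simp add: ennreal_mult mult.assoc)
    have "Hs_norm M F p f \<le> ennreal C_norm * P_norm M F p f" by (rule P_bounds(2)[OF sp(2)[OF f]])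
    also have "\<dots> \<le> ennreal C_norm * (ennreal C_pred * HM_norm M p f)"
      by (rule mult_left_mono[OF HM_regular(2)[OF sp(3)[OF f]]]) simp
    finally show "Hs_norm M F p f \<le> ennreal (C_norm * C_pred) * HM_norm M p f"
      using C_norm_pos C_pred_pos by (simp add: ennreal_mult mult.assoc)
  qed (use C_norm_pos C_hs_pos C_pred_pos in auto)
qed

end

theorem theorem4p5:
  fixes M :: "'a measure" and F :: "nat \<Rightarrow> 'a measure" and p :: "'a \<Rightarrow> real" and K :: real
  assumes "prob_space M" and "complete_measure M"
    and "filtration (space M) F"
    and "\<And>n. subalgebra M (F n)"
    and "sets M = sigma_sets (space M) ((\<Union>n. sets (F n)) \<union> null_sets M)"
    and "\<And>n. generated_by_countably_many_atoms M (F n)"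
    and "p \<in> borel_measurable M" and "\<And>x. x \<in> space M \<Longrightarrow> 0 < p x"
    and "0 < p_minus M p (space M)"
    and "p_minus M p (space M) \<le> p_plus M p (space M)"
    and "p_plus M p (space M) < \<infinity>"
    and "1 \<le> K"
    and "\<And>n A. is_atom M (F n) A \<Longrightarrow>
           measure M A powr (real_of_ereal (p_minus M p A) - real_of_ereal (p_plus M p A)) \<le> K"
  shows
    "(p_plus M p (space M) < 2 \<longrightarrow>
        (\<exists>C::real. 0 < C \<and> (\<forall>f\<in>Hs_space M F p. HM_norm M p f \<le> ennreal C * Hs_norm M F p f)) \<and>
        (\<exists>C::real. 0 < C \<and> (\<forall>f\<in>Hs_space M F p. HS_norm M p f \<le> ennreal C * Hs_norm M F p f)))
     \<and>
     ((\<forall>f\<in>P_space M F p. HM_norm M p f \<le> P_norm M F p f) \<and>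
      (\<forall>f\<in>Q_space M F p. HS_norm M p f \<le> Q_norm M F p f))
     \<and>
     ((\<exists>C::real. 0 < C \<and> (\<forall>f\<in>P_space M F p. HS_norm M p f \<le> ennreal C * P_norm M F p f)) \<and>
      (\<exists>C::real. 0 < C \<and> (\<forall>f\<in>Q_space M F p. HM_norm M p f \<le> ennreal C * Q_norm M F p f)))
     \<and>
     ((\<exists>C::real. 0 < C \<and> (\<forall>f\<in>P_space M F p. Hs_norm M F p f \<le> ennreal C * P_norm M F p f)) \<and>
      (\<exists>C::real. 0 < C \<and> (\<forall>f\<in>Q_space M F p. Hs_norm M F p f \<le> ennreal C * Q_norm M F p f)))
     \<and>
     ((\<exists>C::real. 0 < C \<and> (\<forall>f\<in>Q_space M F p. P_norm M F p f \<le> ennreal C * Q_norm M F p f)) \<and>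
      (\<exists>C::real. 0 < C \<and> (\<forall>f\<in>P_space M F p. Q_norm M F p f \<le> ennreal C * P_norm M F p f)))
     \<and>
     (regular_filtration M F \<longrightarrow>
        HS_space M F p = Q_space M F p \<and> Q_space M F p = P_space M F p \<and>
        P_space M F p = HM_space M F p \<and> HM_space M F p = Hs_space M F p \<and>
        equivalent_on (HS_space M F p) (HS_norm M p) (Q_norm M F p) \<and>
        equivalent_on (HS_space M F p) (Q_norm M F p) (P_norm M F p) \<and>
        equivalent_on (HS_space M F p) (P_norm M F p) (HM_norm M p) \<and>
        equivalent_on (HS_space M F p) (HM_norm M p) (Hs_norm M F p))"
proof -
  interpret prob_space M by fact
  interpret filt: filtration "space M" F by fact
  have filtered: "filtered_prob M F"
    by unfold_locales (use assms(4) filt.sets_F_mono in auto)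
  have pm: "p \<in> borel_measurable M" by fact
  define a where "a = real_of_ereal (p_minus M p (space M))"
  define b where "b = real_of_ereal (p_plus M p (space M))"
  have ea: "p_minus M p (space M) = ereal a" and eb: "p_plus M p (space M) = ereal b"
    using assms(9-11) unfolding a_def b_def
    by (cases "p_minus M p (space M)"; cases "p_plus M p (space M)"; simp)+
  have a0: "0 < a" and ab: "a \<le> b" using assms(9,10) by (auto simp: ea eb)
  have pab: "AE x in M. a \<le> p x \<and> p x \<le> b"
    using AE_le_p_plus[OF sets.top pm] AE_p_minus_le[OF sets.top pm] AE_space
    by eventually_elim (simp add: ea eb)
  have "\<exists>B :: nat \<Rightarrow> 'a set. (\<forall>i. B i \<in> sets (F n)) \<and> disjoint_family B \<and> (\<Union>i. B i) = space M \<and>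
      (\<forall>i A. A \<in> sets (F n) \<longrightarrow> A \<subseteq> B i \<longrightarrow> measure M A = 0 \<or> measure M A = measure M (B i))" for n
    by (rule exists_indivisible_partition[OF assms(4,6)[of n]]) blast
  then obtain B :: "nat \<Rightarrow> nat \<Rightarrow> 'a set" where B: "\<And>n i. B n i \<in> sets (F n)" "\<And>n. disjoint_family (B n)"
    "\<And>n. (\<Union>i. B n i) = space M"
    "\<And>n i A. A \<in> sets (F n) \<Longrightarrow> A \<subseteq> B n i \<Longrightarrow> measure M A = 0 \<or> measure M A = measure M (B n i)"
    by metis
  have BM: "B n i \<in> sets M" for n i using B(1)[of n i] assms(4)[of n] by (auto simp: subalgebra_def)
  define lo where "lo n i = real_of_ereal (p_minus M p (B n i))" for n i
  define hi where "hi n i = real_of_ereal (p_plus M p (B n i))" for n i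
  \<comment> \<open>On a set of positive measure the essential bounds lie between those of the whole space, hence are finite.\<close>
  have lohi: "p_minus M p (B n i) = ereal (lo n i) \<and> p_plus M p (B n i) = ereal (hi n i) \<and> a \<le> lo n i \<and> hi n i \<le> b"
    if pos: "0 < measure M (B n i)" for n i
  proof -
    have "\<exists>x. x \<in> B n i \<and> a \<le> p x \<and> p x \<le> b \<and> ereal (p x) \<le> p_plus M p (B n i) \<and> p_minus M p (B n i) \<le> ereal (p x)"
    proof (rule ccontr)
      assume no: "\<not> ?thesis"
      have "AE x in M. x \<notin> B n i"
        using pab AE_le_p_plus[OF BM[of n i] pm] AE_p_minus_le[OF BM[of n i] pm]
        by eventually_elim (use no in blast)
      then have "measure M (B n i) = 0" using prob_eq_0[OF BM[of n i]] by simp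
      then show False using pos by simp
    qed
    then obtain x where x: "ereal (p x) \<le> p_plus M p (B n i)" "p_minus M p (B n i) \<le> ereal (p x)" by blast
    have "p_plus M p (B n i) \<le> ereal b"
      by (rule p_plus_leI[OF BM pm]) (use pab in eventually_elim, simp)
    moreover have "ereal a \<le> p_minus M p (B n i)"
      by (rule p_minus_geI[OF BM pm]) (use pab in eventually_elim, simp)
    ultimately show ?thesis
      using x unfolding lo_def hi_def
      by (cases "p_minus M p (B n i)"; cases "p_plus M p (B n i)") auto
  qed
  interpret atomic_exponent M F p a b K B lo hi
  proof (intro atomic_exponent.intro filtered atomic_exponent_axioms.intro pm a0 ab assms(12) pab B)
    fix n i assume pos: "0 < measure M (B n i)"
    note lh = lohi[OF pos]
    have "is_atom M (F n) (B n i)"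
      unfolding is_atom_def using B(1) pos B(4)[of _ n i] by fastforce
    from assms(13)[OF this] have "measure M (B n i) powr (lo n i - hi n i) \<le> K" using lh by simp
    moreover have "AE x in M. x \<in> B n i \<longrightarrow> lo n i \<le> p x \<and> p x \<le> hi n i"
      using AE_le_p_plus[OF BM[of n i] pm] AE_p_minus_le[OF BM[of n i] pm]
      by eventually_elim (use lh in auto)
    ultimately show "a \<le> lo n i \<and> hi n i \<le> b \<and> (AE x in M. x \<in> B n i \<longrightarrow> lo n i \<le> p x \<and> p x \<le> hi n i)
      \<and> measure M (B n i) powr (lo n i - hi n i) \<le> K" using lh by blast
    fix c assume "AE x in M. x \<in> B n i \<longrightarrow> p x \<le> c"
    then have "p_plus M p (B n i) \<le> ereal c" by (rule p_plus_leI[OF BM pm])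
    then show "hi n i \<le> c" using lh by simp
  qed
  have regular: "HS_space M F p = Q_space M F p \<and> Q_space M F p = P_space M F p \<and>
        P_space M F p = HM_space M F p \<and> HM_space M F p = Hs_space M F p \<and>
        equivalent_on (HS_space M F p) (HS_norm M p) (Q_norm M F p) \<and>
        equivalent_on (HS_space M F p) (Q_norm M F p) (P_norm M F p) \<and>
        equivalent_on (HS_space M F p) (P_norm M F p) (HM_norm M p) \<and>
        equivalent_on (HS_space M F p) (HM_norm M p) (Hs_norm M F p)"
    if reg: "regular_filtration M F"
  proof -
    obtain R where R: "\<And>n A. 1 \<le> n \<Longrightarrow> A \<in> sets (F n) \<Longrightarrow>
        \<exists>C\<in>sets (F (n - 1)). A \<subseteq> C \<and> measure M C \<le> R * measure M A"
      using reg unfolding regular_filtration_def by blast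
    interpret regular_exponent M F p a b K B lo hi "max 1 R"
    proof
      fix A n assume "A \<in> sets (F (Suc n))"
      then obtain C where "C \<in> sets (F n)" "A \<subseteq> C" "measure M C \<le> R * measure M A"
        using R[of "Suc n" A] by auto
      moreover have "R * measure M A \<le> max 1 R * measure M A" by (rule mult_right_mono) auto
      ultimately show "\<exists>C\<in>sets (F n). A \<subseteq> C \<and> measure M C \<le> max 1 R * measure M A"
        by (meson order_trans)
    qed simp
    show ?thesis using spaces_eq norms_equivalent by blast
  qed
  have small: "(\<exists>C::real. 0 < C \<and> (\<forall>f\<in>Hs_space M F p. HM_norm M p f \<le> ennreal C * Hs_norm M F p f)) \<and>
    (\<exists>C::real. 0 < C \<and> (\<forall>f\<in>Hs_space M F p. HS_norm M p f \<le> ennreal C * Hs_norm M F p f))"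
    if "p_plus M p (space M) < 2"
  proof -
    have b2: "b < 2" using that by (simp add: eb)
    have "0 < C_one powr (1 / a)" using C_one_ge_1[OF b2] by simp
    then show ?thesis using Hs_bounds[OF b2] by blast
  qed
  have bound: "\<exists>C::real. 0 < C \<and> (\<forall>f\<in>X. N f \<le> ennreal C * N' f)"
    if "0 < D" "\<And>f. f \<in> X \<Longrightarrow> N f \<le> ennreal D * N' f" for D X and N N' :: "(nat \<Rightarrow> 'a \<Rightarrow> real) \<Rightarrow> ennreal"
    using that by blast
  show ?thesis
    by (intro conjI impI ballI small[THEN conjunct1] small[THEN conjunct2] HM_le_P HS_le_Q
        bound[OF C_norm_pos P_bounds(1)] bound[OF C_norm_pos Q_bounds(1)]
        bound[OF C_norm_pos P_bounds(2)] bound[OF C_norm_pos Q_bounds(2)]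
        bound[OF C_maj_pos Q_bounds(3)] bound[OF C_maj_pos P_bounds(3)])
      (use regular in auto)
qed

end
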